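(* Let $\Omega$ be a domain in a right-type group $\mathcal N_{\mathbb S}$. Let $K$ and $L$ be compact subsets of $\Omega$ such that $L$ is contained in the interior of $K$. Then there exists a constant $C$ depending only on $K,L$ such that for any $C^2$ plurisubharmonic functions $u_1,\dots,u_p$ on $\Omega$ ($1\le p\le n$), $$\|\triangle u_1\wedge\dots\wedge\triangle u_p\|_L\le C\prod_{i=1}^p\|u_i\|_{C^0(K)} .$$
   Context: Groups. Let $n\ge1$ and let $\mathbb S$ be a real symmetric $4n\times4n$ matrix. Let $I^1,I^2,I^3$ be the $4\times4$ skew matrices whose only nonzero entries above the diagonal are: $I^1_{12}=1,\ I^1_{34}=-1$; $I^2_{13}=1,\ I^2_{24}=1$; $I^3_{14}=1,\ I^3_{23}=-1$. Put $\mathbb I^\beta=\mathrm{diag}(I^\beta,\dots,I^\beta)$ and $B^\beta=\mathbb S\mathbb I^\beta+\mathbb I^\beta\mathbb S$. $\mathcal N_{\mathbb S}$ is $\mathbb R^{4n}\times\mathbb R^3$ with $(\mathbf x,\mathbf t)(\mathbf y,\mathbf s)=(\mathbf x+\mathbf y,\ t_\beta+s_\beta+2\sum_{a,b}B^\beta_{ab}x_ay_b)$; $X_b=\partial_{x_b}+2\sum_{\beta,a}B^\beta_{ab}x_a\partial_{t_\beta}$, $b=1,\dots,4n$. Right-type. With $\nabla_{2l}^{0'}=-\partial_{x_{4l+3}}-\mathbf i\partial_{x_{4l+4}}$, $\nabla_{2l}^{1'}=-\partial_{x_{4l+1}}-\mathbf i\partial_{x_{4l+2}}$, $\nabla_{2l+1}^{0'}=\partial_{x_{4l+1}}-\mathbf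 i\partial_{x_{4l+2}}$, $\nabla_{2l+1}^{1'}=-\partial_{x_{4l+3}}+\mathbf i\partial_{x_{4l+4}}$ ($l=0,\dots,n-1$), $\phi(\mathbf x)=\sum_{a,b}\mathbb S_{ab}x_ax_b$, and a basis $\omega^0,\dots,\omega^{2n-1}$ of $\mathbb C^{2n}$, the group is right-type if $\sum_{A,B}(\nabla_A^{0'}\nabla_B^{1'}\phi)\,\omega^A\wedge\omega^B=0$. Operators. $Z_{(2l)0'}=X_{4l+1}+\mathbf iX_{4l+2}$, $Z_{(2l)1'}=-X_{4l+3}-\mathbf iX_{4l+4}$, $Z_{(2l+1)0'}=X_{4l+3}-\mathbf iX_{4l+4}$, $Z_{(2l+1)1'}=X_{4l+1}-\mathbf iX_{4l+2}$; for $F=\sum f_{\mathbf A}\omega^{\mathbf A}$, $\mathfrak d_{A'}F=\sum_{A,\mathbf A}Z_{AA'}f_{\mathbf A}\,\omega^A\wedge\omega^{\mathbf A}$, $A'=0',1'$; $\triangle u=\mathfrak d_{0'}\mathfrak d_{1'}u$. Positivity. $\Omega_{2n}=\omega^0\wedge\dots\wedge\omega^{2n-1}$; a $2n$-element is positive if it is a nonnegative multiple of $\Omega_{2n}$, and $\int_\Omega f\,\Omega_{2n}:=\int_\Omega f\,dV$ with Lebesgue measure $dV$. Let $\tau$ map a quaternionic matrix to a complex one by replacing each entry $x_1+x_2\mathbf i+x_3\mathbf j+x_4\mathbf k$ by $\begin{pmatrix} x_1+\mathbf ix_2 & -x_3-\mathbf ix_4 \\ x_3-\mathbf ix_4 &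 x_1-\mathbf ix_2 \end{pmatrix}$. A right $\mathbb H$-linear $\eta:\mathbb H^n\to\mathbb H$ is given by a row vector $a\in\mathbb H^{1\times n}$; for a basis $\widetilde\omega^0,\widetilde\omega^1$ of $\mathbb C^2$ put $\eta^*\widetilde\omega^p=\sum_{B=0}^{2n-1}\tau(a)_{pB}\,\omega^B$. A $2p$-element is elementary strongly positive if it is $\eta_1^*\widetilde\omega^0\wedge\eta_1^*\widetilde\omega^1\wedge\dots\wedge\eta_p^*\widetilde\omega^0\wedge\eta_p^*\widetilde\omega^1$ with $\eta_1,\dots,\eta_p$ linearly independent right $\mathbb H$-linear maps; strongly positive elements form the convex cone generated by these. A $2p$-element $\omega$ is positive if $\omega\wedge\eta$ is positive for every strongly positive $(2n-2p)$-element $\eta$. A $p$-current is a continuous linear functional on $C_0^\infty(\Omega,\wedge^{2n-p}\mathbb C^{2n})$; $(\mathfrak d_{A'}F)(\eta):=-F(\mathfrak d_{A'}\eta)$; $F$ is closed if $\mathfrak d_{0'}F=\mathfrak d_{1'}F=0$. A $2p$-current is positive if it is $\ge0$ on strongly positive test forms. A $[-\infty,\infty)$-valued upper semicontinuous function $u$ is plurisubharmonic if it is $L^1_{\rm loc}$ and $\triangle u$ is a closed positive $2$-current; for $u\in C^2$, $\triangle u$ is then a closed strongly positive $2$-form. Norm. $\beta_n=\sum_{l=0}^{n-1}\omega^{2l}\wedge\omega^{2l+1}$, and for a positive $(2n-2p)$-form $T$ and compact $K$, $\|T\|_K=\int_KT\wedge\beta_n^p$. Hence the left side of the claim is $\int_L\triangle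 u_1\wedge\dots\wedge\triangle u_p\wedge\beta_n^{n-p}$.
   Formalization: The differential of a p-current is taken with sign (-1)^(p+1) rather than always -1, so that for C^2 functions the current △u agrees with the form △u; with -1 in all degrees, C^2 plurisubharmonic functions would have negative △u. *)

theory Defs
  imports "HOL-Analysis.Analysis" "HOL-Library.Complex_Order"
begin

section \<open>Conventions\<close>

text \<open>
  \<^item> The integer n is the cardinality of a finite linearly ordered type \<open>'n\<close>, whose elements play
    the role of the block index l = 0, ..., n - 1. The coordinate of index 4l + j
    (j = 1, ..., 4) is indexed by the pair \<open>(l, j) :: 'n \<times> 4\<close>; recall that the type \<open>4\<close> has
    exactly the elements 1, 2, 3 and 4 = 0.
  \<^item> The indices 2l and 2l + 1 in {0, ..., 2n - 1} are \<open>(l, False)\<close> and \<open>(l, True)\<close>.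
  \<^item> An element of the exterior algebra of \<open>\<complex>\<^sup>2\<^sup>n\<close> is the vector of its coefficients: the component
    at \<open>I\<close> belongs to the wedge product of the \<open>\<omega>\<^sup>A\<close>, \<open>A \<in> I\<close>, taken in increasing order.
\<close>

type_synonym 'n idx = "'n \<times> bool"
type_synonym 'n grp = "(real ^ ('n \<times> 4)) \<times> (real ^ 3)"
type_synonym 'n ext = "complex ^ ('n idx set)"

section \<open>The exterior algebra\<close>

definition idx_less :: "'n::linorder idx \<Rightarrow> 'n idx \<Rightarrow> bool" where
  "idx_less A B \<longleftrightarrow> fst A < fst B \<or> (fst A = fst B \<and> \<not> snd A \<and> snd B)"

text \<open>The sign of the permutation that sorts \<open>I\<close> followed by \<open>J\<close>, for disjoint \<open>I\<close> and \<open>J\<close>.\<close>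

definition shuffle_sign :: "'n::linorder idx set \<Rightarrow> 'n idx set \<Rightarrow> complex" where
  "shuffle_sign I J = (-1) ^ card {(A, B). A \<in> I \<and> B \<in> J \<and> idx_less B A}"

definition wedge :: "'n::{finite,linorder} ext \<Rightarrow> 'n ext \<Rightarrow> 'n ext"  (infixr "\<curlywedge>" 70) where
  "v \<curlywedge> w = (\<chi> M. \<Sum>I\<in>Pow M. shuffle_sign I (M - I) * (v $ I) * (w $ (M - I)))"

definition omega_set :: "'n::{finite,linorder} idx set \<Rightarrow> 'n ext" where
  "omega_set I = axis I 1"

definition omega :: "'n::{finite,linorder} idx \<Rightarrow> 'n ext" where
  "omega A = omega_set {A}"

definition ext_one :: "'n::{finite,linorder} ext" where
  "ext_one = omega_set {}"

definition wedge_list :: "'n::{finite,linorder} ext list \<Rightarrow> 'n ext" where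
  "wedge_list ws = foldr (\<curlywedge>) ws ext_one"

definition ext_degree :: "nat \<Rightarrow> 'n::{finite,linorder} ext \<Rightarrow> bool" where
  "ext_degree k w \<longleftrightarrow> (\<forall>I. w $ I \<noteq> 0 \<longrightarrow> card I = k)"

text \<open>The coefficient of \<open>\<Omega>\<^sub>2\<^sub>n\<close>, the wedge product of all \<open>\<omega>\<^sup>A\<close> in increasing order.\<close>

definition top_coeff :: "'n::{finite,linorder} ext \<Rightarrow> complex" where
  "top_coeff w = w $ UNIV"

definition beta_form :: "'n::{finite,linorder} ext" where
  "beta_form = (\<Sum>l\<in>UNIV. omega (l, False) \<curlywedge> omega (l, True))"

section \<open>Differentiability classes\<close>

text \<open>Intended for open \<open>U\<close>.\<close>

primrec Ck_on :: "nat \<Rightarrow> ('a::euclidean_space \<Rightarrow> 'b::real_normed_vector) \<Rightarrow> 'a set \<Rightarrow> bool" where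
  "Ck_on 0 f U \<longleftrightarrow> continuous_on U f"
| "Ck_on (Suc k) f U \<longleftrightarrow>
     (\<forall>x\<in>U. f differentiable (at x)) \<and> (\<forall>v. Ck_on k (\<lambda>x. frechet_derivative f (at x) v) U)"

definition iter_deriv ::
  "'a::euclidean_space list \<Rightarrow> ('a \<Rightarrow> 'b::real_normed_vector) \<Rightarrow> 'a \<Rightarrow> 'b" where
  "iter_deriv vs f = foldr (\<lambda>v g x. frechet_derivative g (at x) v) vs f"

section \<open>The group and its vector fields\<close>

definition I_upper :: "3 \<Rightarrow> real ^ 4 ^ 4" where
  "I_upper \<beta> = (\<chi> i j.
     if \<beta> = 1 then (if (i, j) = (1, 2) then 1 else if (i, j) = (3, 4) then -1 else 0)
     else if \<beta> = 2 then (if (i, j) = (1, 3) \<or> (i, j) = (2, 4) then 1 else 0)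
     else (if (i, j) = (1, 4) then 1 else if (i, j) = (2, 3) then -1 else 0))"

definition I_mat :: "3 \<Rightarrow> real ^ 4 ^ 4" where
  "I_mat \<beta> = I_upper \<beta> - transpose (I_upper \<beta>)"

definition I_diag :: "3 \<Rightarrow> real ^ ('n::finite \<times> 4) ^ ('n \<times> 4)" where
  "I_diag \<beta> = (\<chi> a b. if fst a = fst b then I_mat \<beta> $ snd a $ snd b else 0)"

definition B_mat ::
  "real ^ ('n::finite \<times> 4) ^ ('n \<times> 4) \<Rightarrow> 3 \<Rightarrow> real ^ ('n \<times> 4) ^ ('n \<times> 4)" where
  "B_mat S \<beta> = S ** I_diag \<beta> + I_diag \<beta> ** S"

definition grp_mult ::
  "real ^ ('n::finite \<times> 4) ^ ('n \<times> 4) \<Rightarrow> 'n grp \<Rightarrow> 'n grp \<Rightarrow> 'n grp" where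
  "grp_mult S g h = (fst g + fst h,
     \<chi> \<beta>. snd g $ \<beta> + snd h $ \<beta>
        + 2 * (\<Sum>a\<in>UNIV. \<Sum>b\<in>UNIV. B_mat S \<beta> $ a $ b * fst g $ a * fst h $ b))"

definition dx :: "'n::finite \<times> 4 \<Rightarrow> ('n grp \<Rightarrow> complex) \<Rightarrow> 'n grp \<Rightarrow> complex" where
  "dx b f q = frechet_derivative f (at q) (axis b 1, 0)"

definition dt :: "3 \<Rightarrow> ('n::finite grp \<Rightarrow> complex) \<Rightarrow> 'n grp \<Rightarrow> complex" where
  "dt \<beta> f q = frechet_derivative f (at q) (0, axis \<beta> 1)"

text \<open>The left-invariant field of \<open>grp_mult S\<close> that equals the partial derivative of index \<open>b\<close> at the
  origin.\<close>

definition X_field :: "real ^ ('n::finite \<times> 4) ^ ('n \<times> 4) \<Rightarrow> 'n \<times> 4 \<Rightarrow>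
    ('n grp \<Rightarrow> complex) \<Rightarrow> 'n grp \<Rightarrow> complex" where
  "X_field S b f q = dx b f q
     + 2 * (\<Sum>\<beta>\<in>UNIV. \<Sum>a\<in>UNIV. of_real (B_mat S \<beta> $ a $ b * fst q $ a) * dt \<beta> f q)"

section \<open>Right-type groups\<close>

definition pd :: "'m::finite \<Rightarrow> (real ^ 'm \<Rightarrow> complex) \<Rightarrow> real ^ 'm \<Rightarrow> complex" where
  "pd b f x = frechet_derivative f (at x) (axis b 1)"

definition nabla0 :: "'n::finite idx \<Rightarrow> (real ^ ('n \<times> 4) \<Rightarrow> complex) \<Rightarrow>
    real ^ ('n \<times> 4) \<Rightarrow> complex" where
  "nabla0 A f x = (case A of (l, b) \<Rightarrow>
     if \<not> b then - pd (l, 3) f x - \<i> * pd (l, 4) f x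
     else pd (l, 1) f x - \<i> * pd (l, 2) f x)"

definition nabla1 :: "'n::finite idx \<Rightarrow> (real ^ ('n \<times> 4) \<Rightarrow> complex) \<Rightarrow>
    real ^ ('n \<times> 4) \<Rightarrow> complex" where
  "nabla1 A f x = (case A of (l, b) \<Rightarrow>
     if \<not> b then - pd (l, 1) f x - \<i> * pd (l, 2) f x
     else - pd (l, 3) f x + \<i> * pd (l, 4) f x)"

definition phi_quad :: "real ^ ('n::finite \<times> 4) ^ ('n \<times> 4) \<Rightarrow> real ^ ('n \<times> 4) \<Rightarrow> complex" where
  "phi_quad S x = of_real (\<Sum>a\<in>UNIV. \<Sum>b\<in>UNIV. S $ a $ b * x $ a * x $ b)"

definition right_type ::
  "real ^ ('n::{finite,linorder} \<times> 4) ^ ('n \<times> 4) \<Rightarrow> bool" where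
  "right_type S \<longleftrightarrow>
     (\<forall>x. (\<Sum>A\<in>UNIV. \<Sum>B\<in>UNIV. nabla0 A (nabla1 B (phi_quad S)) x *s (omega A \<curlywedge> omega B)) = 0)"

section \<open>The operators\<close>

definition Z0 :: "real ^ ('n::finite \<times> 4) ^ ('n \<times> 4) \<Rightarrow> 'n idx \<Rightarrow>
    ('n grp \<Rightarrow> complex) \<Rightarrow> 'n grp \<Rightarrow> complex" where
  "Z0 S A f q = (case A of (l, b) \<Rightarrow>
     if \<not> b then X_field S (l, 1) f q + \<i> * X_field S (l, 2) f q
     else X_field S (l, 3) f q - \<i> * X_field S (l, 4) f q)"

definition Z1 :: "real ^ ('n::finite \<times> 4) ^ ('n \<times> 4) \<Rightarrow> 'n idx \<Rightarrow>
    ('n grp \<Rightarrow> complex) \<Rightarrow> 'n grp \<Rightarrow> complex" where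
  "Z1 S A f q = (case A of (l, b) \<Rightarrow>
     if \<not> b then - X_field S (l, 3) f q - \<i> * X_field S (l, 4) f q
     else X_field S (l, 1) f q - \<i> * X_field S (l, 2) f q)"

definition d0 :: "real ^ ('n::{finite,linorder} \<times> 4) ^ ('n \<times> 4) \<Rightarrow>
    ('n grp \<Rightarrow> 'n ext) \<Rightarrow> 'n grp \<Rightarrow> 'n ext" where
  "d0 S F q = (\<Sum>A\<in>UNIV. \<Sum>I\<in>UNIV. Z0 S A (\<lambda>r. F r $ I) q *s (omega A \<curlywedge> omega_set I))"

definition d1 :: "real ^ ('n::{finite,linorder} \<times> 4) ^ ('n \<times> 4) \<Rightarrow>
    ('n grp \<Rightarrow> 'n ext) \<Rightarrow> 'n grp \<Rightarrow> 'n ext" where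
  "d1 S F q = (\<Sum>A\<in>UNIV. \<Sum>I\<in>UNIV. Z1 S A (\<lambda>r. F r $ I) q *s (omega A \<curlywedge> omega_set I))"

definition triangle_form :: "real ^ ('n::{finite,linorder} \<times> 4) ^ ('n \<times> 4) \<Rightarrow>
    ('n grp \<Rightarrow> real) \<Rightarrow> 'n grp \<Rightarrow> 'n ext" where
  "triangle_form S u = d0 S (d1 S (\<lambda>q. of_real (u q) *s ext_one))"

section \<open>Strongly positive elements\<close>

text \<open>The quaternion \<open>x\<^sub>1 + x\<^sub>2 i + x\<^sub>3 j + x\<^sub>4 k\<close> is the vector of its four coordinates.\<close>

definition qmult :: "real ^ 4 \<Rightarrow> real ^ 4 \<Rightarrow> real ^ 4" where
  "qmult x y = vector
     [x$1 * y$1 - x$2 * y$2 - x$3 * y$3 - x$4 * y$4,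
      x$1 * y$2 + x$2 * y$1 + x$3 * y$4 - x$4 * y$3,
      x$1 * y$3 - x$2 * y$4 + x$3 * y$1 + x$4 * y$2,
      x$1 * y$4 + x$2 * y$3 - x$3 * y$2 + x$4 * y$1]"

text \<open>The right \<open>\<H>\<close>-linear map given by a row vector \<open>a\<close>. Such maps form a left \<open>\<H>\<close>-module, so
  linear independence is taken with coefficients on the left.\<close>

definition qmap :: "(real ^ 4) ^ 'n::finite \<Rightarrow> (real ^ 4) ^ 'n \<Rightarrow> real ^ 4" where
  "qmap a v = (\<Sum>l\<in>UNIV. qmult (a $ l) (v $ l))"

definition q_independent :: "nat \<Rightarrow> (nat \<Rightarrow> (real ^ 4) ^ 'n::finite) \<Rightarrow> bool" where
  "q_independent p a \<longleftrightarrow>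
     (\<forall>c. (\<forall>v. (\<Sum>i<p. qmult (c i) (qmap (a i) v)) = 0) \<longrightarrow> (\<forall>i<p. c i = 0))"

text \<open>Entry of the 2 by 2 block of a quaternion; \<open>False\<close> and \<open>True\<close> are the first and second
  row or column.\<close>

definition tau_entry :: "real ^ 4 \<Rightarrow> bool \<Rightarrow> bool \<Rightarrow> complex" where
  "tau_entry x r c =
     (if \<not> r then (if \<not> c then Complex (x$1) (x$2) else Complex (- x$3) (- x$4))
      else (if \<not> c then Complex (x$3) (- x$4) else Complex (x$1) (- x$2)))"

definition pullback :: "(real ^ 4) ^ 'n::{finite,linorder} \<Rightarrow> bool \<Rightarrow> 'n ext" where
  "pullback a r = (\<Sum>B\<in>UNIV. tau_entry (a $ fst B) r (snd B) *s omega B)"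

definition elementary_sp :: "nat \<Rightarrow> 'n::{finite,linorder} ext set" where
  "elementary_sp p =
     {wedge_list (map (\<lambda>i. pullback (a i) False \<curlywedge> pullback (a i) True) [0..<p]) | a.
        q_independent p a}"

definition strongly_positive :: "nat \<Rightarrow> 'n::{finite,linorder} ext set" where
  "strongly_positive p = convex_cone hull (elementary_sp p)"

section \<open>Currents\<close>

text \<open>Test forms are extended by zero to the whole group.\<close>

definition test_form :: "'n::{finite,linorder} grp set \<Rightarrow> nat \<Rightarrow> ('n grp \<Rightarrow> 'n ext) \<Rightarrow> bool" where
  "test_form \<Omega> k \<eta> \<longleftrightarrow>
     (\<forall>m. Ck_on m \<eta> UNIV) \<and> compact (closure {q. \<eta> q \<noteq> 0}) \<and> closure {q. \<eta> q \<noteq> 0} \<subseteq> \<Omega> \<and>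
     (\<forall>q. ext_degree k (\<eta> q))"

definition test_conv :: "'n::{finite,linorder} grp set \<Rightarrow>
    (nat \<Rightarrow> 'n grp \<Rightarrow> 'n ext) \<Rightarrow> ('n grp \<Rightarrow> 'n ext) \<Rightarrow> bool" where
  "test_conv \<Omega> \<eta> \<zeta> \<longleftrightarrow>
     (\<exists>K. compact K \<and> K \<subseteq> \<Omega> \<and> (\<forall>j. {q. \<eta> j q \<noteq> 0} \<subseteq> K)) \<and>
     (\<forall>vs. uniform_limit UNIV (\<lambda>j. iter_deriv vs (\<eta> j)) (iter_deriv vs \<zeta>) sequentially)"

text \<open>For a linear functional on the LF-space of test forms, continuity is the same as
  sequential continuity.\<close>

definition is_current ::
  "'n::{finite,linorder} grp set \<Rightarrow> nat \<Rightarrow> (('n grp \<Rightarrow> 'n ext) \<Rightarrow> complex) \<Rightarrow> bool" where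
  "is_current \<Omega> p T \<longleftrightarrow> (\<forall>k. k + p = 2 * CARD('n) \<longrightarrow>
     (\<forall>\<eta> \<zeta>. test_form \<Omega> k \<eta> \<longrightarrow> test_form \<Omega> k \<zeta> \<longrightarrow> T (\<lambda>q. \<eta> q + \<zeta> q) = T \<eta> + T \<zeta>) \<and>
     (\<forall>c \<eta>. test_form \<Omega> k \<eta> \<longrightarrow> T (\<lambda>q. c *s \<eta> q) = c * T \<eta>) \<and>
     (\<forall>\<eta> \<zeta>. (\<forall>j. test_form \<Omega> k (\<eta> j)) \<longrightarrow> test_form \<Omega> k \<zeta> \<longrightarrow> test_conv \<Omega> \<eta> \<zeta> \<longrightarrow>
        (\<lambda>j. T (\<eta> j)) \<longlonglongrightarrow> T \<zeta>))"

text \<open>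
  The differential of a \<open>p\<close>-current, for \<open>d\<close> one of the operators \<open>d0 S\<close>, \<open>d1 S\<close>. The formula
  \<open>(dT)(\<eta>) = - T(d\<eta>)\<close> is the one for even \<open>p\<close>. The graded sign is needed so that the differential
  of a smooth \<open>p\<close>-form \<open>F\<close>, regarded as the current \<open>\<eta> \<mapsto> \<integral> F \<and> \<eta>\<close>, is the current of the form \<open>dF\<close>:
  integrating \<open>d(F \<and> \<eta>) = dF \<and> \<eta> + (-1)\<^sup>p F \<and> d\<eta>\<close> gives \<open>\<integral> dF \<and> \<eta> = (-1)\<^sup>p\<^sup>+\<^sup>1 \<integral> F \<and> d\<eta>\<close>. With the
  sign -1 also for the 1-current \<open>d\<^sub>1u\<close>, the current \<open>d\<^sub>0d\<^sub>1u\<close> of a C2 function \<open>u\<close> would be minus the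
  form \<open>d\<^sub>0d\<^sub>1u\<close>, and the C2 functions whose current is positive would have a negative \<open>d\<^sub>0d\<^sub>1u\<close>.
  The notion of a closed current does not depend on this sign.
\<close>

definition current_diff :: "nat \<Rightarrow> (('n::{finite,linorder} grp \<Rightarrow> 'n ext) \<Rightarrow> 'n grp \<Rightarrow> 'n ext) \<Rightarrow>
    (('n grp \<Rightarrow> 'n ext) \<Rightarrow> complex) \<Rightarrow> ('n grp \<Rightarrow> 'n ext) \<Rightarrow> complex" where
  "current_diff p d T \<eta> = (-1) ^ (p + 1) * T (d \<eta>)"

definition closed_current :: "real ^ ('n::{finite,linorder} \<times> 4) ^ ('n \<times> 4) \<Rightarrow>
    'n grp set \<Rightarrow> nat \<Rightarrow> (('n grp \<Rightarrow> 'n ext) \<Rightarrow> complex) \<Rightarrow> bool" where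
  "closed_current S \<Omega> p T \<longleftrightarrow>
     (\<forall>k \<eta>. k + (p + 1) = 2 * CARD('n) \<longrightarrow> test_form \<Omega> k \<eta> \<longrightarrow>
        current_diff p (d0 S) T \<eta> = 0 \<and> current_diff p (d1 S) T \<eta> = 0)"

text \<open>Positivity of a \<open>2p\<close>-current, with the order on complex numbers for which \<open>0 \<le> z\<close> means that
  \<open>z\<close> is real and nonnegative.\<close>

definition positive_current ::
  "'n::{finite,linorder} grp set \<Rightarrow> nat \<Rightarrow> (('n grp \<Rightarrow> 'n ext) \<Rightarrow> complex) \<Rightarrow> bool" where
  "positive_current \<Omega> p T \<longleftrightarrow>
     (\<forall>k \<eta>. k + p = CARD('n) \<longrightarrow> test_form \<Omega> (2 * k) \<eta> \<longrightarrow>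
        (\<forall>q. \<eta> q \<in> strongly_positive k) \<longrightarrow> 0 \<le> T \<eta>)"

section \<open>Plurisubharmonic functions\<close>

definition is_domain :: "'a::topological_space set \<Rightarrow> bool" where
  "is_domain \<Omega> \<longleftrightarrow> open \<Omega> \<and> connected \<Omega> \<and> \<Omega> \<noteq> {}"

definition usc_on :: "'a::topological_space set \<Rightarrow> ('a \<Rightarrow> ereal) \<Rightarrow> bool" where
  "usc_on \<Omega> u \<longleftrightarrow> (\<forall>c. openin (top_of_set \<Omega>) {q \<in> \<Omega>. u q < c})"

text \<open>The first conjunct is needed since \<open>real_of_ereal\<close> maps infinite values to 0.\<close>

definition L1_loc :: "'a::euclidean_space set \<Rightarrow> ('a \<Rightarrow> ereal) \<Rightarrow> bool" where
  "L1_loc \<Omega> u \<longleftrightarrow> (AE q in lborel. q \<in> \<Omega> \<longrightarrow> \<bar>u q\<bar> \<noteq> \<infinity>) \<and>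
     (\<forall>K. compact K \<longrightarrow> K \<subseteq> \<Omega> \<longrightarrow> set_integrable lborel K (\<lambda>q. real_of_ereal (u q)))"

definition function_current ::
  "'n::{finite,linorder} grp set \<Rightarrow> ('n grp \<Rightarrow> ereal) \<Rightarrow> ('n grp \<Rightarrow> 'n ext) \<Rightarrow> complex" where
  "function_current \<Omega> u \<eta> = (LINT q:\<Omega>|lborel. of_real (real_of_ereal (u q)) * top_coeff (\<eta> q))"

definition triangle_current :: "real ^ ('n::{finite,linorder} \<times> 4) ^ ('n \<times> 4) \<Rightarrow>
    'n grp set \<Rightarrow> ('n grp \<Rightarrow> ereal) \<Rightarrow> ('n grp \<Rightarrow> 'n ext) \<Rightarrow> complex" where
  "triangle_current S \<Omega> u =
     current_diff 1 (d0 S) (current_diff 0 (d1 S) (function_current \<Omega> u))"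

definition psh :: "real ^ ('n::{finite,linorder} \<times> 4) ^ ('n \<times> 4) \<Rightarrow>
    'n grp set \<Rightarrow> ('n grp \<Rightarrow> ereal) \<Rightarrow> bool" where
  "psh S \<Omega> u \<longleftrightarrow>
     (\<forall>q\<in>\<Omega>. u q \<noteq> \<infinity>) \<and> usc_on \<Omega> u \<and> L1_loc \<Omega> u \<and>
     is_current \<Omega> 2 (triangle_current S \<Omega> u) \<and>
     closed_current S \<Omega> 2 (triangle_current S \<Omega> u) \<and>
     positive_current \<Omega> 1 (triangle_current S \<Omega> u)"

section \<open>Norms\<close>

definition form_integral ::
  "'n::{finite,linorder} grp set \<Rightarrow> ('n grp \<Rightarrow> 'n ext) \<Rightarrow> complex" where
  "form_integral K F = (LINT q:K|lborel. top_coeff (F q))"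

text \<open>The norm of a \<open>(2n - 2p)\<close>-form. It is a real number when the form is positive on \<open>K\<close>.\<close>

definition form_norm ::
  "nat \<Rightarrow> ('n::{finite,linorder} grp \<Rightarrow> 'n ext) \<Rightarrow> 'n grp set \<Rightarrow> complex" where
  "form_norm p T K = form_integral K (\<lambda>q. T q \<curlywedge> wedge_list (replicate p beta_form))"

definition C0_norm :: "('a \<Rightarrow> real) \<Rightarrow> 'a set \<Rightarrow> real" where
  "C0_norm u K = (SUP q\<in>K. \<bar>u q\<bar>)"

end

theory Submission
  imports Defs
begin

text \<open>
  The argument is that of Chern, Levine and Nirenberg. Let \<open>\<psi>\<close> be a cutoff function with
  \<open>\<psi> \<ge> 1\<close> on \<open>L\<close> whose support \<open>Q\<close> lies in the interior of \<open>K\<close>, and put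
  \<open>T = \<triangle>u\<^sub>2 \<and> \<dots> \<and> \<triangle>u\<^sub>p \<and> \<beta>\<^sub>n\<^sup>n\<^sup>-\<^sup>p\<close>. Integrating by parts twice bounds
  \<open>\<integral>\<^sub>L \<triangle>u\<^sub>1 \<and> T \<le> \<integral> \<psi> \<triangle>u\<^sub>1 \<and> T = \<integral> u\<^sub>1 \<triangle>\<psi> \<and> T\<close> by a constant times
  \<open>\<parallel>u\<^sub>1\<parallel> \<integral>\<^sub>Q \<beta>\<^sub>n \<and> T\<close>, and induction on \<open>p\<close> applies to the last integral.

  The integration by parts needs \<open>T\<close> to be closed, which for \<open>C\<^sup>2\<close> functions holds only weakly and
  is obtained by mollifying one \<open>u\<^sub>i\<close> at a time. The right-type condition says that
  \<open>d\<^sub>0d\<^sub>0 = d\<^sub>1d\<^sub>1 = 0\<close> and \<open>d\<^sub>0d\<^sub>1 = - d\<^sub>1d\<^sub>0\<close>. For the pointwise positivity, testing the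
  positive current \<open>\<triangle>u\<close> against bump functions shows that \<open>\<triangle>u\<close> has a positive semidefinite
  quaternionic hermitian coefficient matrix. Hence it is a sum of forms \<open>v \<and> Jv\<close>, where \<open>J\<close> is the
  quaternionic structure on covectors, and a product of \<open>n\<close> such forms is nonnegative by elimination.
\<close>

section \<open>The exterior algebra\<close>

text \<open>An ordinary convolution need not preserve plurisubharmonicity, since the left-invariant
  fields do not commute with Euclidean translations. So positivity is never asked of an approximant:
  all that is used of it is that d0 and d1 annihilate the second-order form of any C^3 function, an
  algebraic identity that survives a limit of integrals. Positivity is read off pointwise from the
  original functions. The induction is driven by a Cauchy-Schwarz bound. For positive T the top
  coefficients of products of two basis covectors with T are, up to unit factors, the entries of a
  positive semidefinite matrix, and half of its trace is the top coefficient of beta_n wedge T.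
  Hence the 2-form of the cutoff, which has no sign, is controlled by a positive mass, at the price
  of one more factor beta_n and a larger compact set. The domain does not enter the constant because
  the cutoff lives in the interior of K.\<close>

lemma idx_less_total: "A \<noteq> B \<Longrightarrow> idx_less A B \<longleftrightarrow> \<not> idx_less B A"
  by (auto simp: idx_less_def prod_eq_iff)

text \<open>Keeping the exponent of the sign as a natural number turns sign identities into additive
  counts.\<close>

definition inversions :: "'n::{finite,linorder} idx set \<Rightarrow> 'n idx set \<Rightarrow> nat" where
  "inversions I J = card {(A, B). A \<in> I \<and> B \<in> J \<and> idx_less B A}"

lemma shuffle_sign_inversions: "shuffle_sign I J = (-1) ^ inversions I J"
  by (simp add: shuffle_sign_def inversions_def)

lemma inversions_Un_left:
  "I \<inter> J = {} \<Longrightarrow> inversions (I \<union> J) K = inversions I K + inversions J K"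
  unfolding inversions_def
  by (subst card_Un_disjoint[symmetric]) (auto intro!: arg_cong[where f=card])

lemma inversions_Un_right:
  "J \<inter> K = {} \<Longrightarrow> inversions I (J \<union> K) = inversions I J + inversions I K"
  unfolding inversions_def
  by (subst card_Un_disjoint[symmetric]) (auto intro!: arg_cong[where f=card])

text \<open>Disjointness excludes ties, so each pair in I \<times> J is inverted in exactly one of
  the two orders.\<close>

lemma inversions_swap:
  assumes "I \<inter> J = {}"
  shows "inversions I J + inversions J I = card I * card J"
proof -
  define P Q where "P = {(A, B). A \<in> I \<and> B \<in> J \<and> idx_less B A}"
    and "Q = {(A, B). A \<in> I \<and> B \<in> J \<and> idx_less A B}"
  have "bij_betw (\<lambda>(x, y). (y, x)) {(A, B). A \<in> J \<and> B \<in> I \<and> idx_less B A} Q"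
    by (rule bij_betw_byWitness[where f'="\<lambda>(x, y). (y, x)"]) (auto simp: Q_def)
  then have "inversions J I = card Q"
    unfolding inversions_def by (rule bij_betw_same_card)
  moreover have "idx_less B A \<longleftrightarrow> \<not> idx_less A B" if "A \<in> I" "B \<in> J" for A B
    using assms that idx_less_total[of B A] by blast
  then have "P \<union> Q = I \<times> J" "P \<inter> Q = {}"
    by (auto simp: P_def Q_def)
  then have "card P + card Q = card I * card J"
    by (metis card_Un_disjoint card_cartesian_product finite)
  ultimately show ?thesis
    by (simp add: inversions_def P_def)
qed

lemma shuffle_sign_empty [simp]: "shuffle_sign {} J = 1" "shuffle_sign I {} = 1"
  by (simp_all add: shuffle_sign_def)

lemma wedge_nth: "(v \<curlywedge> w) $ M = (\<Sum>I\<in>Pow M. shuffle_sign I (M - I) * (v $ I) * (w $ (M - I)))"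
  by (simp add: wedge_def)

lemma wedge_add_left: "(u + v) \<curlywedge> w = u \<curlywedge> w + v \<curlywedge> w"
  and wedge_add_right: "u \<curlywedge> (v + w) = u \<curlywedge> v + u \<curlywedge> w"
  and wedge_diff_left: "(u - v) \<curlywedge> w = u \<curlywedge> w - v \<curlywedge> w"
  and wedge_diff_right: "u \<curlywedge> (v - w) = u \<curlywedge> v - u \<curlywedge> w"
  and wedge_minus_left: "(- u) \<curlywedge> w = - (u \<curlywedge> w)"
  and wedge_minus_right: "u \<curlywedge> (- w) = - (u \<curlywedge> w)"
  and wedge_scale_left: "(c *s u) \<curlywedge> w = c *s (u \<curlywedge> w)"
  and wedge_scale_right: "u \<curlywedge> (c *s w) = c *s (u \<curlywedge> w)"
  and wedge_zero_left [simp]: "0 \<curlywedge> w = 0"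
  and wedge_zero_right [simp]: "u \<curlywedge> 0 = 0"
  by (simp_all add: vec_eq_iff wedge_nth algebra_simps sum.distrib sum_subtractf sum_negf sum_distrib_left)

lemma scaleR_eq_vector_scale: "r *\<^sub>R v = of_real r *s (v :: complex ^ 'm)"
  by (simp add: vec_eq_iff scaleR_conv_of_real[where 'a=complex])

text \<open>Boundedness comes from finite dimension. The product rule and the continuity of wedges
  of form-valued functions then follow from the general theory of bounded bilinear maps.\<close>

lemma bounded_bilinear_wedge: "bounded_bilinear wedge"
proof (rule bilinear_conv_bounded_bilinear[THEN iffD1])
  show "bilinear wedge"
    by (auto simp: bilinear_def intro!: linearI
        simp: wedge_add_left wedge_add_right scaleR_eq_vector_scale wedge_scale_left wedge_scale_right)
qed

interpretation wedge: bounded_bilinear wedge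
  by (rule bounded_bilinear_wedge)

text \<open>A chain I \<subseteq> N \<subseteq> M amounts to an ordered disjoint pair (I, N - I) of
  subsets of M.\<close>

lemma Pow_Pow_split_sum:
  fixes f :: "'a set \<Rightarrow> 'a set \<Rightarrow> 'b::comm_monoid_add"
  assumes "finite M"
  shows "(\<Sum>N\<in>Pow M. \<Sum>I\<in>Pow N. f I (N - I)) = (\<Sum>I\<in>Pow M. \<Sum>J\<in>Pow (M - I). f I J)"
proof -
  have "(\<Sum>N\<in>Pow M. \<Sum>I\<in>Pow N. f I (N - I)) = (\<Sum>(N, I)\<in>(SIGMA N:Pow M. Pow N). f I (N - I))"
    using assms finite_subset by (subst sum.Sigma) (auto intro: finite_subset)
  also have "\<dots> = (\<Sum>(I, J)\<in>(SIGMA I:Pow M. Pow (M - I)). f I J)"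
    by (rule sum.reindex_bij_witness[where i="\<lambda>(I, J). (I \<union> J, I)" and j="\<lambda>(N, I). (I, N - I)"]) auto
  also have "\<dots> = (\<Sum>I\<in>Pow M. \<Sum>J\<in>Pow (M - I). f I J)"
    using assms by (subst sum.Sigma) (auto intro: finite_subset)
  finally show ?thesis .
qed

lemma Diff_Un_eq: "M - (I \<union> J) = M - I - J"
  by auto

text \<open>Both sides become sums over ordered partitions of M into three blocks.\<close>

lemma wedge_assoc: "(u \<curlywedge> v) \<curlywedge> w = u \<curlywedge> (v \<curlywedge> w)"
proof -
  have "((u \<curlywedge> v) \<curlywedge> w) $ M = (u \<curlywedge> (v \<curlywedge> w)) $ M" for M
  proof -
    have "((u \<curlywedge> v) \<curlywedge> w) $ M = (\<Sum>N\<in>Pow M. \<Sum>I\<in>Pow N. shuffle_sign N (M - N) *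
        (shuffle_sign I (N - I) * u $ I * v $ (N - I)) * w $ (M - N))"
      by (simp add: wedge_nth sum_distrib_left sum_distrib_right)
    also have "\<dots> = (\<Sum>N\<in>Pow M. \<Sum>I\<in>Pow N. shuffle_sign (I \<union> (N - I)) (M - (I \<union> (N - I))) *
        (shuffle_sign I (N - I) * u $ I * v $ (N - I)) * w $ (M - (I \<union> (N - I))))"
      by (intro sum.cong refl) (auto simp: Un_absorb1 Un_absorb2)
    also have "\<dots> = (\<Sum>I\<in>Pow M. \<Sum>J\<in>Pow (M - I). shuffle_sign (I \<union> J) (M - (I \<union> J)) *
        (shuffle_sign I J * u $ I * v $ J) * w $ (M - (I \<union> J)))"
      by (rule Pow_Pow_split_sum) simp
    also have "\<dots> = (\<Sum>I\<in>Pow M. \<Sum>J\<in>Pow (M - I). shuffle_sign I (M - I) * u $ I *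
        (shuffle_sign J (M - I - J) * v $ J * w $ (M - I - J)))"
    proof (intro sum.cong refl)
      fix I J assume "I \<in> Pow M" "J \<in> Pow (M - I)"
      then have IJ: "I \<inter> J = {}" "J \<inter> (M - I - J) = {}" "M - I = J \<union> (M - I - J)" by auto
      \<comment> \<open>Each side counts the inversions between all three pairs of blocks.\<close>
      have "shuffle_sign (I \<union> J) (M - I - J) * shuffle_sign I J
          = shuffle_sign I (J \<union> (M - I - J)) * shuffle_sign J (M - I - J)"
        unfolding shuffle_sign_inversions
        using inversions_Un_left[OF IJ(1)] inversions_Un_right[OF IJ(2)]
        by (simp add: power_add)
      then show "shuffle_sign (I \<union> J) (M - (I \<union> J)) * (shuffle_sign I J * u $ I * v $ J) * w $ (M - (I \<union> J))
         = shuffle_sign I (M - I) * u $ I * (shuffle_sign J (M - I - J) * v $ J * w $ (M - I - J))"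
        using IJ(3) by (simp add: Diff_Un_eq mult_ac)
    qed
    also have "\<dots> = (u \<curlywedge> (v \<curlywedge> w)) $ M"
      by (simp add: wedge_nth sum_distrib_left)
    finally show ?thesis .
  qed
  then show ?thesis by (simp add: vec_eq_iff)
qed

lemma omega_set_nth: "omega_set I $ J = (if I = J then 1 else 0)"
  by (simp add: omega_set_def axis_def eq_commute)

lemma wedge_one_left [simp]: "ext_one \<curlywedge> w = w"
proof -
  have "(ext_one \<curlywedge> w) $ M = (\<Sum>I\<in>Pow M. if I = {} then w $ M else 0)" for M
    unfolding wedge_nth by (intro sum.cong) (auto simp: ext_one_def omega_set_nth)
  then show ?thesis by (simp add: vec_eq_iff)
qed

lemma wedge_one_right [simp]: "w \<curlywedge> ext_one = w"
proof -
  have "(w \<curlywedge> ext_one) $ M = (\<Sum>I\<in>Pow M. if I = M then w $ M else 0)" for M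
    unfolding wedge_nth by (intro sum.cong) (auto simp: ext_one_def omega_set_nth)
  then show ?thesis by (simp add: vec_eq_iff)
qed

section \<open>Parity and graded commutativity\<close>

definition even_ext :: "'n::{finite,linorder} ext \<Rightarrow> bool" where
  "even_ext w \<longleftrightarrow> (\<forall>I. w $ I \<noteq> 0 \<longrightarrow> even (card I))"

definition odd_ext :: "'n::{finite,linorder} ext \<Rightarrow> bool" where
  "odd_ext w \<longleftrightarrow> (\<forall>I. w $ I \<noteq> 0 \<longrightarrow> odd (card I))"

lemma wedge_nth_swap:
  "(w \<curlywedge> v) $ M = (\<Sum>I\<in>Pow M. shuffle_sign (M - I) I * (v $ I) * (w $ (M - I)))"
  unfolding wedge_nth
  by (rule sum.reindex_bij_witness[where i="\<lambda>I. M - I" and j="\<lambda>I. M - I"])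
    (auto simp: double_diff)

lemma shuffle_sign_swap:
  fixes I J :: "'n::{finite,linorder} idx set"
  shows "I \<inter> J = {} \<Longrightarrow> shuffle_sign I J = (-1) ^ (card I * card J) * shuffle_sign J I"
  unfolding shuffle_sign_inversions
  by (subst inversions_swap[symmetric]) (simp_all add: power_add mult.assoc flip: power_mult_distrib)

lemma even_ext_commute:
  assumes "even_ext v"
  shows "v \<curlywedge> w = w \<curlywedge> v"
proof -
  have "shuffle_sign I (M - I) * v $ I * w $ (M - I) = shuffle_sign (M - I) I * v $ I * w $ (M - I)" for I M
    using assms shuffle_sign_swap[of I "M - I"] by (auto simp: even_ext_def)
  then have "(v \<curlywedge> w) $ M = (w \<curlywedge> v) $ M" for M
    unfolding wedge_nth_swap[of w v] wedge_nth[of v w] by (rule sum.cong[OF refl])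
  then show ?thesis
    by (simp add: vec_eq_iff)
qed

lemma odd_ext_anticommute:
  assumes "odd_ext v" "odd_ext w"
  shows "v \<curlywedge> w = - (w \<curlywedge> v)"
proof -
  have "shuffle_sign I (M - I) * v $ I * w $ (M - I) = - (shuffle_sign (M - I) I * v $ I * w $ (M - I))" for I M
    using assms shuffle_sign_swap[of I "M - I"] 
    by (cases "v $ I = 0"; cases "w $ (M - I) = 0") (auto simp: odd_ext_def)
  then have "(v \<curlywedge> w) $ M = - ((w \<curlywedge> v) $ M)" for M
    unfolding wedge_nth_swap[of w v] wedge_nth[of v w] sum_negf[symmetric] by (rule sum.cong[OF refl])
  then show ?thesis
    by (simp add: vec_eq_iff)
qed

lemma odd_ext_square:
  assumes "odd_ext v"
  shows "v \<curlywedge> v = 0"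
proof -
  have "v \<curlywedge> v + v \<curlywedge> v = 0"
    using odd_ext_anticommute[OF assms assms] by (metis add.right_inverse)
  then show ?thesis
    by (simp add: vec_eq_iff)
qed

text \<open>Replaces the sum over subsets by one witness, so that parity and degree of a product can
  be read off from its factors.\<close>

lemma wedge_nth_nonzeroE:
  assumes "(v \<curlywedge> w) $ M \<noteq> 0"
  obtains I where "v $ I \<noteq> 0" "w $ (M - I) \<noteq> 0" "card M = card I + card (M - I)"
proof -
  obtain I where "I \<in> Pow M" "shuffle_sign I (M - I) * (v $ I) * (w $ (M - I)) \<noteq> 0"
    using assms unfolding wedge_nth by (rule sum.not_neutral_contains_not_neutral)
  moreover have "card M = card I + card (M - I)"
    using \<open>I \<in> Pow M\<close> by (simp add: card_Diff_subset card_mono)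
  ultimately show ?thesis using that by auto
qed

lemma even_ext_wedge: "even_ext v \<Longrightarrow> even_ext w \<Longrightarrow> even_ext (v \<curlywedge> w)"
  and odd_odd_wedge: "odd_ext v \<Longrightarrow> odd_ext w \<Longrightarrow> even_ext (v \<curlywedge> w)"
proof -
  show "even_ext (v \<curlywedge> w)" if "even_ext v" "even_ext w"
    unfolding even_ext_def
  proof (intro allI impI)
    fix M assume "(v \<curlywedge> w) $ M \<noteq> 0"
    then obtain I where "v $ I \<noteq> 0" "w $ (M - I) \<noteq> 0" and M: "card M = card I + card (M - I)"
      by (rule wedge_nth_nonzeroE)
    with that have "even (card I)" "even (card (M - I))" by (auto simp only: even_ext_def)
    with M show "even (card M)" by presburger
  qed
  show "even_ext (v \<curlywedge> w)" if "odd_ext v" "odd_ext w"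
    unfolding even_ext_def
  proof (intro allI impI)
    fix M assume "(v \<curlywedge> w) $ M \<noteq> 0"
    then obtain I where "v $ I \<noteq> 0" "w $ (M - I) \<noteq> 0" and M: "card M = card I + card (M - I)"
      by (rule wedge_nth_nonzeroE)
    with that have "odd (card I)" "odd (card (M - I))" by (auto simp only: odd_ext_def)
    with M show "even (card M)" by presburger
  qed
qed

lemma ext_degree_wedge:
  assumes "ext_degree j v" "ext_degree k w"
  shows "ext_degree (j + k) (v \<curlywedge> w)"
  unfolding ext_degree_def
proof (intro allI impI)
  fix M assume "(v \<curlywedge> w) $ M \<noteq> 0"
  then obtain I where "v $ I \<noteq> 0" "w $ (M - I) \<noteq> 0" "card M = card I + card (M - I)"
    by (rule wedge_nth_nonzeroE)
  then show "card M = j + k"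
    using assms by (auto simp: ext_degree_def)
qed

lemma even_ext_0 [simp]: "even_ext 0"
  and even_ext_one [simp]: "even_ext ext_one"
  and even_ext_add: "even_ext v \<Longrightarrow> even_ext w \<Longrightarrow> even_ext (v + w)"
  and even_ext_scale: "even_ext v \<Longrightarrow> even_ext (c *s v)"
  by (auto simp: even_ext_def ext_one_def omega_set_nth split: if_splits) (metis add.left_neutral)

lemma even_ext_scaleR: "even_ext v \<Longrightarrow> even_ext (r *\<^sub>R v)"
  by (simp add: scaleR_eq_vector_scale even_ext_scale)

lemma even_ext_sum: "(\<And>i. i \<in> A \<Longrightarrow> even_ext (f i)) \<Longrightarrow> even_ext (sum f A)"
  by (induction A rule: infinite_finite_induct) (auto intro: even_ext_add)

lemma odd_ext_omega: "odd_ext (omega A)"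
  by (auto simp: odd_ext_def omega_def omega_set_nth split: if_splits)

lemma odd_ext_0 [simp]: "odd_ext 0"
  and odd_ext_add: "odd_ext v \<Longrightarrow> odd_ext w \<Longrightarrow> odd_ext (v + w)"
  and odd_ext_scale: "odd_ext v \<Longrightarrow> odd_ext (c *s v)"
  by (auto simp: odd_ext_def) (metis add.left_neutral)

lemma odd_ext_sum: "(\<And>i. i \<in> A \<Longrightarrow> odd_ext (f i)) \<Longrightarrow> odd_ext (sum f A)"
  by (induction A rule: infinite_finite_induct) (auto intro: odd_ext_add)

lemma wedge_sum_left: "sum f A \<curlywedge> w = (\<Sum>i\<in>A. f i \<curlywedge> w)"
  and wedge_sum_right: "w \<curlywedge> sum f A = (\<Sum>i\<in>A. w \<curlywedge> f i)"
  by (induction A rule: infinite_finite_induct) (auto simp: wedge_add_left wedge_add_right)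

lemma even_ext_left_commute: "even_ext v \<Longrightarrow> u \<curlywedge> (v \<curlywedge> w) = v \<curlywedge> (u \<curlywedge> w)"
  by (metis even_ext_commute wedge_assoc)

lemma wedge_list_Nil [simp]: "wedge_list [] = ext_one"
  and wedge_list_Cons [simp]: "wedge_list (w # ws) = w \<curlywedge> wedge_list ws"
  by (simp_all add: wedge_list_def)

lemma wedge_list_append: "wedge_list (vs @ ws) = wedge_list vs \<curlywedge> wedge_list ws"
  by (induction vs) (simp_all add: wedge_assoc)

lemma even_ext_wedge_list: "(\<And>w. w \<in> set ws \<Longrightarrow> even_ext w) \<Longrightarrow> even_ext (wedge_list ws)"
  by (induction ws) (auto intro: even_ext_wedge)

lemma omega_set_wedge:
  "omega_set I \<curlywedge> omega_set J = (if I \<inter> J = {} then shuffle_sign I J *s omega_set (I \<union> J) else 0)"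
proof -
  have "(omega_set I \<curlywedge> omega_set J) $ M =
      (\<Sum>I'\<in>Pow M. if I' = I then (if J = M - I then shuffle_sign I J else 0) else 0)" for M
    unfolding wedge_nth by (intro sum.cong) (auto simp: omega_set_nth)
  also have "\<dots> M = (if I \<subseteq> M \<and> J = M - I then shuffle_sign I J else 0)" for M
    by (simp add: sum.delta')
  finally show ?thesis
    by (auto simp: vec_eq_iff omega_set_nth)
qed

lemma top_coeff_add: "top_coeff (v + w) = top_coeff v + top_coeff w"
  and top_coeff_diff: "top_coeff (v - w) = top_coeff v - top_coeff w"
  and top_coeff_scale: "top_coeff (c *s v) = c * top_coeff v"
  and top_coeff_scaleR: "top_coeff (r *\<^sub>R v) = r *\<^sub>R top_coeff v"
  and top_coeff_0 [simp]: "top_coeff 0 = 0"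
  by (simp_all add: top_coeff_def)

lemma top_coeff_sum: "top_coeff (sum f A) = (\<Sum>i\<in>A. top_coeff (f i))"
  by (simp add: top_coeff_def)

lemma bounded_linear_top_coeff: "bounded_linear top_coeff"
  unfolding top_coeff_def by (rule bounded_linear_vec_nth)

section \<open>Strongly positive elements\<close>

definition covec :: "complex ^ ('n::{finite,linorder} idx) \<Rightarrow> 'n ext" where
  "covec v = (\<Sum>A\<in>UNIV. v $ A *s omega A)"

text \<open>The antilinear quaternionic structure, with square -1. In the 2 by 2 block of a
  quaternion under tau it carries the first row to the second.\<close>

definition qJ :: "complex ^ ('n::{finite,linorder} idx) \<Rightarrow> complex ^ ('n idx)" where
  "qJ v = (\<chi> A. if snd A then cnj (v $ (fst A, False)) else - cnj (v $ (fst A, True)))"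

text \<open>By \<open>pullback_qrow\<close> this is the factor that a single quaternionic functional
  contributes to an elementary strongly positive element.\<close>

definition zeta :: "complex ^ ('n::{finite,linorder} idx) \<Rightarrow> 'n ext" where
  "zeta v = covec v \<curlywedge> covec (qJ v)"

lemma covec_add: "covec (v + w) = covec v + covec w"
  and covec_diff: "covec (v - w) = covec v - covec w"
  and covec_minus: "covec (- v) = - covec v"
  and covec_scale: "covec (c *s v) = c *s covec v"
  and covec_0 [simp]: "covec 0 = 0"
  by (simp_all add: covec_def vec_eq_iff sum.distrib sum_subtractf sum_negf sum_distrib_left algebra_simps)

lemma covec_axis: "covec (axis A c) = c *s omega A"
proof -
  have "covec (axis A c) = (\<Sum>B\<in>UNIV. if B = A then c *s omega A else 0)"
    unfolding covec_def by (rule sum.cong) (auto simp: axis_def)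
  then show ?thesis by simp
qed

lemma odd_ext_covec: "odd_ext (covec v)"
  unfolding covec_def by (intro odd_ext_sum odd_ext_scale odd_ext_omega)

lemma even_ext_zeta: "even_ext (zeta v)"
  unfolding zeta_def by (intro odd_odd_wedge odd_ext_covec)

lemma qJ_add: "qJ (v + w) = qJ v + qJ w"
  and qJ_diff: "qJ (v - w) = qJ v - qJ w"
  and qJ_scale: "qJ (c *s v) = cnj c *s qJ v"
  and qJ_qJ: "qJ (qJ v) = - v"
  and qJ_0 [simp]: "qJ 0 = 0"
  by (simp_all add: qJ_def vec_eq_iff)

lemma qJ_axis:
  "qJ (axis (l, False) 1) = axis (l, True) 1"
  "qJ (axis (l, True) 1) = - axis (l, False) 1"
  by (auto simp: qJ_def vec_eq_iff axis_def)

lemma zeta_axis: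
  "zeta (axis (l, False) 1) = omega (l, False) \<curlywedge> omega (l, True)"
  "zeta (axis (l, True) 1) = omega (l, False) \<curlywedge> omega (l, True)"
  using odd_ext_anticommute[OF odd_ext_omega odd_ext_omega, of "(l, True)" "(l, False)"]
  by (simp_all add: zeta_def qJ_axis covec_axis covec_minus wedge_minus_right)

lemma covec_square: "covec v \<curlywedge> covec v = 0"
  by (rule odd_ext_square) (rule odd_ext_covec)

lemma covec_anticommute: "covec v \<curlywedge> covec w = - (covec w \<curlywedge> covec v)"
  by (rule odd_ext_anticommute) (rule odd_ext_covec)+

lemma zeta_wedge_covec:
  "zeta v \<curlywedge> covec v = 0" "zeta v \<curlywedge> covec (qJ v) = 0"
proof -
  show "zeta v \<curlywedge> covec (qJ v) = 0"
    by (simp add: zeta_def wedge_assoc covec_square)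
  have "zeta v \<curlywedge> covec v = covec v \<curlywedge> zeta v"
    by (rule even_ext_commute) (rule even_ext_zeta)
  then show "zeta v \<curlywedge> covec v = 0"
    by (simp add: zeta_def covec_square flip: wedge_assoc)
qed

text \<open>A quaternionic row operation: the covectors of \<open>y\<close> and \<open>qJ y\<close>
  change only by combinations of those of \<open>v\<close> and \<open>qJ v\<close>, which
  \<open>zeta v\<close> annihilates.\<close>

lemma zeta_elim:
  "zeta v \<curlywedge> zeta (y - s *s v - t *s qJ v) = zeta v \<curlywedge> zeta y"
proof -
  have 1: "zeta v \<curlywedge> covec (y - s *s v - t *s qJ v) = zeta v \<curlywedge> covec y"
    and 2: "zeta v \<curlywedge> covec (qJ (y - s *s v - t *s qJ v)) = zeta v \<curlywedge> covec (qJ y)"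
    by (simp_all add: covec_diff covec_scale covec_add qJ_diff qJ_scale qJ_qJ wedge_diff_right
        wedge_scale_right wedge_add_right zeta_wedge_covec covec_minus wedge_minus_right)
  have "zeta v \<curlywedge> zeta (y - s *s v - t *s qJ v)
      = (zeta v \<curlywedge> covec (y - s *s v - t *s qJ v)) \<curlywedge> covec (qJ (y - s *s v - t *s qJ v))"
    by (simp add: zeta_def[of "y - s *s v - t *s qJ v"] wedge_assoc)
  also have "\<dots> = covec y \<curlywedge> (zeta v \<curlywedge> covec (qJ (y - s *s v - t *s qJ v)))"
    by (simp only: 1 wedge_assoc even_ext_left_commute[OF even_ext_zeta])
  also have "\<dots> = zeta v \<curlywedge> zeta y"
    by (simp only: 2 zeta_def[of y] even_ext_left_commute[OF even_ext_zeta])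
  finally show ?thesis .
qed

lemma zeta_elim_list:
  "zeta v \<curlywedge> wedge_list (map (\<lambda>j. zeta (y j - s j *s v - t j *s qJ v)) js) = zeta v \<curlywedge> wedge_list (map (\<lambda>j. zeta (y j)) js)"
proof (induction js)
  case (Cons j js)
  let ?W = "wedge_list (map (\<lambda>j. zeta (y j - s j *s v - t j *s qJ v)) js)"
  have "zeta v \<curlywedge> (zeta (y j - s j *s v - t j *s qJ v) \<curlywedge> ?W) = (zeta v \<curlywedge> zeta (y j)) \<curlywedge> ?W"
    using arg_cong[OF zeta_elim[of v "y j" "s j" "t j"], of "\<lambda>x. x \<curlywedge> ?W"] by (simp only: wedge_assoc)
  also have "\<dots> = zeta (y j) \<curlywedge> (zeta v \<curlywedge> ?W)"
    unfolding wedge_assoc by (rule even_ext_left_commute) (rule even_ext_zeta)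
  also have "\<dots> = zeta v \<curlywedge> (zeta (y j) \<curlywedge> wedge_list (map (\<lambda>j. zeta (y j)) js))"
    unfolding Cons.IH by (rule even_ext_left_commute) (rule even_ext_zeta)
  finally show ?case by simp
qed simp

lemma wedge_list_zeta_remove:
  "wedge_list (map zeta (xs @ v # ys)) = zeta v \<curlywedge> wedge_list (map zeta (xs @ ys))"
  by (simp add: wedge_list_append even_ext_left_commute[OF even_ext_zeta])

text \<open>Inversions between different blocks involve the whole blocks, hence four index pairs at
  a time.\<close>

lemma inversions_block_even:
  assumes "l \<notin> B"
  shows "even (inversions ({l} \<times> UNIV) (B \<times> UNIV))"
proof -
  have "{(X, Y). X \<in> {l} \<times> (UNIV :: bool set) \<and> Y \<in> B \<times> UNIV \<and> idx_less Y X}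
      = ({l} \<times> UNIV) \<times> ({j \<in> B. j < l} \<times> UNIV)"
    using assms by (auto simp: idx_less_def)
  then show ?thesis
    unfolding inversions_def by (simp add: card_cartesian_product)
qed

lemma omega_block: "omega (l, False) \<curlywedge> omega (l, True) = omega_set ({l} \<times> UNIV)"
proof -
  have "inversions {(l, False)} {(l, True)} = 0"
    by (auto simp: inversions_def idx_less_def)
  moreover have "{(l, False), (l, True)} = {l} \<times> UNIV" by auto
  ultimately show ?thesis
    by (simp add: omega_def omega_set_wedge shuffle_sign_inversions insert_commute)
qed

lemma omega_block_wedge:
  assumes "l \<notin> B"
  shows "omega_set ({l} \<times> UNIV) \<curlywedge> omega_set (B \<times> UNIV) = omega_set (insert l B \<times> UNIV)"
proof -
  have *: "({l} \<times> UNIV) \<inter> (B \<times> UNIV) = {}" "({l} \<times> UNIV) \<union> (B \<times> UNIV) = insert l B \<times> UNIV"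
    using assms by auto
  show ?thesis
    unfolding omega_set_wedge shuffle_sign_inversions *
    using inversions_block_even[OF assms] by simp
qed

text \<open>Indices in the blocks of B repeat a factor, and \<open>v\<close> vanishes outside the
  listed blocks; only block \<open>l\<close> is left.\<close>

lemma covec_wedge_block:
  assumes "\<And>A. fst A \<notin> insert l B \<Longrightarrow> v $ A = 0"
  shows "covec v \<curlywedge> omega_set (B \<times> UNIV)
    = (v $ (l, False) *s omega (l, False) + v $ (l, True) *s omega (l, True)) \<curlywedge> omega_set (B \<times> UNIV)"
proof -
  have "(v $ A *s omega A) \<curlywedge> omega_set (B \<times> UNIV) = 0" if "A \<in> - {(l, False), (l, True)}" for A
  proof (cases "fst A \<in> B")
    case True
    then have "A \<in> B \<times> UNIV" by (cases A) simp
    then show ?thesis by (simp add: omega_def omega_set_wedge wedge_scale_left)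
  next
    case False
    with that assms[of A] show ?thesis by (cases A) auto
  qed
  then have "covec v \<curlywedge> omega_set (B \<times> UNIV)
      = (\<Sum>A\<in>{(l, False), (l, True)}. (v $ A *s omega A) \<curlywedge> omega_set (B \<times> UNIV))"
    unfolding covec_def wedge_sum_left by (intro sum.mono_neutral_right) auto
  then show ?thesis by (simp add: wedge_add_left)
qed

text \<open>The coefficient is the determinant with rows (x, y) and (- cnj y, cnj x), the squared
  norm of the quaternion in block \<open>l\<close>.\<close>

lemma zeta_wedge_block:
  assumes "\<And>A. fst A \<notin> insert l B \<Longrightarrow> v $ A = 0" "l \<notin> B"
  shows "zeta v \<curlywedge> omega_set (B \<times> UNIV)
    = of_real ((cmod (v $ (l, False)))\<^sup>2 + (cmod (v $ (l, True)))\<^sup>2) *s omega_set (insert l B \<times> UNIV)"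
proof -
  define x y P where "x = v $ (l, False)" and "y = v $ (l, True)" and "P = omega_set (B \<times> (UNIV :: bool set))"
  define a b where "a = omega (l, False)" and "b = omega (l, True)"
  have Jv: "qJ v $ (l, False) = - cnj y" "qJ v $ (l, True) = cnj x"
    by (simp_all add: qJ_def x_def y_def)
  have ab: "a \<curlywedge> a = 0" "b \<curlywedge> b = 0" "b \<curlywedge> a = - (a \<curlywedge> b)"
    by (auto simp: a_def b_def odd_ext_square odd_ext_omega intro!: odd_ext_anticommute)
  have oab: "odd_ext (x *s a + y *s b)" "odd_ext (- cnj y *s a + cnj x *s b)"
    by (intro odd_ext_add odd_ext_scale; simp add: a_def b_def odd_ext_omega)+
  have e: "covec v \<curlywedge> P = (x *s a + y *s b) \<curlywedge> P"
    unfolding P_def a_def b_def x_def y_def by (rule covec_wedge_block) (rule assms)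
  have "\<And>A. fst A \<notin> insert l B \<Longrightarrow> qJ v $ A = 0"
    using assms(1) by (auto simp: qJ_def)
  then have e': "covec (qJ v) \<curlywedge> P = (- cnj y *s a + cnj x *s b) \<curlywedge> P"
    unfolding P_def a_def b_def Jv[symmetric] by (rule covec_wedge_block)
  have "zeta v \<curlywedge> P = (covec v \<curlywedge> (- cnj y *s a + cnj x *s b)) \<curlywedge> P"
    by (simp only: zeta_def wedge_assoc e')
  \<comment> \<open>The reduction \<open>e\<close> applies only to a factor adjacent to
    \<open>P\<close>, so the two odd factors are exchanged here and exchanged back
    afterwards.\<close>
  also have "\<dots> = - ((- cnj y *s a + cnj x *s b) \<curlywedge> ((x *s a + y *s b) \<curlywedge> P))"
    by (simp only: odd_ext_anticommute[OF odd_ext_covec oab(2)] wedge_minus_left wedge_assoc e)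
  also have "\<dots> = ((x *s a + y *s b) \<curlywedge> (- cnj y *s a + cnj x *s b)) \<curlywedge> P"
    by (simp only: odd_ext_anticommute[OF oab(1) oab(2)] wedge_minus_left flip: wedge_assoc)
  also have "(x *s a + y *s b) \<curlywedge> (- cnj y *s a + cnj x *s b) = (x * cnj x + y * cnj y) *s (a \<curlywedge> b)"
    by (simp add: wedge_add_left wedge_add_right wedge_scale_left wedge_scale_right wedge_diff_right ab
        vec_eq_iff algebra_simps)
  also have "x * cnj x + y * cnj y = of_real ((cmod x)\<^sup>2 + (cmod y)\<^sup>2)"
    by (simp only: of_real_add complex_norm_square)
  also have "(of_real ((cmod x)\<^sup>2 + (cmod y)\<^sup>2) *s (a \<curlywedge> b)) \<curlywedge> P
      = of_real ((cmod x)\<^sup>2 + (cmod y)\<^sup>2) *s omega_set (insert l B \<times> UNIV)"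
    by (simp only: wedge_scale_left P_def a_def b_def omega_block omega_block_wedge[OF assms(2)])
  finally show ?thesis by (simp only: P_def x_def y_def)
qed

text \<open>Division by the nonzero quaternion that \<open>v\<close> has in block
  \<open>l\<close>.\<close>

lemma block_elimination:
  assumes "v $ (l, False) \<noteq> 0 \<or> v $ (l, True) \<noteq> 0"
  obtains s t where "\<And>b. (w - s *s v - t *s qJ v) $ (l, b) = 0"
proof -
  define x y a b where "x = v $ (l, False)" and "y = v $ (l, True)"
    and "a = w $ (l, False)" and "b = w $ (l, True)"
  define N where "N = x * cnj x + y * cnj y"
  have "N = of_real ((cmod x)\<^sup>2 + (cmod y)\<^sup>2)"
    by (simp only: N_def of_real_add complex_norm_square)
  moreover have "(cmod x)\<^sup>2 + (cmod y)\<^sup>2 \<noteq> 0"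
    using assms by (simp add: x_def y_def sum_power2_eq_zero_iff)
  ultimately have N: "N \<noteq> 0" by (metis of_real_eq_0_iff)
  \<comment> \<open>Cramer's rule for s x - t cnj y = a and s y + t cnj x = b, a system with
    determinant N.\<close>
  define s t where "s = (a * cnj x + b * cnj y) / N" and "t = (b * x - a * y) / N"
  have "s * x - t * cnj y = a" "s * y + t * cnj x = b"
    using N by (simp_all add: s_def t_def field_simps) (simp_all add: N_def algebra_simps)
  then have "(w - s *s v - t *s qJ v) $ (l, c) = 0" for c
    by (cases c) (auto simp: qJ_def x_def y_def a_def b_def algebra_simps)
  then show ?thesis by (rule that)
qed

text \<open>Gaussian elimination over the quaternions, one block of indices at a time. A pivot
  contributes a nonnegative factor, and the other vectors lose their entries in its block. The
  second conjunct settles the case of a block without pivot.\<close>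

lemma zeta_list_blocks:
  fixes B :: "'n::{finite,linorder} set"
  assumes "finite B" "\<And>v A. v \<in> set vs \<Longrightarrow> fst A \<notin> B \<Longrightarrow> v $ A = 0"
  shows "(length vs = card B \<longrightarrow> (\<exists>r\<ge>0. wedge_list (map zeta vs) = complex_of_real r *s omega_set (B \<times> UNIV)))
     \<and> (length vs > card B \<longrightarrow> wedge_list (map zeta vs) = 0)"
  using assms
proof (induction B arbitrary: vs rule: finite_induct)
  case empty
  have "zeta v = 0" if "v \<in> set vs" for v
  proof -
    have "v = 0" using empty that by (simp add: vec_eq_iff)
    then show ?thesis by (simp add: zeta_def)
  qed
  \<comment> \<open>Over no blocks the empty product is \<open>omega_set {}\<close>, and every other
    product contains a vanishing factor.\<close>
  then show ?case
    by (cases vs) (auto simp: ext_one_def intro!: exI[of _ "1::real"])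
next
  case (insert l B)
  show ?case
  proof (cases "\<forall>v\<in>set vs. v $ (l, False) = 0 \<and> v $ (l, True) = 0")
    case True
    \<comment> \<open>Without a pivot the vectors live on the blocks of B, for which the list is too
      long, so the product is 0.\<close>
    have "v $ A = 0" if "v \<in> set vs" "fst A \<notin> B" for v A
      using True insert.prems[of v A] that by (cases A; cases "snd A") auto
    from insert.IH[OF this] insert.hyps show ?thesis
      by (auto intro!: exI[of _ "0::real"])
  next
    case False
    then obtain v where v: "v \<in> set vs" "v $ (l, False) \<noteq> 0 \<or> v $ (l, True) \<noteq> 0" by blast
    then obtain xs ys where vs: "vs = xs @ v # ys" by (meson split_list)
    have "\<exists>s t. \<forall>b. (w - s *s v - t *s qJ v) $ (l, b) = 0" for w
      using block_elimination[OF v(2), of w] by metis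
    then obtain s t where st: "\<And>w b. (w - s w *s v - t w *s qJ v) $ (l, b) = 0" by metis
    define ws where "ws = map (\<lambda>w. w - s w *s v - t w *s qJ v) (xs @ ys)"
    have supp: "w $ A = 0" if "w \<in> set (xs @ ys) \<union> {v}" "fst A \<notin> insert l B" for w A
      using insert.prems[of w A] that vs by auto
    then have supp_J: "qJ v $ A = 0" if "fst A \<notin> insert l B" for A
      using that by (auto simp: qJ_def)
    have "w $ A = 0" if "w \<in> set ws" "fst A \<notin> B" for w A
    proof (cases "fst A = l")
      case True
      with st that show ?thesis by (cases A) (auto simp: ws_def)
    next
      case False
      obtain y where y: "y \<in> set (xs @ ys)" "w = y - s y *s v - t y *s qJ v"
        using \<open>w \<in> set ws\<close> by (auto simp: ws_def)
      have "fst A \<notin> insert l B" using False that by simp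
      with supp[of y A] supp[of v A] supp_J[of A] y show ?thesis by simp
    qed
    note IH = insert.IH[OF this]
    have eq: "wedge_list (map zeta vs) = zeta v \<curlywedge> wedge_list (map zeta ws)"
      unfolding vs wedge_list_zeta_remove ws_def map_map o_def by (rule zeta_elim_list[symmetric])
    have len: "length vs = Suc (length ws)" by (simp add: vs ws_def)
    show ?thesis
    proof (intro conjI impI)
      assume "length vs = card (insert l B)"
      then obtain r where r: "r \<ge> 0" "wedge_list (map zeta ws) = complex_of_real r *s omega_set (B \<times> UNIV)"
        using IH len insert.hyps by auto
      show "\<exists>r\<ge>0. wedge_list (map zeta vs) = complex_of_real r *s omega_set (insert l B \<times> UNIV)"
      proof (intro exI conjI)
        have z: "zeta v \<curlywedge> omega_set (B \<times> UNIV)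
          = of_real ((cmod (v $ (l, False)))\<^sup>2 + (cmod (v $ (l, True)))\<^sup>2) *s omega_set (insert l B \<times> UNIV)"
          by (rule zeta_wedge_block) (use supp[of v] insert.hyps in auto)
        show "wedge_list (map zeta vs) = complex_of_real (r * ((cmod (v $ (l, False)))\<^sup>2
            + (cmod (v $ (l, True)))\<^sup>2)) *s omega_set (insert l B \<times> UNIV)"
          unfolding eq r wedge_scale_right z by (simp only: vector_smult_assoc of_real_mult)
      qed (use r(1) in simp)
    next
      assume "length vs > card (insert l B)"
      then show "wedge_list (map zeta vs) = 0"
        unfolding eq using IH len insert.hyps by auto
    qed
  qed
qed

lemma ext_degree_omega_set: "ext_degree (card I) (omega_set I)"
  by (simp add: ext_degree_def omega_set_nth)

lemma ext_degree_0 [simp]: "ext_degree k 0"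
  and ext_degree_add: "ext_degree k v \<Longrightarrow> ext_degree k w \<Longrightarrow> ext_degree k (v + w)"
  and ext_degree_scale: "ext_degree k v \<Longrightarrow> ext_degree k (c *s v)"
  by (auto simp: ext_degree_def) (metis add.left_neutral)

lemma ext_degree_sum: "(\<And>i. i \<in> A \<Longrightarrow> ext_degree k (f i)) \<Longrightarrow> ext_degree k (sum f A)"
  by (induction A rule: infinite_finite_induct) (auto intro: ext_degree_add)

lemma ext_degree_covec: "ext_degree 1 (covec v)"
  using ext_degree_omega_set[of "{A}" for A]
  by (auto simp: covec_def omega_def intro!: ext_degree_sum ext_degree_scale)

lemma ext_degree_zeta_list: "ext_degree (2 * length vs) (wedge_list (map zeta vs))"
proof (induction vs)
  case Nil
  then show ?case by (auto simp: ext_degree_def ext_one_def omega_set_nth)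
next
  case (Cons v vs)
  have "ext_degree 2 (zeta v)"
    using ext_degree_wedge[OF ext_degree_covec ext_degree_covec] by (simp add: zeta_def numeral_2_eq_2)
  from ext_degree_wedge[OF this Cons.IH] show ?case by simp
qed

lemma card_idx: "card (UNIV :: 'n::finite idx set) = 2 * CARD('n)"
  by (simp add: card_cartesian_product flip: UNIV_Times_UNIV)

text \<open>Only lists of exactly n factors reach the top degree without vanishing: shorter ones
  fail by degree, longer ones are 0 by elimination.\<close>

lemma top_coeff_zeta_list_nonneg: "0 \<le> top_coeff (wedge_list (map zeta vs))"
proof -
  consider "length vs < CARD('a)" | "length vs = CARD('a)" | "length vs > CARD('a)" by linarith
  then show ?thesis
  proof cases
    case 1
    then have "2 * length vs \<noteq> card (UNIV :: 'a idx set)" by (simp only: card_idx)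
    then have "top_coeff (wedge_list (map zeta vs)) = 0"
      using ext_degree_zeta_list[of vs] unfolding ext_degree_def top_coeff_def by metis
    then show ?thesis by simp
  next
    case 2
    with zeta_list_blocks[of "UNIV :: 'a set" vs]
    obtain r where "r \<ge> 0" "wedge_list (map zeta vs) = complex_of_real r *s omega_set UNIV"
      by auto
    then show ?thesis by (simp add: top_coeff_def omega_set_nth less_eq_complex_def)
  next
    case 3
    with zeta_list_blocks[of "UNIV :: 'a set" vs] show ?thesis by auto
  qed
qed

text \<open>Any number of factors is allowed, but only the lists that complete \<open>T\<close> to top degree matter.\<close>

definition Pos :: "'n::{finite,linorder} ext \<Rightarrow> bool" where
  "Pos T \<longleftrightarrow> even_ext T \<and> (\<forall>vs. 0 \<le> top_coeff (T \<curlywedge> wedge_list (map zeta vs)))"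

lemma Pos_top_coeff: "Pos T \<Longrightarrow> 0 \<le> top_coeff T"
  unfolding Pos_def by (drule conjunct2, drule spec[of _ "[]"]) simp

lemma Pos_ext_one: "Pos ext_one"
  by (simp add: Pos_def top_coeff_zeta_list_nonneg)

lemma Pos_0: "Pos 0"
  by (simp add: Pos_def)

lemma Pos_add: "Pos T \<Longrightarrow> Pos T' \<Longrightarrow> Pos (T + T')"
  by (simp add: Pos_def even_ext_add wedge_add_left top_coeff_add)

lemma Pos_scaleR: "0 \<le> r \<Longrightarrow> Pos T \<Longrightarrow> Pos (r *\<^sub>R T)"
  by (simp add: Pos_def even_ext_scaleR wedge.scaleR_left top_coeff_scaleR scaleR_nonneg_nonneg less_eq_complex_def)

lemma Pos_sum: "(\<And>i. i \<in> A \<Longrightarrow> Pos (f i)) \<Longrightarrow> Pos (sum f A)"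
  by (induction A rule: infinite_finite_induct) (auto intro: Pos_add Pos_0)

text \<open>The new factor is even and can be absorbed into the list of test factors.\<close>

lemma Pos_zeta:
  assumes "Pos T"
  shows "Pos (zeta v \<curlywedge> T)"
  unfolding Pos_def
proof (intro conjI allI)
  show "even_ext (zeta v \<curlywedge> T)"
    using assms by (simp add: Pos_def even_ext_wedge even_ext_zeta)
  fix vs
  have "(zeta v \<curlywedge> T) \<curlywedge> wedge_list (map zeta vs) = T \<curlywedge> wedge_list (map zeta (v # vs))"
    using even_ext_left_commute[OF even_ext_zeta, of T v] by (simp add: wedge_assoc)
  then show "0 \<le> top_coeff ((zeta v \<curlywedge> T) \<curlywedge> wedge_list (map zeta vs))"
    using assms unfolding Pos_def by metis
qed

definition zeta_sum :: "'n::{finite,linorder} ext \<Rightarrow> bool" where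
  "zeta_sum w \<longleftrightarrow> (\<exists>(m::nat) r v. (\<forall>k<m. 0 \<le> r k) \<and> w = (\<Sum>k<m. r k *\<^sub>R zeta (v k)))"

lemma Pos_zeta_sum: "zeta_sum w \<Longrightarrow> Pos T \<Longrightarrow> Pos (w \<curlywedge> T)"
  by (auto simp: zeta_sum_def wedge_sum_left wedge.scaleR_left intro!: Pos_sum Pos_scaleR Pos_zeta)

lemma Pos_beta: "Pos T \<Longrightarrow> Pos (beta_form \<curlywedge> T)"
  by (auto simp: beta_form_def wedge_sum_left zeta_axis[symmetric] intro!: Pos_sum Pos_zeta)

text \<open>Hermitian symmetry of \<open>t\<close> on the two indices follows from the values of the
  form being real; a direction with a suitable phase then gives the bound.\<close>

lemma cmod_le_half_diagonal:
  fixes t :: "'a \<Rightarrow> 'a \<Rightarrow> complex"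
  assumes psd: "\<And>c d. 0 \<le> c * cnj c * t x x + c * cnj d * t x y + d * cnj c * t y x + d * cnj d * t y y"
  shows "cmod (t x y) \<le> (Re (t x x) + Re (t y y)) / 2"
proof -
  have xx: "Im (t x x) = 0" and yy: "Im (t y y) = 0"
    using psd[of 1 0] psd[of 0 1] by (auto simp: less_eq_complex_def)
  \<comment> \<open>The directions (1, 1) and (1, i) give the two real equations of hermitian
    symmetry.\<close>
  have "Im (t x y) = - Im (t y x)" "Re (t x y) = Re (t y x)"
    using psd[of 1 1] psd[of 1 \<i>] xx yy by (auto simp: less_eq_complex_def algebra_simps)
  then have yx: "t y x = cnj (t x y)" by (simp add: complex_eq_iff)
  show ?thesis
  proof (cases "t x y = 0")
    case True
    then show ?thesis using psd[of 1 1] yx by (simp add: less_eq_complex_def)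
  next
    case False
    define u where "u = sgn (t x y)"
    have u: "u * cnj u = 1" using False by (simp add: u_def complex_norm_square[symmetric] norm_sgn)
    have tu: "t x y = of_real (cmod (t x y)) * u" using False by (simp add: u_def sgn_eq)
    have "cnj u * t x y = of_real (cmod (t x y))" 
      by (subst tu) (simp add: u mult_ac)
    then have a: "cnj (-u) * t x y = - of_real (cmod (t x y))" by simp
    then have "cnj (cnj (-u) * t x y) = cnj (- of_real (cmod (t x y)))" by simp
    then have b: "(-u) * cnj (t x y) = - of_real (cmod (t x y))" by simp
    \<comment> \<open>The phase - u makes both cross terms equal to minus the modulus of t x
      y.\<close>
    have "0 \<le> t x x - of_real (cmod (t x y)) - of_real (cmod (t x y)) + t y y"
      using psd[of 1 "-u"] a b u by (simp add: yx)
    then show ?thesis by (simp add: less_eq_complex_def)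
  qed
qed

text \<open>Lets the product of two basis covectors be viewed as an off-diagonal entry of the
  hermitian form behind \<open>zeta\<close>.\<close>

lemma omega_as_qJ: "\<exists>B' c. cmod c = 1 \<and> omega B = c *s covec (qJ (axis B' 1)) \<and> fst B' = fst B"
proof (cases B)
  case (Pair l b)
  show ?thesis
  proof (cases b)
    case True
    then show ?thesis using Pair
      by (intro exI[of _ "(l, False)"] exI[of _ 1]) (simp add: qJ_axis covec_axis)
  next
    case False
    then show ?thesis using Pair
      by (intro exI[of _ "(l, True)"] exI[of _ "-1"]) (simp add: qJ_axis covec_axis covec_minus)
  qed
qed

text \<open>This is how a 2-form without sign gets controlled by positive mass. Up to unit factors
  the products are entries of a positive semidefinite matrix, so each is bounded by the mean of two
  diagonal entries, and a diagonal entry is one summand of the nonnegative sum for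
  \<open>beta_form\<close>.\<close>

lemma Pos_omega_bound:
  assumes "Pos T"
  shows "cmod (top_coeff (omega A \<curlywedge> omega B \<curlywedge> T)) \<le> Re (top_coeff (beta_form \<curlywedge> T))"
proof -
  obtain B' c where B': "cmod c = 1" "omega B = c *s covec (qJ (axis B' 1))" "fst B' = fst B"
    using omega_as_qJ by metis
  define t where "t X Y = top_coeff (covec (axis X 1) \<curlywedge> covec (qJ (axis Y 1)) \<curlywedge> T)" for X Y
  have psd: "0 \<le> c * cnj c * t X X + c * cnj d * t X Y + d * cnj c * t Y X + d * cnj d * t Y Y" for c d X Y
  proof -
    have "zeta (c *s axis X 1 + d *s axis Y 1) \<curlywedge> T =
       (c * cnj c) *s (covec (axis X 1) \<curlywedge> covec (qJ (axis X 1)) \<curlywedge> T)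
       + (c * cnj d) *s (covec (axis X 1) \<curlywedge> covec (qJ (axis Y 1)) \<curlywedge> T)
       + (d * cnj c) *s (covec (axis Y 1) \<curlywedge> covec (qJ (axis X 1)) \<curlywedge> T)
       + (d * cnj d) *s (covec (axis Y 1) \<curlywedge> covec (qJ (axis Y 1)) \<curlywedge> T)"
      by (simp add: zeta_def covec_add covec_scale qJ_add qJ_scale wedge_add_left wedge_add_right
          wedge_scale_left wedge_scale_right wedge_assoc vec_eq_iff algebra_simps)
    moreover have "0 \<le> top_coeff (zeta (c *s axis X 1 + d *s axis Y 1) \<curlywedge> T)"
      by (intro Pos_top_coeff Pos_zeta assms)
    ultimately show ?thesis by (simp add: t_def top_coeff_add top_coeff_scale)
  qed
  have diag: "Re (t X X) \<le> Re (top_coeff (beta_form \<curlywedge> T))" for X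
  proof -
    \<comment> \<open>Both indices of a block give the same 2-element, so the representative with
      \<open>False\<close> will do.\<close>
    have "t X X = top_coeff (zeta (axis (fst X, False) 1) \<curlywedge> T)"
      by (cases X; cases "snd X") (simp_all add: t_def zeta_axis flip: wedge_assoc zeta_def)
    moreover have "beta_form \<curlywedge> T = (\<Sum>l\<in>UNIV. zeta (axis (l, False) 1) \<curlywedge> T)"
      by (simp add: beta_form_def wedge_sum_left zeta_axis)
    then have "Re (top_coeff (beta_form \<curlywedge> T)) = (\<Sum>l\<in>UNIV. Re (top_coeff (zeta (axis (l, False) 1) \<curlywedge> T)))"
      by (simp add: top_coeff_sum)
    moreover have "Re (top_coeff (zeta (axis (fst X, False) 1) \<curlywedge> T)) \<le> \<dots>"
      using Pos_top_coeff[OF Pos_zeta[OF assms]]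
      by (intro member_le_sum) (auto simp: less_eq_complex_def)
    ultimately show ?thesis by simp
  qed
  have "cmod (top_coeff (omega A \<curlywedge> omega B \<curlywedge> T)) = cmod (t A B')"
    unfolding t_def B' by (simp add: covec_axis wedge_scale_left wedge_scale_right top_coeff_scale norm_mult B')
  also have "\<dots> \<le> (Re (t A A) + Re (t B' B')) / 2"
    by (rule cmod_le_half_diagonal) (rule psd)
  also have "\<dots> \<le> Re (top_coeff (beta_form \<curlywedge> T))"
    using add_mono[OF diag[of A] diag[of B']] by simp
  finally show ?thesis .
qed

text \<open>Cholesky decomposition, by Schur complements.\<close>

lemma psd_rank_one_sum:
  fixes c :: "'i \<Rightarrow> 'i \<Rightarrow> complex"
  assumes "finite I" "\<And>a. 0 \<le> (\<Sum>A\<in>I. \<Sum>B\<in>I. c A B * a A * cnj (a B))"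
  shows "\<exists>(m::nat) w. \<forall>A\<in>I. \<forall>B\<in>I. c A B = (\<Sum>k<m. w k A * cnj (w k B))"
  using assms
proof (induction I arbitrary: c rule: finite_induct)
  case empty
  then show ?case by auto
next
  case (insert i I)
  have two: "0 \<le> p * cnj p * c X X + p * cnj q * c X Y + q * cnj p * c Y X + q * cnj q * c Y Y"
    if "X \<in> insert i I" "Y \<in> insert i I" "X \<noteq> Y" for p q X Y
  proof -
    define a where "a Z = (if Z = X then p else if Z = Y then q else 0)" for Z
    have "(\<Sum>A\<in>insert i I. \<Sum>B\<in>insert i I. c A B * a A * cnj (a B))
      = (\<Sum>A\<in>{X, Y}. \<Sum>B\<in>{X, Y}. c A B * a A * cnj (a B))"
      using that insert.hyps
      by (intro sum.mono_neutral_cong_right sum.mono_neutral_right) (auto simp: a_def intro!: sum.neutral)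
    then show ?thesis
      using insert.prems[of a] that by (simp add: a_def algebra_simps)
  qed
  have diag: "0 \<le> c X X" if "X \<in> insert i I" for X
  proof -
    define a where "a Z = (if Z = X then 1 else 0 :: complex)" for Z
    have "(\<Sum>A\<in>insert i I. \<Sum>B\<in>insert i I. c A B * a A * cnj (a B))
      = (\<Sum>A\<in>{X}. \<Sum>B\<in>{X}. c A B * a A * cnj (a B))"
      using that insert.hyps
      by (intro sum.mono_neutral_cong_right sum.mono_neutral_right) (auto simp: a_def intro!: sum.neutral)
    then show ?thesis using insert.prems[of a] by (simp add: a_def)
  qed
  have herm: "c Y X = cnj (c X Y)" if "X \<in> insert i I" "Y \<in> insert i I" for X Y
  proof (cases "X = Y")
    case True
    with diag[of X] that have "0 \<le> c X X" by simp
    then show ?thesis using True by (simp add: complex_eq_iff less_eq_complex_def)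
  next
    case False
    note t = two[OF that False]
    have "Im (c X X) = 0" "Im (c Y Y) = 0"
      using t[of 1 0] t[of 0 1] by (auto simp: less_eq_complex_def)
    then have "Im (c X Y) = - Im (c Y X)" "Re (c X Y) = Re (c Y X)"
      using t[of 1 1] t[of 1 \<i>] by (auto simp: less_eq_complex_def algebra_simps)
    then show ?thesis by (simp add: complex_eq_iff)
  qed
  have split: "(\<Sum>A\<in>insert i I. \<Sum>B\<in>insert i I. c A B * a A * cnj (a B)) =
     c i i * a i * cnj (a i) + a i * (\<Sum>B\<in>I. c i B * cnj (a B)) + cnj (a i) * (\<Sum>A\<in>I. c A i * a A)
       + (\<Sum>A\<in>I. \<Sum>B\<in>I. c A B * a A * cnj (a B))" for a
    using insert.hyps by (simp add: sum.distrib sum_distrib_left algebra_simps)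
  define d where "d = Re (c i i)"
  have "0 \<le> c i i" using diag by simp
  then have cii: "c i i = of_real d" "0 \<le> d"
    by (auto simp: d_def less_eq_complex_def complex_eq_iff)
  show ?case
  proof (cases "d = 0")
    case True
    \<comment> \<open>A vanishing diagonal entry of a semidefinite matrix kills its row and
      column.\<close>
    have zero: "c A i = 0 \<and> c i A = 0" if "A \<in> I" for A
    proof -
      have "A \<noteq> i" using that insert.hyps by auto
      note t = two[of A i, OF _ _ this]
      have h: "c i A = cnj (c A i)" using herm[of A i] that by simp
      \<comment> \<open>The weight - r c A i on the index \<open>i\<close> enters only linearly,
        because its quadratic term has the coefficient c i i = 0.\<close>
      have "0 \<le> c A A + r * (cmod (c A i))\<^sup>2 * (-2)" for r :: real
      proof -
        have "0 \<le> c A A + cnj (- of_real r * c A i) * c A i + (- of_real r * c A i) * cnj (c A i)"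
          using t[of 1 "- of_real r * c A i"] that cii True h by (simp add: algebra_simps)
        also have "\<dots> = c A A + r * (cmod (c A i))\<^sup>2 * (-2)"
          unfolding of_real_mult complex_norm_square by (simp add: algebra_simps)
        finally show ?thesis .
      qed
      then have r: "2 * r * (cmod (c A i))\<^sup>2 \<le> Re (c A A)" for r :: real
        by (simp add: less_eq_complex_def algebra_simps flip: of_real_power)
      have "c A i = 0"
      proof (rule ccontr)
        assume "c A i \<noteq> 0"
        \<comment> \<open>This r makes the left side 2 (Re (c A A) + 1), while r = 0 shows that Re
          (c A A) is nonnegative.\<close>
        then show False
          using r[of "(Re (c A A) + 1) / (cmod (c A i))\<^sup>2"] r[of 0] by simp
      qed
      then show ?thesis using h by simp
    qed
    have "0 \<le> (\<Sum>A\<in>I. \<Sum>B\<in>I. c A B * a A * cnj (a B))" for a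
      using insert.prems[of a] unfolding split using zero cii True by simp
    from insert.IH[OF this] obtain m :: nat and w where
      w: "\<And>A B. A \<in> I \<Longrightarrow> B \<in> I \<Longrightarrow> c A B = (\<Sum>k<m. w k A * cnj (w k B))" by blast
    show ?thesis
      using w zero cii True insert.hyps
      by (intro exI[of _ m] exI[of _ "\<lambda>k A. if A = i then 0 else w k A"])
        (auto intro!: sum.cong)
  next
    case False
    then have d: "d > 0" using cii by simp
    define w0 where "w0 A = c A i / of_real (sqrt d)" for A
    have sq: "of_real (sqrt d) * of_real (sqrt d) = (of_real d :: complex)"
      using d by (simp flip: of_real_mult)
    have w0w0: "w0 A * cnj (w0 B) = c A i * c i B / of_real d" if "B \<in> insert i I" for A B
      using herm[of B i] that d by (simp add: w0_def sq)
    \<comment> \<open>The Schur complement; its row and column \<open>i\<close> vanish.\<close>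
    define c' where "c' A B = c A B - w0 A * cnj (w0 B)" for A B
    have c': "c' A B = c A B - c A i * c i B / of_real d" if "B \<in> insert i I" for A B
      using w0w0[OF that] by (simp add: c'_def)
    have "0 \<le> (\<Sum>A\<in>I. \<Sum>B\<in>I. c' A B * a A * cnj (a B))" for a
    proof -
      define p where "p = (\<Sum>A\<in>I. c A i * a A)"
      define q where "q = (\<Sum>B\<in>I. c i B * cnj (a B))"
      have pq: "q = cnj p"
        unfolding p_def q_def cnj_sum complex_cnj_mult
      proof (rule sum.cong[OF refl])
        fix B assume "B \<in> I"
        then have "c i B = cnj (c B i)" by (intro herm) auto
        then show "c i B * cnj (a B) = cnj (c B i) * cnj (a B)" by (rule arg_cong)
      qed
      \<comment> \<open>This entry at \<open>i\<close> minimizes the full form in that variable: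
        completing the square leaves the Schur complement.\<close>
      define a' where "a' Z = (if Z = i then - p / of_real d else a Z)" for Z
      have eqs: "(\<Sum>A\<in>I. c A i * a' A) = p" "(\<Sum>B\<in>I. c i B * cnj (a' B)) = q"
        "(\<Sum>A\<in>I. \<Sum>B\<in>I. c A B * a' A * cnj (a' B)) = (\<Sum>A\<in>I. \<Sum>B\<in>I. c A B * a A * cnj (a B))"
        using insert.hyps by (auto simp: a'_def p_def q_def intro!: sum.cong)
      have "(\<Sum>A\<in>I. \<Sum>B\<in>I. c' A B * a A * cnj (a B)) =
         (\<Sum>A\<in>I. \<Sum>B\<in>I. c A B * a A * cnj (a B) - (c A i * a A) * (c i B * cnj (a B)) / of_real d)"
        by (intro sum.cong refl) (simp add: c' algebra_simps)
      also have "\<dots> = (\<Sum>A\<in>I. \<Sum>B\<in>I. c A B * a A * cnj (a B)) - p * q / of_real d"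
        by (simp add: sum_subtractf p_def q_def sum_product sum_divide_distrib)
      also have "\<dots> = (\<Sum>A\<in>insert i I. \<Sum>B\<in>insert i I. c A B * a' A * cnj (a' B))"
        unfolding split eqs using d by (simp add: a'_def cii pq field_simps)
      finally show ?thesis using insert.prems[of a'] by simp
    qed
    from insert.IH[OF this] obtain m :: nat and w where
      w: "\<And>A B. A \<in> I \<Longrightarrow> B \<in> I \<Longrightarrow> c' A B = (\<Sum>k<m. w k A * cnj (w k B))" by blast
    \<comment> \<open>The pivot vector gets the new index \<open>m\<close>, and the vectors found
      for I are extended by 0 at \<open>i\<close>.\<close>
    define w' where "w' k A = (if k = m then w0 A else if A = i then 0 else w k A)" for k A
    have "c A B = (\<Sum>k<Suc m. w' k A * cnj (w' k B))" if "A \<in> insert i I" "B \<in> insert i I" for A B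
    proof -
      have "c' A B = (\<Sum>k<m. w' k A * cnj (w' k B))"
      proof (cases "A = i \<or> B = i")
        case True
        then have "c' A B = 0" using c'[OF that(2), of A] d cii by auto
        then show ?thesis using True by (auto simp: w'_def)
      next
        case False
        then show ?thesis using that w by (auto simp: w'_def intro!: sum.cong)
      qed
      then show ?thesis by (simp add: c'_def w'_def algebra_simps)
    qed
    then show ?thesis by blast
  qed
qed

section \<open>Elementary elements and quaternionic hermitian forms\<close>

lemma covec_wedge_zeta_list:
  assumes "v \<in> set vs"
  shows "covec v \<curlywedge> wedge_list (map zeta vs) = 0" "covec (qJ v) \<curlywedge> wedge_list (map zeta vs) = 0"
proof -
  obtain xs ys where vs: "vs = xs @ v # ys" using assms by (meson split_list)
  show "covec v \<curlywedge> wedge_list (map zeta vs) = 0" "covec (qJ v) \<curlywedge> wedge_list (map zeta vs) = 0"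
    unfolding vs wedge_list_zeta_remove
    by (simp_all add: even_ext_left_commute[OF even_ext_zeta] zeta_wedge_covec flip: wedge_assoc)
      (simp_all add: even_ext_commute[OF even_ext_zeta, symmetric] zeta_wedge_covec)
qed

lemma wedge_list_blocks:
  "distinct js \<Longrightarrow> wedge_list (map (\<lambda>j. zeta (axis (j, False) 1)) js) = omega_set (set js \<times> UNIV)"
  by (induction js) (simp_all add: ext_one_def zeta_axis omega_block omega_block_wedge)

text \<open>Reads a covector as a first row under tau. The entries of that row are x1 + i x2 and -
  x3 - i x4, whence the two minus signs.\<close>

definition qrow :: "complex ^ ('n::finite idx) \<Rightarrow> (real ^ 4) ^ 'n" where
  "qrow v = (\<chi> l. \<chi> i. if i = 1 then Re (v $ (l, False)) else if i = 2 then Im (v $ (l, False))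
     else if i = 3 then - Re (v $ (l, True)) else - Im (v $ (l, True)))"

lemma pullback_qrow:
  "pullback (qrow v) False = covec v" "pullback (qrow v) True = covec (qJ v)"
  by (auto simp: pullback_def covec_def qJ_def qrow_def tau_entry_def complex_eq_iff intro!: sum.cong arg_cong2[where f="(*s)"])

lemma qmult_1_right: "qmult x (axis 1 1) = x"
  by (simp add: qmult_def vec_eq_iff forall_4 axis_def vector_def)

lemma qmult_0_right: "qmult x 0 = 0"
  by (simp add: qmult_def vec_eq_iff forall_4 vector_def)

text \<open>The coefficients of a functional are its values at the coordinate vectors with the
  quaternion 1 as single nonzero entry.\<close>

lemma qmap_axis: "qmap a (axis j (axis 1 1)) = a $ j"
proof -
  have "qmap a (axis j (axis 1 1)) = (\<Sum>l\<in>UNIV. if l = j then a $ j else 0)"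
    unfolding qmap_def by (intro sum.cong) (auto simp: axis_def[of j] qmult_1_right qmult_0_right)
  then show ?thesis by simp
qed

lemma covec_axis_sum: "(\<Sum>A\<in>UNIV. v $ A *s covec (axis A 1)) = covec v"
  unfolding covec_axis by (simp add: covec_def)

text \<open>The functionals are independent because their coefficients in the columns
  \<open>js\<close> form the identity matrix; the corrections sit in column
  \<open>l\<close>.\<close>

lemma elementary_sp_zeta_list:
  assumes js: "distinct js" "l \<notin> set js"
  shows "wedge_list (map zeta (map (\<lambda>j. axis (j, False) 1 - s j *s axis (l, False) 1 - t j *s axis (l, True) 1) js))
    \<in> elementary_sp (length js)"
proof -
  define v :: "'a \<Rightarrow> complex ^ ('a idx)"
    where "v j = axis (j, False) 1 - s j *s axis (l, False) 1 - t j *s axis (l, True) 1" for j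
  define a where "a i = qrow (v (js ! i))" for i
  have entry: "a i $ j = (if j = js ! i then axis 1 1 else 0)" if "i < length js" "j \<in> set js" for i j
  proof -
    have "j \<noteq> l" using that js by auto
    then show ?thesis
      by (auto simp: a_def qrow_def v_def vec_eq_iff axis_def)
  qed
  have "q_independent (length js) a"
    unfolding q_independent_def
  proof (intro allI impI)
    fix c i assume c: "\<forall>v. (\<Sum>i<length js. qmult (c i) (qmap (a i) v)) = 0" and i: "i < length js"
    have "(\<Sum>k<length js. qmult (c k) (qmap (a k) (axis (js ! i) (axis 1 1)))) = (\<Sum>k<length js. if k = i then c i else 0)"
    proof (intro sum.cong refl)
      fix k assume "k \<in> {..<length js}"
      then show "qmult (c k) (qmap (a k) (axis (js ! i) (axis 1 1))) = (if k = i then c i else 0)"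
        using i js by (simp add: qmap_axis entry qmult_1_right qmult_0_right nth_eq_iff_index_eq)
    qed
    then show "c i = 0" using c i by simp
  qed
  moreover have "map zeta (map v js) = map (\<lambda>i. pullback (a i) False \<curlywedge> pullback (a i) True) [0..<length js]"
    by (rule nth_equalityI) (simp_all add: a_def pullback_qrow zeta_def)
  ultimately show ?thesis
    unfolding elementary_sp_def v_def[symmetric] by auto
qed

text \<open>Adding the term for \<open>qJ a\<close> makes the sign of the value depend only on the
  quaternionic line of \<open>a\<close>, see \<open>qform_quaternion_scale\<close>.\<close>

definition qform :: "('n::{finite,linorder} idx \<Rightarrow> 'n idx \<Rightarrow> complex) \<Rightarrow> complex ^ ('n idx) \<Rightarrow> complex" where
  "qform c a = (\<Sum>A\<in>UNIV. \<Sum>B\<in>UNIV. c A B * (a $ A * cnj (a $ B) + qJ a $ A * cnj (qJ a $ B)))"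

text \<open>The vector \<open>qJ (p *s a + q *s qJ a)\<close> has coefficients - cnj q and cnj p, so
  the mixed terms of the two summands cancel. The factor is the squared norm of the quaternion with
  components p and q.\<close>

lemma qform_quaternion_scale:
  "qform c (p *s a + q *s qJ a) = (p * cnj p + q * cnj q) * qform c a"
  unfolding qform_def sum_distrib_left
  by (intro sum.cong refl) (simp add: qJ_add qJ_scale qJ_qJ algebra_simps)

text \<open>Wedging with the elementary form of the quaternionic linear functionals that vanish on a given
  vector evaluates the quaternionic hermitian form of \<open>w\<close> at that vector.\<close>

lemma qform_eq_top_coeff:
  fixes a :: "complex ^ ('n::{finite,linorder} idx)"
  assumes a: "a $ (l, False) = 1" "a $ (l, True) = 0"
  obtains \<eta> where "\<eta> \<in> elementary_sp (CARD('n) - 1)"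
    "\<And>c. top_coeff ((\<Sum>A\<in>UNIV. \<Sum>B\<in>UNIV. c A B *s (covec (axis A 1) \<curlywedge> covec (qJ (axis B 1)))) \<curlywedge> \<eta>) = qform c a"
proof -
  obtain js where js: "set js = - {l}" "distinct js"
    using finite_distinct_list[of "- {l}"] by auto
  have len: "length js = CARD('n) - 1"
    using distinct_card[OF js(2)] by (simp add: js(1) Compl_eq_Diff_UNIV card_Diff_singleton)
  define b where "b = qJ a"
  have b: "b $ (l, False) = 0" "b $ (l, True) = 1"
    using a by (simp_all add: b_def qJ_def)
  define e where "e = (axis (l, False) 1 :: complex ^ ('n idx))"
  define E E' where "E = covec e" and "E' = covec (qJ e)"
  have Je: "qJ e = axis (l, True) 1" by (simp add: e_def qJ_axis)
  \<comment> \<open>Modulo these covectors and their images under \<open>qJ\<close>, every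
    coordinate covector is a combination of \<open>e\<close> and \<open>qJ e\<close> whose
    coefficients are its coordinates in \<open>a\<close> and \<open>qJ a\<close>.\<close>
  define v where "v j = axis (j, False) 1 - a $ (j, False) *s e - b $ (j, False) *s qJ e" for j
  define P where "P = wedge_list (map zeta (map v js))"
  have P: "P \<in> elementary_sp (CARD('n) - 1)"
    unfolding P_def v_def Je unfolding e_def len[symmetric]
    by (rule elementary_sp_zeta_list) (use js in auto)
  have vP: "covec (v j) \<curlywedge> P = 0" "covec (qJ (v j)) \<curlywedge> P = 0" if "j \<noteq> l" for j
  proof -
    have "v j \<in> set (map v js)" using that js by simp
    then show "covec (v j) \<curlywedge> P = 0" "covec (qJ (v j)) \<curlywedge> P = 0"
      unfolding P_def by (fact covec_wedge_zeta_list)+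
  qed
  have ax: "covec (axis A 1) \<curlywedge> P = (a $ A *s E + b $ A *s E') \<curlywedge> P" for A
  proof (cases "fst A = l")
    case True
    then show ?thesis
      using a b by (cases A; cases "snd A") (simp_all add: E_def E'_def e_def qJ_axis)
  next
    case False
    obtain j where j: "A = (j, False) \<or> A = (j, True)" "j \<noteq> l"
      using False by (cases A; cases "snd A") auto
    have "axis (j, False) 1 = v j + a $ (j, False) *s e + b $ (j, False) *s qJ e"
      by (simp add: v_def)
    then have 1: "covec (axis (j, False) 1) \<curlywedge> P = (a $ (j, False) *s E + b $ (j, False) *s E') \<curlywedge> P"
      using vP[OF j(2)] by (simp add: covec_add covec_scale wedge_add_left E_def E'_def)
    have "axis (j, True) 1 = qJ (axis (j, False) 1)"
      by (simp add: qJ_axis)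
    also have "\<dots> = qJ (v j + a $ (j, False) *s e + b $ (j, False) *s qJ e)"
      by (simp add: v_def)
    also have "\<dots> = qJ (v j) + a $ (j, True) *s e + b $ (j, True) *s qJ e"
      unfolding qJ_add qJ_scale qJ_qJ by (simp add: b_def qJ_def vec_eq_iff)
    finally have "covec (axis (j, True) 1) \<curlywedge> P = (a $ (j, True) *s E + b $ (j, True) *s E') \<curlywedge> P"
      using vP[OF j(2)] by (simp add: covec_add covec_scale wedge_add_left E_def E'_def)
    with 1 j show ?thesis by auto
  qed
  have axJ: "covec (qJ (axis B 1)) \<curlywedge> P = (- cnj (b $ B) *s E + cnj (a $ B) *s E') \<curlywedge> P" for B
  proof -
    obtain j where j: "B = (j, False) \<or> B = (j, True)" by (metis (full_types) surj_pair)
    then show ?thesis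
      by (auto simp: qJ_axis covec_minus wedge_minus_left ax)
        (simp_all add: b_def qJ_def wedge_add_left wedge_scale_left wedge_diff_left)
  qed
  have oE: "odd_ext (x *s E + y *s E')" for x y
    unfolding E_def E'_def by (intro odd_ext_add odd_ext_scale odd_ext_covec)
  \<comment> \<open>In the presence of \<open>zeta e\<close> the corrections in \<open>v\<close>
    drop out, which leaves the product of all coordinate blocks.\<close>
  have "zeta e \<curlywedge> P = zeta e \<curlywedge> wedge_list (map (\<lambda>j. zeta (axis (j, False) 1)) js)"
    unfolding P_def map_map o_def v_def by (rule zeta_elim_list)
  also have "\<dots> = omega_set ({l} \<times> UNIV) \<curlywedge> omega_set (set js \<times> UNIV)"
    unfolding wedge_list_blocks[OF js(2)] by (simp add: e_def zeta_axis omega_block)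
  also have "\<dots> = omega_set UNIV"
    using js by (subst omega_block_wedge) (auto intro!: arg_cong[where f=omega_set])
  finally have top: "zeta e \<curlywedge> P = omega_set UNIV" .
  have entry: "(covec (axis A 1) \<curlywedge> covec (qJ (axis B 1))) \<curlywedge> P
      = (a $ A * cnj (a $ B) + b $ A * cnj (b $ B)) *s omega_set UNIV" for A B
  proof -
    have "(covec (axis A 1) \<curlywedge> covec (qJ (axis B 1))) \<curlywedge> P
        = (covec (axis A 1) \<curlywedge> (- cnj (b $ B) *s E + cnj (a $ B) *s E')) \<curlywedge> P"
      by (simp only: wedge_assoc axJ)
    also have "\<dots> = - ((- cnj (b $ B) *s E + cnj (a $ B) *s E') \<curlywedge> ((a $ A *s E + b $ A *s E') \<curlywedge> P))"
      by (simp only: odd_ext_anticommute[OF odd_ext_covec oE] wedge_minus_left wedge_assoc ax)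
    also have "\<dots> = ((a $ A *s E + b $ A *s E') \<curlywedge> (- cnj (b $ B) *s E + cnj (a $ B) *s E')) \<curlywedge> P"
      by (simp only: odd_ext_anticommute[OF oE[of "a $ A" "b $ A"] oE] wedge_minus_left flip: wedge_assoc)
    also have "(a $ A *s E + b $ A *s E') \<curlywedge> (- cnj (b $ B) *s E + cnj (a $ B) *s E')
        = (a $ A * cnj (a $ B) + b $ A * cnj (b $ B)) *s zeta e"
      unfolding zeta_def E_def[symmetric] E'_def[symmetric]
      using covec_square[of e] covec_square[of "qJ e"] covec_anticommute[of "qJ e" e]
      by (simp add: wedge_add_left wedge_add_right wedge_scale_left wedge_scale_right wedge_diff_right
          E_def[symmetric] E'_def[symmetric] vec_eq_iff algebra_simps)
    finally show ?thesis by (simp only: wedge_scale_left top)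
  qed
  have "top_coeff ((\<Sum>A\<in>UNIV. \<Sum>B\<in>UNIV. c A B *s (covec (axis A 1) \<curlywedge> covec (qJ (axis B 1)))) \<curlywedge> P) = qform c a" for c
    unfolding wedge_sum_left wedge_scale_left entry top_coeff_sum qform_def b_def
    by (simp add: top_coeff_def omega_set_nth distrib_left)
  with P show ?thesis by (rule that)
qed

text \<open>Pairing with elementary elements evaluates the quaternionic hermitian form of
  \<open>w\<close> at normalized vectors. By scaling, this makes the form semidefinite, and its
  Cholesky decomposition supplies the summands.\<close>

lemma zeta_sum_of_positive:
  fixes m :: "'n::{finite,linorder} idx \<Rightarrow> 'n idx \<Rightarrow> complex"
  assumes w: "w = (\<Sum>A\<in>UNIV. \<Sum>B\<in>UNIV. m A B *s (omega A \<curlywedge> omega B))"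
    and pos: "\<And>\<eta>. \<eta> \<in> elementary_sp (CARD('n) - 1) \<Longrightarrow> 0 \<le> top_coeff (w \<curlywedge> \<eta>)"
  shows "zeta_sum w"
proof -
  \<comment> \<open>In coordinates \<open>qJ\<close> is conjugation combined with a swap inside each
    block and the sign \<open>sg\<close>.\<close>
  define flip :: "'n idx \<Rightarrow> 'n idx" where "flip A = (fst A, \<not> snd A)" for A
  define sg :: "'n idx \<Rightarrow> complex" where "sg A = (if snd A then 1 else -1)" for A
  have ff: "flip (flip A) = A" for A by (simp add: flip_def)
  have bij: "bij flip" by (metis ff involuntory_imp_bij)
  have sgf: "sg (flip A) = - sg A" "sg A * sg A = 1" "cnj (sg A) = sg A" for A by (auto simp: sg_def flip_def)
  have Jflip: "covec (qJ (axis B 1)) = - sg B *s omega (flip B)" for B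
    by (cases B; cases "snd B") (simp_all add: qJ_axis covec_axis covec_minus sg_def flip_def)
  have qJ_sg: "qJ a $ A = sg A * cnj (a $ flip A)" for a A
    by (cases A) (auto simp: qJ_def sg_def flip_def)
  define F :: "('n idx \<Rightarrow> 'n idx \<Rightarrow> complex) \<Rightarrow> 'n ext" where "F c = (\<Sum>A\<in>UNIV. \<Sum>B\<in>UNIV. c A B *s (covec (axis A 1) \<curlywedge> covec (qJ (axis B 1))))" for c
  \<comment> \<open>Rewrites the second covector as an image under \<open>qJ\<close>, the shape in
    which the hermitian form appears.\<close>
  define c where "c A B = - sg B * m A (flip B)" for A B
  have Fw: "F c = w"
  proof -
    have "(\<Sum>B\<in>UNIV. c A B *s (covec (axis A 1) \<curlywedge> covec (qJ (axis B 1))))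
        = (\<Sum>B\<in>UNIV. m A (flip B) *s (omega A \<curlywedge> omega (flip B)))" for A
      by (intro sum.cong refl)
        (simp add: c_def Jflip covec_axis wedge_scale_right wedge_minus_right sg_def)
    then have "F c = (\<Sum>A\<in>UNIV. \<Sum>B\<in>UNIV. m A (flip B) *s (omega A \<curlywedge> omega (flip B)))"
      by (simp add: F_def)
    also have "\<dots> = w"
      unfolding w using sum.reindex_bij_betw[OF bij, of "\<lambda>B. m A B *s (omega A \<curlywedge> omega B)" for A] by simp
    finally show ?thesis .
  qed
  have norm_nonneg: "0 \<le> qform c a" if a: "a $ (l, False) = 1" "a $ (l, True) = 0" for a l
  proof -
    obtain \<eta> where "\<eta> \<in> elementary_sp (CARD('n) - 1)" and \<eta>: "\<And>c. top_coeff (F c \<curlywedge> \<eta>) = qform c a"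
      by (rule qform_eq_top_coeff[OF a]) (auto simp: F_def)
    then have "0 \<le> top_coeff (F c \<curlywedge> \<eta>)"
      unfolding Fw by (intro pos)
    then show ?thesis by (simp only: \<eta>)
  qed
  have nonneg: "0 \<le> qform c a" for a
  proof (cases "a = 0")
    case True
    then show ?thesis by (simp add: qform_def)
  next
    case False
    then obtain l b where lb: "a $ (l, b) \<noteq> 0" by (metis surj_pair vec_eq_iff zero_index)
    define x y where "x = a $ (l, False)" and "y = a $ (l, True)"
    define N where "N = (cmod x)\<^sup>2 + (cmod y)\<^sup>2"
    have "x \<noteq> 0 \<or> y \<noteq> 0" using lb by (cases b) (auto simp: x_def y_def)
    then have N: "N > 0" by (auto simp: N_def sum_power2_gt_zero_iff)
    have Nc: "of_real N = x * cnj x + y * cnj y"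
      by (simp only: N_def of_real_add complex_norm_square)
    \<comment> \<open>The quaternionic multiplier that turns the nonzero block (x, y) into (1, 0),
      as \<open>norm_nonneg\<close> requires.\<close>
    define p q where "p = cnj x / of_real N" and "q = - y / of_real N"
    have "(p *s a + q *s qJ a) $ (l, False) = (x * cnj x + y * cnj y) / of_real N"
      "(p *s a + q *s qJ a) $ (l, True) = 0"
      by (simp_all add: p_def q_def qJ_def flip: x_def y_def) (simp_all add: field_simps add_divide_distrib)
    then have "0 \<le> qform c (p *s a + q *s qJ a)"
      using N by (intro norm_nonneg[of _ l]) (simp_all flip: Nc)
    moreover have "p * cnj p + q * cnj q = of_real (1 / N)"
    proof -
      have "p * cnj p + q * cnj q = (x * cnj x + y * cnj y) / (of_real N * of_real N)"
        by (simp add: p_def q_def add_divide_distrib mult_ac)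
      then show ?thesis using N by (simp flip: Nc)
    qed
    ultimately have "0 \<le> of_real (1 / N) * qform c a"
      by (simp only: qform_quaternion_scale)
    then have "0 \<le> (1 / N) * Re (qform c a)" "0 = (1 / N) * Im (qform c a)"
      by (simp_all only: less_eq_complex_def Re_complex_of_real Im_complex_of_real times_complex.sel zero_complex.sel)
        simp_all
    then show ?thesis using N by (simp add: less_eq_complex_def zero_le_divide_iff)
  qed
  \<comment> \<open>Shifts the \<open>qJ a\<close> part of \<open>qform\<close> onto the
    coefficients; what results is an ordinary hermitian form, to which the Cholesky decomposition
    applies.\<close>
  define c' where "c' A B = c A B + sg A * sg B * c (flip B) (flip A)" for A B
  have "(\<Sum>A\<in>UNIV. \<Sum>B\<in>UNIV. c' A B * a $ A * cnj (a $ B)) = qform c a" for a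
  proof -
    have "(\<Sum>A\<in>UNIV. \<Sum>B\<in>UNIV. sg A * sg B * c (flip B) (flip A) * a $ A * cnj (a $ B))
       = (\<Sum>A\<in>UNIV. \<Sum>B\<in>UNIV. sg (flip A) * sg (flip B) * c (flip (flip B)) (flip (flip A)) * a $ flip A * cnj (a $ flip B))"
      by (subst sum.reindex_bij_betw[OF bij, symmetric], rule sum.cong[OF refl],
          subst sum.reindex_bij_betw[OF bij, symmetric], rule refl)
    also have "\<dots> = (\<Sum>A\<in>UNIV. \<Sum>B\<in>UNIV. sg A * sg B * c B A * a $ flip A * cnj (a $ flip B))"
      by (simp add: ff sgf)
    also have "\<dots> = (\<Sum>B\<in>UNIV. \<Sum>A\<in>UNIV. sg A * sg B * c B A * a $ flip A * cnj (a $ flip B))"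
      by (rule sum.swap)
    also have "\<dots> = (\<Sum>A\<in>UNIV. \<Sum>B\<in>UNIV. c A B * (qJ a $ A * cnj (qJ a $ B)))"
      by (intro sum.cong refl) (simp add: qJ_sg sgf mult_ac)
    finally show ?thesis
      unfolding qform_def c'_def by (simp add: distrib_left distrib_right sum.distrib mult.assoc)
  qed
  with nonneg have "0 \<le> (\<Sum>A\<in>UNIV. \<Sum>B\<in>UNIV. c' A B * a $ A * cnj (a $ B))" for a
    by simp
  from this[of "\<chi> A. a A" for a] have "0 \<le> (\<Sum>A\<in>UNIV. \<Sum>B\<in>UNIV. c' A B * a A * cnj (a B))" for a
    by simp
  from psd_rank_one_sum[OF finite this] obtain k :: nat and u where
    u: "\<And>A B. c' A B = (\<Sum>i<k. u i A * cnj (u i B))" by auto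
  have "F c' = (\<Sum>i<k. zeta (\<chi> A. u i A))"
  proof -
    have z: "zeta v = (\<Sum>A\<in>UNIV. \<Sum>B\<in>UNIV. (v $ A * cnj (v $ B)) *s (covec (axis A 1) \<curlywedge> covec (qJ (axis B 1))))" for v :: "complex ^ ('n idx)"
    proof -
      have "covec (qJ v) = (\<Sum>A\<in>UNIV. qJ v $ A *s omega A)" by (simp add: covec_def)
      also have "\<dots> = (\<Sum>A\<in>UNIV. qJ v $ flip A *s omega (flip A))"
        by (rule sum.reindex_bij_betw[OF bij, symmetric])
      also have "\<dots> = (\<Sum>B\<in>UNIV. cnj (v $ B) *s covec (qJ (axis B 1)))"
        by (intro sum.cong refl) (simp add: qJ_sg ff sgf Jflip vector_smult_assoc mult.commute)
      finally have J: "covec (qJ v) = (\<Sum>B\<in>UNIV. cnj (v $ B) *s covec (qJ (axis B 1)))" .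
      show ?thesis
        unfolding zeta_def J covec_axis_sum[of v, symmetric] wedge_sum_left
        by (simp add: wedge_sum_right wedge_scale_left wedge_scale_right vector_smult_assoc
            covec_axis_sum mult.commute)
    qed
    have "(\<Sum>i<k. zeta (\<chi> A. u i A)) = (\<Sum>A\<in>UNIV. \<Sum>B\<in>UNIV. \<Sum>i<k. (u i A * cnj (u i B)) *s (covec (axis A 1) \<curlywedge> covec (qJ (axis B 1))))"
      unfolding z by (simp add: sum.swap[of _ "{..<k}"])
    also have "\<dots> = F c'"
      unfolding F_def u by (simp add: vec_eq_iff sum_distrib_right)
    finally show ?thesis by simp
  qed
  moreover have "F c' = w + w"
  proof -
    \<comment> \<open>The reflected coefficients describe the same 2-element because covectors
      anticommute; hence \<open>F c'\<close> counts \<open>w\<close> twice.\<close>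
    have "F (\<lambda>A B. sg A * sg B * c (flip B) (flip A)) = (\<Sum>A\<in>UNIV. \<Sum>B\<in>UNIV. c A B *s (covec (axis A 1) \<curlywedge> covec (qJ (axis B 1))))"
    proof -
      have "F (\<lambda>A B. sg A * sg B * c (flip B) (flip A)) =
         (\<Sum>A\<in>UNIV. \<Sum>B\<in>UNIV. (sg (flip A) * sg (flip B) * c (flip (flip B)) (flip (flip A))) *s (covec (axis (flip A) 1) \<curlywedge> covec (qJ (axis (flip B) 1))))"
        unfolding F_def by (subst sum.reindex_bij_betw[OF bij, symmetric], rule sum.cong[OF refl],
          subst sum.reindex_bij_betw[OF bij, symmetric], rule refl)
      also have "\<dots> = (\<Sum>A\<in>UNIV. \<Sum>B\<in>UNIV. c B A *s (covec (axis B 1) \<curlywedge> covec (qJ (axis A 1))))"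
      proof (intro sum.cong refl)
        fix A B
        have "covec (axis (flip A) 1) \<curlywedge> covec (qJ (axis (flip B) 1)) = sg B *s (omega (flip A) \<curlywedge> omega B)"
          by (simp add: Jflip covec_axis ff sgf wedge_scale_right)
        moreover have "covec (axis B 1) \<curlywedge> covec (qJ (axis A 1)) = sg A *s (omega (flip A) \<curlywedge> omega B)"
          using odd_ext_anticommute[OF odd_ext_omega odd_ext_omega, of B "flip A"]
          by (simp add: Jflip covec_axis wedge_scale_right wedge_minus_right vec_eq_iff)
        ultimately show "(sg (flip A) * sg (flip B) * c (flip (flip B)) (flip (flip A))) *s (covec (axis (flip A) 1) \<curlywedge> covec (qJ (axis (flip B) 1)))
            = c B A *s (covec (axis B 1) \<curlywedge> covec (qJ (axis A 1)))"
          by (simp add: ff sgf vector_smult_assoc mult_ac)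
      qed
      finally show ?thesis by (subst (asm) sum.swap)
    qed
    then have "F (\<lambda>A B. sg A * sg B * c (flip B) (flip A)) = w" by (simp add: Fw flip: F_def)
    moreover have "F c' = F c + F (\<lambda>A B. sg A * sg B * c (flip B) (flip A))"
      unfolding F_def c'_def by (simp add: vector_sadd_rdistrib sum.distrib)
    ultimately show ?thesis by (simp add: Fw)
  qed
  moreover have "w = (1/2) *\<^sub>R (w + w)"
    by (simp add: vec_eq_iff)
  ultimately have "w = (\<Sum>i<k. (1/2) *\<^sub>R zeta (\<chi> A. u i A))"
    by (simp only: scaleR_right.sum)
  then show ?thesis
    unfolding zeta_sum_def
    by (intro exI[of _ k] exI[of _ "\<lambda>_. 1/2 :: real"] exI[of _ "\<lambda>i. \<chi> A. u i A"]) simp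
qed

section \<open>Functions of class \<open>C\<^sup>k\<close>\<close>

abbreviation dird :: "'a::euclidean_space \<Rightarrow> ('a \<Rightarrow> 'b::real_normed_vector) \<Rightarrow> 'a \<Rightarrow> 'b" where
  "dird v f \<equiv> (\<lambda>x. frechet_derivative f (at x) v)"

lemma dirdI: "(f has_derivative f') (at x) \<Longrightarrow> dird v f x = f' v"
  by (metis frechet_derivative_at)

lemma differentiable_has_dird: "f differentiable (at x) \<Longrightarrow> (f has_derivative (\<lambda>v. dird v f x)) (at x)"
  using frechet_derivative_works by blast

lemma Ck_on_imp_differentiable: "Ck_on (Suc k) f U \<Longrightarrow> x \<in> U \<Longrightarrow> f differentiable (at x)"
  by simp

lemma Ck_on_has_dird: "Ck_on (Suc k) f U \<Longrightarrow> x \<in> U \<Longrightarrow> (f has_derivative (\<lambda>v. dird v f x)) (at x)"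
  by (simp add: differentiable_has_dird)

lemma Ck_on_dird: "Ck_on (Suc k) f U \<Longrightarrow> Ck_on k (dird v f) U"
  by simp

lemma Ck_on_Suc_imp: "Ck_on (Suc k) f U \<Longrightarrow> Ck_on k f U"
proof (induction k arbitrary: f)
  case 0
  then show ?case
    by (auto intro!: continuous_at_imp_continuous_on differentiable_imp_continuous_within)
next
  case (Suc k)
  then show ?case by (metis Ck_on.simps(2))
qed

lemma Ck_on_le: "Ck_on k f U \<Longrightarrow> j \<le> k \<Longrightarrow> Ck_on j f U"
  by (induction k) (auto simp: le_Suc_eq simp del: Ck_on.simps dest: Ck_on_Suc_imp)

lemma Ck_on_continuous: "Ck_on k f U \<Longrightarrow> continuous_on U f"
  using Ck_on_le[of k f U 0] by simp

lemma Ck_on_subset: "Ck_on k f U \<Longrightarrow> V \<subseteq> U \<Longrightarrow> Ck_on k f V"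
  by (induction k arbitrary: f) (auto intro: continuous_on_subset)

lemma Ck_on_cong:
  assumes "open U" "\<And>x. x \<in> U \<Longrightarrow> f x = g x" "Ck_on k f U"
  shows "Ck_on k g U"
  using assms(2,3)
proof (induction k arbitrary: f g)
  case 0
  then show ?case by (simp cong: continuous_on_cong)
next
  case (Suc k)
  have d: "(g has_derivative (\<lambda>v. dird v f x)) (at x)" if "x \<in> U" for x
    by (rule has_derivative_transform_within_open[OF Ck_on_has_dird[OF Suc.prems(2) that] \<open>open U\<close> that])
      (rule Suc.prems(1))
  then have "dird v f x = dird v g x" if "x \<in> U" for x v
    using that by (metis dirdI)
  moreover have "Ck_on k (dird v f) U" for v
    using Suc.prems(2) by simp
  ultimately have "Ck_on k (dird v g) U" for v
    by (rule Suc.IH)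
  moreover have "g differentiable (at x)" if "x \<in> U" for x
    using d[OF that] by (auto simp: differentiable_def)
  ultimately show ?case by simp
qed

lemma Ck_on_const: "Ck_on k (\<lambda>x. c) U"
  by (induction k arbitrary: c) simp_all

lemma dird_add:
  assumes "f differentiable (at x)" "g differentiable (at x)"
  shows "dird v (\<lambda>x. f x + g x) x = dird v f x + dird v g x"
  by (rule dirdI) (intro derivative_intros differentiable_has_dird assms)

lemma Ck_on_add:
  assumes "open U"
  shows "Ck_on k f U \<Longrightarrow> Ck_on k g U \<Longrightarrow> Ck_on k (\<lambda>x. f x + g x) U"
proof (induction k arbitrary: f g)
  case 0
  then show ?case by (auto intro: continuous_intros)
next
  case (Suc k)
  have "Ck_on k (dird v (\<lambda>x. f x + g x)) U" for v
    by (rule Ck_on_cong[OF assms, where f="\<lambda>x. dird v f x + dird v g x"])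
      (use Suc in \<open>auto simp: dird_add\<close>)
  with Suc.prems show ?case by simp
qed

lemma Ck_on_sum:
  assumes "open U"
  shows "(\<And>i. i \<in> A \<Longrightarrow> Ck_on k (f i) U) \<Longrightarrow> Ck_on k (\<lambda>x. \<Sum>i\<in>A. f i x) U"
  by (induction A rule: infinite_finite_induct) (auto intro: Ck_on_add assms Ck_on_const)

lemma (in bounded_bilinear) dird_prod:
  fixes f :: "'d::euclidean_space \<Rightarrow> 'a" and g :: "'d \<Rightarrow> 'b"
  assumes "f differentiable (at x)" "g differentiable (at x)"
  shows "dird v (\<lambda>x. prod (f x) (g x)) x = prod (f x) (dird v g x) + prod (dird v f x) (g x)"
  by (rule dirdI) (rule FDERIV[OF differentiable_has_dird[OF assms(1)] differentiable_has_dird[OF assms(2)]])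

lemma (in bounded_bilinear) differentiable_prod:
  fixes f :: "'d::euclidean_space \<Rightarrow> 'a" and g :: "'d \<Rightarrow> 'b"
  assumes "f differentiable (at x)" "g differentiable (at x)"
  shows "(\<lambda>x. prod (f x) (g x)) differentiable (at x)"
  using FDERIV[OF differentiable_has_dird[OF assms(1)] differentiable_has_dird[OF assms(2)]]
  by (auto simp: differentiable_def)

lemma (in bounded_bilinear) Ck_on_prod:
  fixes f :: "'d::euclidean_space \<Rightarrow> 'a" and g :: "'d \<Rightarrow> 'b"
  assumes "open U"
  shows "Ck_on k f U \<Longrightarrow> Ck_on k g U \<Longrightarrow> Ck_on k (\<lambda>x. prod (f x) (g x)) U"
proof (induction k arbitrary: f g)
  case 0
  then show ?case by (auto intro: continuous_on)
next
  case (Suc k)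
  have "Ck_on k (dird v (\<lambda>x. prod (f x) (g x))) U" for v
  proof (rule Ck_on_cong[OF assms])
    show "Ck_on k (\<lambda>x. prod (f x) (dird v g x) + prod (dird v f x) (g x)) U"
      using Suc.prems by (intro Ck_on_add Suc.IH assms) (auto simp del: Ck_on.simps intro: Ck_on_Suc_imp Ck_on_dird)
  qed (use Suc.prems in \<open>simp add: dird_prod\<close>)
  with Suc.prems show ?case by (auto intro!: differentiable_prod)
qed

lemma (in bounded_linear) dird_linear:
  fixes g :: "'d::euclidean_space \<Rightarrow> 'a"
  assumes "g differentiable (at x)"
  shows "dird v (\<lambda>x. f (g x)) x = f (dird v g x)"
  by (rule dirdI) (rule has_derivative[OF differentiable_has_dird[OF assms]])

lemma (in bounded_linear) differentiable_linear:
  fixes g :: "'d::euclidean_space \<Rightarrow> 'a"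
  assumes "g differentiable (at x)"
  shows "(\<lambda>x. f (g x)) differentiable (at x)"
  using has_derivative[OF differentiable_has_dird[OF assms]] by (auto simp: differentiable_def)

lemma (in bounded_linear) Ck_on_linear:
  fixes g :: "'d::euclidean_space \<Rightarrow> 'a"
  assumes "open U"
  shows "Ck_on k g U \<Longrightarrow> Ck_on k (\<lambda>x. f (g x)) U"
proof (induction k arbitrary: g)
  case 0
  then show ?case by (auto intro: continuous_on)
next
  case (Suc k)
  have "Ck_on k (dird v (\<lambda>x. f (g x))) U" for v
    by (rule Ck_on_cong[OF assms, where f="\<lambda>x. f (dird v g x)"]) (use Suc in \<open>auto simp: dird_linear\<close>)
  with Suc.prems show ?case by (auto intro!: differentiable_linear)
qed

lemma Ck_on_bounded_linear:
  assumes "bounded_linear f"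
  shows "Ck_on k f U"
proof (cases k)
  case 0
  then show ?thesis using assms by (auto intro: linear_continuous_on)
next
  case (Suc j)
  have "dird v f = (\<lambda>x. f v)" for v
    using dirdI[OF bounded_linear_imp_has_derivative[OF assms]] by auto
  then show ?thesis
    using assms unfolding Suc by (auto intro: Ck_on_const bounded_linear_imp_differentiable)
qed

text \<open>\<Omega> and the complement of Q form an open cover, and all derivatives vanish on the
  second set.\<close>

lemma Ck_on_zero_extension:
  assumes "open \<Omega>" "closed Q" "Q \<subseteq> \<Omega>" "\<And>x. x \<notin> Q \<Longrightarrow> f x = 0" "Ck_on k f \<Omega>"
  shows "Ck_on k f UNIV"
  using assms(4,5)
proof (induction k arbitrary: f)
  case 0
  have "continuous_on (- Q) f"
    using 0 by (subst continuous_on_cong[OF refl, where g="\<lambda>_. 0"]) auto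
  moreover have "\<Omega> \<union> - Q = UNIV" using assms by auto
  ultimately show ?case
    using 0 assms(1,2) continuous_on_open_Un[of \<Omega> "- Q" f] by (simp add: open_Compl)
next
  case (Suc k)
  have off: "(f has_derivative (\<lambda>v. 0)) (at x)" if "x \<notin> Q" for x
    by (rule has_derivative_transform_within_open[where f="\<lambda>x. 0" and s="- Q"])
      (use that Suc.prems assms(2) in \<open>auto simp: open_Compl\<close>)
  have "dird v f x = 0" if "x \<notin> Q" for x v
    by (rule dirdI[OF off[OF that]])
  then have "Ck_on k (dird v f) UNIV" for v
    using Suc.prems by (intro Suc.IH) simp_all
  moreover have "f differentiable (at x)" for x
    using off[of x] Suc.prems(2) assms(3) by (cases "x \<in> Q") (auto simp: differentiable_def)
  ultimately show ?case by simp
qed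

lemma dird_zero_off:
  assumes "closed Q" "\<And>x. x \<notin> Q \<Longrightarrow> f x = 0" "x \<notin> Q"
  shows "dird v f x = 0"
  by (rule dirdI[where f'="\<lambda>v. 0"], rule has_derivative_transform_within_open[where f="\<lambda>x. 0" and s="- Q"])
    (use assms in \<open>auto simp: open_Compl\<close>)

lemma dird_cong:
  assumes "open U" "x \<in> U" "\<And>y. y \<in> U \<Longrightarrow> f y = g y"
  shows "dird v f x = dird v g x"
proof (cases "f differentiable (at x)")
  case True
  from has_derivative_transform_within_open[OF differentiable_has_dird[OF True] assms(1,2), of g]
  show ?thesis using assms(3) by (metis dirdI)
next
  case False
  \<comment> \<open>Neither function has a derivative, so both values come from the same default
    choice.\<close>
  have "\<not> (g has_derivative g') (at x)" for g'
    using False assms has_derivative_transform_within_open[of g g' x UNIV U f] by (auto simp: differentiable_def)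
  then show ?thesis
    using False by (auto simp: frechet_derivative_def differentiable_def)
qed

lemma dird_linear_vector:
  assumes "f differentiable (at x)"
  shows "dird (v + w) f x = dird v f x + dird w f x" "dird (r *\<^sub>R v) f x = r *\<^sub>R dird v f x" "dird 0 f x = 0"
proof -
  have "linear (frechet_derivative f (at x))"
    using assms by (rule linear_frechet_derivative)
  then show "dird (v + w) f x = dird v f x + dird w f x" "dird (r *\<^sub>R v) f x = r *\<^sub>R dird v f x" "dird 0 f x = 0"
    by (simp_all add: linear_add linear_scale linear_0)
qed

section \<open>Symmetry of second directional derivatives\<close>

lemma dird_along_line:
  fixes f :: "'a::euclidean_space \<Rightarrow> 'b::real_normed_vector"
  assumes "f differentiable (at (x + t *\<^sub>R v))"
  shows "((\<lambda>t. f (x + t *\<^sub>R v)) has_vector_derivative dird v f (x + t *\<^sub>R v)) (at t)"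
proof -
  have "((\<lambda>t. x + t *\<^sub>R v) has_derivative (\<lambda>s. s *\<^sub>R v)) (at t)"
    by (auto intro!: derivative_eq_intros)
  from diff_chain_at[OF this differentiable_has_dird[OF assms]]
  show ?thesis
    by (simp add: has_vector_derivative_def o_def dird_linear_vector[OF assms])
qed

text \<open>The mean value theorem is applied first to the difference \<open>p\<close> in the
  direction \<open>v\<close>, then to the first derivative in the direction
  \<open>w\<close>.\<close>

lemma second_difference_mean_value:
  fixes f :: "'a::euclidean_space \<Rightarrow> real"
  assumes f: "Ck_on 2 f U" and h: "0 < h"
    and U: "\<And>s t. 0 \<le> s \<Longrightarrow> s \<le> h \<Longrightarrow> 0 \<le> t \<Longrightarrow> t \<le> h \<Longrightarrow> x + s *\<^sub>R v + t *\<^sub>R w \<in> U"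
  shows "\<exists>s t. 0 < s \<and> s < h \<and> 0 < t \<and> t < h \<and>
    f (x + h *\<^sub>R v + h *\<^sub>R w) - f (x + h *\<^sub>R v) - f (x + h *\<^sub>R w) + f x
      = h * (h * dird w (dird v f) (x + s *\<^sub>R v + t *\<^sub>R w))"
proof -
  have f2: "Ck_on (Suc (Suc 0)) f U" using f by (simp only: numeral_2_eq_2)
  define p where "p s = f ((x + h *\<^sub>R w) + s *\<^sub>R v) - f (x + s *\<^sub>R v)" for s
  have "(p has_real_derivative (dird v f ((x + h *\<^sub>R w) + s *\<^sub>R v) - dird v f (x + s *\<^sub>R v))) (at s)"
    if "0 \<le> s" "s \<le> h" for s
  proof -
    have "f differentiable (at ((x + h *\<^sub>R w) + s *\<^sub>R v))"
      using U[of s h] that h by (intro Ck_on_imp_differentiable[OF f2]) (simp add: algebra_simps)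
    moreover have "f differentiable (at (x + s *\<^sub>R v))"
      using U[of s 0] that h by (intro Ck_on_imp_differentiable[OF f2]) simp
    ultimately show ?thesis
      unfolding p_def has_real_derivative_iff_has_vector_derivative
      by (intro has_vector_derivative_diff dird_along_line)
  qed
  from MVT2[OF h this] obtain s where s: "0 < s" "s < h"
    "p h - p 0 = (h - 0) * (dird v f ((x + h *\<^sub>R w) + s *\<^sub>R v) - dird v f (x + s *\<^sub>R v))" by blast
  have "((\<lambda>t. dird v f ((x + s *\<^sub>R v) + t *\<^sub>R w)) has_real_derivative dird w (dird v f) ((x + s *\<^sub>R v) + t *\<^sub>R w)) (at t)"
    if "0 \<le> t" "t \<le> h" for t
    unfolding has_real_derivative_iff_has_vector_derivative
    using U[of s t] that s h by (intro dird_along_line Ck_on_imp_differentiable[OF Ck_on_dird[OF f2]]) simp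
  from MVT2[OF h this] obtain t where t: "0 < t" "t < h"
    "dird v f ((x + s *\<^sub>R v) + h *\<^sub>R w) - dird v f ((x + s *\<^sub>R v) + 0 *\<^sub>R w)
      = (h - 0) * dird w (dird v f) ((x + s *\<^sub>R v) + t *\<^sub>R w)" by blast
  show ?thesis
    using s t by (intro exI[of _ s] exI[of _ t]) (simp add: p_def algebra_simps)
qed

text \<open>The second difference does not depend on the order of \<open>v\<close> and
  \<open>w\<close>, so the two mixed derivatives share a value, taken at two points near
  \<open>x\<close>; continuity does the rest.\<close>

lemma dird_symmetric:
  fixes f :: "'a::euclidean_space \<Rightarrow> real"
  assumes "open U" "x \<in> U" "Ck_on 2 f U"
  shows "dird v (dird w f) x = dird w (dird v f) x"
proof (rule ccontr)
  let ?a = "dird v (dird w f)" and ?b = "dird w (dird v f)"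
  assume ne: "?a x \<noteq> ?b x"
  define e where "e = \<bar>?a x - ?b x\<bar> / 2"
  have "e > 0" using ne by (simp add: e_def)
  have f2: "Ck_on (Suc (Suc 0)) f U" using assms(3) by (simp only: numeral_2_eq_2)
  have cont: "continuous_on U ?a" "continuous_on U ?b"
    using Ck_on_dird[OF Ck_on_dird[OF f2]] by simp_all
  obtain r where r: "r > 0" "ball x r \<subseteq> U"
    using assms by (meson openE)
  obtain d1 where d1: "d1 > 0" "\<And>y. y \<in> U \<Longrightarrow> dist y x < d1 \<Longrightarrow> dist (?a y) (?a x) < e"
    using cont(1) \<open>x \<in> U\<close> \<open>e > 0\<close> unfolding continuous_on_iff by metis
  obtain d2 where d2: "d2 > 0" "\<And>y. y \<in> U \<Longrightarrow> dist y x < d2 \<Longrightarrow> dist (?b y) (?b x) < e"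
    using cont(2) \<open>x \<in> U\<close> \<open>e > 0\<close> unfolding continuous_on_iff by metis
  define d where "d = min r (min d1 d2)"
  \<comment> \<open>Small enough for the parallelogram spanned by h v and h w to stay within
    distance d; the summand 1 covers v = w = 0.\<close>
  define h where "h = d / (norm v + norm w + 1)"
  have d: "d > 0" using r d1 d2 by (simp add: d_def)
  then have h: "h > 0" by (simp add: h_def add_nonneg_pos)
  have near: "dist (x + s *\<^sub>R v + t *\<^sub>R w) x < d" if "0 \<le> s" "s \<le> h" "0 \<le> t" "t \<le> h" for s t
  proof -
    have "dist (x + s *\<^sub>R v + t *\<^sub>R w) x \<le> s * norm v + t * norm w"
      using norm_triangle_ineq[of "s *\<^sub>R v" "t *\<^sub>R w"] that by (simp add: dist_norm add.assoc)
    also have "\<dots> \<le> h * norm v + h * norm w"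
      using that by (intro add_mono mult_right_mono) auto
    also have "\<dots> < h * (norm v + norm w + 1)" using h by (simp add: algebra_simps)
    also have "\<dots> = d" unfolding h_def by (simp add: add_nonneg_pos less_imp_neq[symmetric])
    finally show ?thesis .
  qed
  have inU: "x + s *\<^sub>R v + t *\<^sub>R w \<in> U" if "0 \<le> s" "s \<le> h" "0 \<le> t" "t \<le> h" for s t
    using near[OF that] r by (auto simp: d_def dist_commute)
  obtain s t where st: "0 < s" "s < h" "0 < t" "t < h"
    "f (x + h *\<^sub>R v + h *\<^sub>R w) - f (x + h *\<^sub>R v) - f (x + h *\<^sub>R w) + f x = h * (h * ?b (x + s *\<^sub>R v + t *\<^sub>R w))"
    using second_difference_mean_value[OF assms(3) h inU] by blast
  have "x + s *\<^sub>R w + t *\<^sub>R v \<in> U" if "0 \<le> s" "s \<le> h" "0 \<le> t" "t \<le> h" for s t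
    using inU[of t s] that by (simp add: algebra_simps)
  then obtain t' s' where st': "0 < t'" "t' < h" "0 < s'" "s' < h"
    "f (x + h *\<^sub>R w + h *\<^sub>R v) - f (x + h *\<^sub>R w) - f (x + h *\<^sub>R v) + f x = h * (h * ?a (x + t' *\<^sub>R w + s' *\<^sub>R v))"
    using second_difference_mean_value[OF assms(3) h, of x w v] by blast
  have "?b (x + s *\<^sub>R v + t *\<^sub>R w) = ?a (x + s' *\<^sub>R v + t' *\<^sub>R w)"
    using st(5) st'(5) h by (simp add: algebra_simps)
  moreover have "dist (?b (x + s *\<^sub>R v + t *\<^sub>R w)) (?b x) < e"
    using near[of s t] inU[of s t] st by (intro d2(2)) (auto simp: d_def)
  moreover have "dist (?a (x + s' *\<^sub>R v + t' *\<^sub>R w)) (?a x) < e"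
    using near[of s' t'] inU[of s' t'] st' by (intro d1(2)) (auto simp: d_def)
  ultimately have "dist (?a x) (?b x) < e + e"
    using dist_triangle3[of "?a x" "?b x" "?b (x + s *\<^sub>R v + t *\<^sub>R w)"] by simp
  then show False
    by (simp add: e_def dist_real_def)
qed

section \<open>Smooth bump functions\<close>

text \<open>The power of 1/t makes the family closed under differentiation up to linear
  combinations.\<close>

definition flat :: "nat \<Rightarrow> real \<Rightarrow> real" where
  "flat k t = (if 0 < t then exp (- inverse t) * inverse t ^ k else 0)"

lemma flat_tendsto_0: "((\<lambda>t. exp (- inverse t) * inverse t ^ k) \<longlongrightarrow> 0) (at_right (0::real))"
proof -
  have "((\<lambda>x. x ^ k / exp x) \<longlongrightarrow> 0) (at_top :: real filter)"
    by (rule tendsto_power_div_exp_0)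
  from filterlim_compose[OF this filterlim_inverse_at_top_right]
  show ?thesis by (simp add: exp_minus field_simps)
qed

lemma flat_has_derivative:
  "(flat k has_real_derivative (flat (k + 2) t - of_nat k * flat (k + 1) t)) (at t)"
proof -
  consider "t > 0" | "t < 0" | "t = 0" by linarith
  then show ?thesis
  proof cases
    case 1
    have e: "((\<lambda>t. exp (- inverse t)) has_real_derivative exp (- inverse t) * inverse t ^ 2) (at t)"
      using 1 by (auto intro!: derivative_eq_intros simp: power2_eq_square)
    have p: "((\<lambda>t. inverse t ^ k) has_real_derivative of_nat k * (- (inverse t ^ 2) * inverse t ^ (k - 1))) (at t)"
      using DERIV_power[OF DERIV_inverse, of t k UNIV] 1 by (simp add: numeral_2_eq_2)
    have "k \<noteq> 0 \<Longrightarrow> inverse t ^ 2 * inverse t ^ (k - 1) = inverse t ^ (k + 1)"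
      by (cases k) (simp_all add: power2_eq_square)
    then have "exp (- inverse t) * inverse t ^ 2 * inverse t ^ k
        + of_nat k * (- (inverse t ^ 2) * inverse t ^ (k - 1)) * exp (- inverse t)
      = flat (k + 2) t - of_nat k * flat (k + 1) t"
      using 1 by (cases "k = 0") (auto simp: flat_def power_add power2_eq_square algebra_simps)
    with DERIV_mult[OF e p] have "((\<lambda>t. exp (- inverse t) * inverse t ^ k) has_real_derivative
        (flat (k + 2) t - of_nat k * flat (k + 1) t)) (at t)"
      by simp
    then show ?thesis
      by (rule has_field_derivative_transform_within_open[where S="{0<..}"]) (use 1 in \<open>auto simp: flat_def\<close>)
  next
    case 2
    have "((\<lambda>t. 0) has_real_derivative (flat (k + 2) t - of_nat k * flat (k + 1) t)) (at t)"
      using 2 by (simp add: flat_def)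
    then show ?thesis
      by (rule has_field_derivative_transform_within_open[where S="{..<0}"]) (use 2 in \<open>auto simp: flat_def\<close>)
  next
    case 3
    \<comment> \<open>To the right of 0 the quotient is \<open>flat (Suc k)\<close>, which tends to
      0.\<close>
    have "((\<lambda>h. flat k h / h) \<longlongrightarrow> 0) (at_right 0)"
      by (rule Lim_transform_eventually[OF flat_tendsto_0[of "Suc k"]])
        (auto simp: eventually_at_right_field flat_def field_simps intro!: exI[of _ 1])
    moreover have "((\<lambda>h. flat k h / h) \<longlongrightarrow> 0) (at_left 0)"
      by (rule Lim_transform_eventually[OF tendsto_const])
        (auto simp: eventually_at_left_field flat_def intro!: exI[of _ "-1"])
    ultimately have "((\<lambda>h. flat k h / h) \<longlongrightarrow> 0) (at 0)"
      by (simp add: filterlim_split_at)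
    then have "(flat k has_real_derivative 0) (at 0)"
      unfolding DERIV_def by (simp add: flat_def)
    then show ?thesis
      using 3 by (simp add: flat_def)
  qed
qed

text \<open>Smoothness of the bump functions follows since this class is closed under directional
  derivatives.\<close>

inductive smooth_bump :: "'a::euclidean_space \<Rightarrow> real \<Rightarrow> ('a \<Rightarrow> real) \<Rightarrow> bool" for c r where
  const: "smooth_bump c r (\<lambda>x. k)"
| inner: "smooth_bump c r (\<lambda>x. x \<bullet> w)"
| flat: "smooth_bump c r (\<lambda>x. flat k (r\<^sup>2 - (x - c) \<bullet> (x - c)))"
| add: "smooth_bump c r f \<Longrightarrow> smooth_bump c r g \<Longrightarrow> smooth_bump c r (\<lambda>x. f x + g x)"
| mult: "smooth_bump c r f \<Longrightarrow> smooth_bump c r g \<Longrightarrow> smooth_bump c r (\<lambda>x. f x * g x)"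

lemma smooth_bump_dird:
  "smooth_bump c r f \<Longrightarrow> (\<forall>x. f differentiable (at x)) \<and> (\<forall>v. smooth_bump c r (dird v f))"
proof (induction rule: smooth_bump.induct)
  case (const k)
  then show ?case by (simp add: smooth_bump.const)
next
  case (inner w)
  have d: "((\<lambda>x. x \<bullet> w) has_derivative (\<lambda>v. v \<bullet> w)) (at x)" for x
    by (auto intro!: derivative_eq_intros)
  have "dird v (\<lambda>x. x \<bullet> w) = (\<lambda>x. v \<bullet> w)" for v
    by (rule ext) (rule dirdI[OF d])
  with d show ?case by (auto simp: differentiable_def smooth_bump.const)
next
  case (flat k)
  let ?s = "\<lambda>x. r\<^sup>2 - (x - c) \<bullet> (x - c)"
  have s: "(?s has_derivative (\<lambda>v. - 2 * ((x - c) \<bullet> v))) (at x)" for x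
    by (auto intro!: derivative_eq_intros simp: inner_commute)
  have d: "((\<lambda>x. flat k (?s x)) has_derivative
      (\<lambda>v. (flat (k + 2) (?s x) - of_nat k * flat (k + 1) (?s x)) * (- 2 * ((x - c) \<bullet> v)))) (at x)" for x
    using diff_chain_at[OF s flat_has_derivative[unfolded has_field_derivative_def]] by (simp add: o_def)
  have "dird v (\<lambda>x. flat k (?s x)) =
      (\<lambda>x. (flat (k + 2) (?s x) + (- of_nat k) * flat (k + 1) (?s x)) * ((- 2) * (x \<bullet> v) + 2 * (c \<bullet> v)))" for v
    by (rule ext, subst dirdI[OF d]) (simp add: inner_diff_left algebra_simps)
  moreover have "smooth_bump c r (\<lambda>x. (flat (k + 2) (?s x) + (- of_nat k) * flat (k + 1) (?s x)) * ((- 2) * (x \<bullet> v) + 2 * (c \<bullet> v)))" for v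
    by (intro smooth_bump.intros)
  ultimately show ?case
    using d by (auto simp: differentiable_def)
next
  case (add f g)
  then have "dird v (\<lambda>x. f x + g x) = (\<lambda>x. dird v f x + dird v g x)" for v
    by (auto simp: dird_add)
  with add show ?case by (auto intro: smooth_bump.add)
next
  case (mult f g)
  interpret bounded_bilinear "(*) :: real \<Rightarrow> real \<Rightarrow> real" by (rule bounded_bilinear_mult)
  have "dird v (\<lambda>x. f x * g x) = (\<lambda>x. f x * dird v g x + dird v f x * g x)" for v
    using mult by (auto simp: dird_prod)
  moreover have "smooth_bump c r (\<lambda>x. f x * dird v g x + dird v f x * g x)" for v
    by (rule smooth_bump.add[OF smooth_bump.mult smooth_bump.mult]) (use mult in auto)
  ultimately show ?case using mult by (auto intro: differentiable_prod)
qed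

lemma smooth_bump_Ck_on: "smooth_bump c r f \<Longrightarrow> Ck_on m f U"
proof (induction m arbitrary: f)
  case 0
  then show ?case
    using smooth_bump_dird[OF 0]
    by (auto intro!: continuous_at_imp_continuous_on differentiable_imp_continuous_within)
next
  case (Suc m)
  with smooth_bump_dird show ?case by auto
qed

text \<open>The quadratic function inside \<open>flat\<close> is positive exactly on the
  ball.\<close>

lemma exists_bump:
  fixes c :: "'a::euclidean_space"
  assumes "r > 0"
  obtains f :: "'a \<Rightarrow> real" where "\<And>m. Ck_on m f UNIV" "\<And>x. 0 \<le> f x" "\<And>x. x \<in> ball c r \<Longrightarrow> 0 < f x"
    "\<And>x. x \<notin> ball c r \<Longrightarrow> f x = 0"
proof -
  define f where "f x = flat 0 (r\<^sup>2 - (x - c) \<bullet> (x - c))" for x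
  have "Ck_on m f UNIV" for m
    unfolding f_def by (rule smooth_bump_Ck_on) (rule smooth_bump.flat)
  moreover have "0 \<le> f x" for x by (simp add: f_def flat_def)
  moreover have "(x - c) \<bullet> (x - c) < r\<^sup>2 \<longleftrightarrow> x \<in> ball c r" for x
    using assms power_mono_iff[of r "norm (x - c)" 2] by (simp only: linorder_not_le[symmetric] power2_norm_eq_inner[symmetric]) (auto simp: dist_norm norm_minus_commute not_le)
  then have "x \<in> ball c r \<Longrightarrow> 0 < f x" "x \<notin> ball c r \<Longrightarrow> f x = 0" for x
    by (simp_all add: f_def flat_def)
  ultimately show ?thesis by (rule that)
qed

text \<open>Finitely many balls inside U cover L. The sum of their bumps is positive on L, and
  dividing by its minimum there raises it to at least 1.\<close>

lemma exists_cutoff: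
  fixes L :: "'a::euclidean_space set"
  assumes "compact L" "open U" "L \<subseteq> U"
  obtains f :: "'a \<Rightarrow> real" and Q where "\<And>m. Ck_on m f UNIV" "\<And>x. 0 \<le> f x" "\<And>x. x \<in> L \<Longrightarrow> 1 \<le> f x"
    "compact Q" "Q \<subseteq> U" "L \<subseteq> Q" "\<And>x. x \<notin> Q \<Longrightarrow> f x = 0"
proof (cases "L = {}")
  case True
  show ?thesis
    by (rule that[of "\<lambda>x. 0" "{}"]) (auto simp: True intro: Ck_on_const)
next
  case False
  have "\<forall>x\<in>L. \<exists>r>0. cball x r \<subseteq> U"
    using assms open_contains_cball by blast
  then obtain r where r: "\<And>x. x \<in> L \<Longrightarrow> r x > 0 \<and> cball x (r x) \<subseteq> U" by metis
  have "\<forall>x\<in>L. \<exists>f. (\<forall>m. Ck_on m f UNIV) \<and> (\<forall>y. 0 \<le> f y) \<and> (\<forall>y\<in>ball x (r x). 0 < f y) \<and> (\<forall>y. y \<notin> ball x (r x) \<longrightarrow> f y = (0::real))"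
  proof
    fix x assume "x \<in> L"
    then obtain f :: "'a \<Rightarrow> real" where "\<And>m. Ck_on m f UNIV" "\<And>y. 0 \<le> f y" "\<And>y. y \<in> ball x (r x) \<Longrightarrow> 0 < f y"
      "\<And>y. y \<notin> ball x (r x) \<Longrightarrow> f y = 0"
      using exists_bump[of "r x" x] r by blast
    then show "\<exists>f. (\<forall>m. Ck_on m f UNIV) \<and> (\<forall>y. 0 \<le> f y) \<and> (\<forall>y\<in>ball x (r x). 0 < f y) \<and> (\<forall>y. y \<notin> ball x (r x) \<longrightarrow> f y = (0::real))"
      by blast
  qed
  then obtain g where g: "\<And>x m. x \<in> L \<Longrightarrow> Ck_on m (g x) UNIV" "\<And>x y. x \<in> L \<Longrightarrow> 0 \<le> g x y"
    "\<And>x y. x \<in> L \<Longrightarrow> y \<in> ball x (r x) \<Longrightarrow> 0 < (g x y :: real)" "\<And>x y. x \<in> L \<Longrightarrow> y \<notin> ball x (r x) \<Longrightarrow> g x y = 0"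
    by metis
  obtain F where F: "F \<subseteq> L" "finite F" "L \<subseteq> (\<Union>x\<in>F. ball x (r x))"
  proof (rule compactE_image[OF assms(1), of L "\<lambda>x. ball x (r x)"])
    show "L \<subseteq> (\<Union>x\<in>L. ball x (r x))" using r by force
  qed auto
  define G where "G y = (\<Sum>x\<in>F. g x y)" for y
  have G: "Ck_on m G UNIV" for m
    unfolding G_def using F g by (intro Ck_on_sum) auto
  have G0: "0 \<le> G y" for y
    unfolding G_def using F g by (auto intro!: sum_nonneg)
  have Gpos: "0 < G y" if "y \<in> L" for y
  proof -
    obtain x where "x \<in> F" "y \<in> ball x (r x)" using F \<open>y \<in> L\<close> by blast
    then show ?thesis
      unfolding G_def using F g by (intro sum_pos2[of F x]) auto
  qed
  obtain y0 where y0: "y0 \<in> L" "\<And>y. y \<in> L \<Longrightarrow> G y0 \<le> G y"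
    using continuous_attains_inf[OF assms(1) False] continuous_on_subset[OF Ck_on_continuous[OF G]] by blast
  show ?thesis
  proof (rule that[of "\<lambda>y. (1 / G y0) * G y" "\<Union>x\<in>F. cball x (r x)"])
    show "Ck_on m (\<lambda>y. (1 / G y0) * G y) UNIV" for m
      by (rule bounded_linear.Ck_on_linear[OF bounded_linear_mult_right _ G]) simp
    show "0 \<le> (1 / G y0) * G x" for x
      using G0 by simp
    show "1 \<le> (1 / G y0) * G x" if "x \<in> L" for x
      using y0(2)[OF that] Gpos[OF y0(1)] by simp
    show "compact (\<Union>x\<in>F. cball x (r x))"
      using F by (intro compact_UN) auto
    show "(\<Union>x\<in>F. cball x (r x)) \<subseteq> U"
      using F r by blast
    show "L \<subseteq> (\<Union>x\<in>F. cball x (r x))"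
    proof (rule order_trans[OF F(3)])
      show "(\<Union>x\<in>F. ball x (r x)) \<subseteq> (\<Union>x\<in>F. cball x (r x))"
        by (intro UN_mono) auto
    qed
    show "(1 / G y0) * G x = 0" if "x \<notin> (\<Union>x\<in>F. cball x (r x))" for x
    proof -
      have "g y x = 0" if "y \<in> F" for y
      proof (rule g(4))
        show "x \<notin> ball y (r y)" using \<open>x \<notin> (\<Union>x\<in>F. cball x (r x))\<close> \<open>y \<in> F\<close> by auto
      qed (use that F(1) in auto)
      then show ?thesis by (simp add: G_def)
    qed
  qed
qed

section \<open>Integration by parts\<close>

lemma integrable_continuous_compact_support:
  fixes f :: "'a::euclidean_space \<Rightarrow> 'b::{banach, second_countable_topology}"
  assumes "compact Q" "continuous_on Q f" "\<And>x. x \<notin> Q \<Longrightarrow> f x = 0"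
  shows "integrable lborel f"
proof -
  have "integrable lborel (\<lambda>x. indicator Q x *\<^sub>R f x)"
    using assms by (intro borel_integrable_compact)
  moreover have "(\<lambda>x. indicator Q x *\<^sub>R f x) = f"
    using assms(3) by (auto simp: indicator_def)
  ultimately show ?thesis by simp
qed

lemma lborel_integral_translate:
  fixes f :: "'a::euclidean_space \<Rightarrow> 'b::{banach, second_countable_topology}"
  assumes "f \<in> borel_measurable borel"
  shows "(LINT x|lborel. f (c + x)) = (LINT x|lborel. f x)"
proof -
  have "(LINT x|lborel. f x) = (LINT x|distr lborel borel ((+) c). f x)"
    by (simp add: lborel_distr_plus)
  also have "\<dots> = (LINT x|lborel. f (c + x))"
    using assms by (subst integral_distr) auto
  finally show ?thesis by simp
qed

lemma lborel_integrable_translate: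
  fixes f :: "'a::euclidean_space \<Rightarrow> 'b::{banach, second_countable_topology}"
  assumes "f \<in> borel_measurable borel" "integrable lborel f"
  shows "integrable lborel (\<lambda>x. f (c + x))"
proof -
  have "integrable (distr lborel borel ((+) c)) f"
    using assms by (simp add: lborel_distr_plus)
  then show ?thesis
    using assms by (subst (asm) integrable_distr_eq) auto
qed

text \<open>Difference quotients have integral 0 by translation invariance, and dominated
  convergence passes to the derivative.\<close>

lemma integral_dird_eq_0:
  fixes f :: "'a::euclidean_space \<Rightarrow> 'b::euclidean_space"
  assumes f: "Ck_on 1 f UNIV" and Q: "compact Q" "\<And>x. x \<notin> Q \<Longrightarrow> f x = 0"
  shows "(LINT x|lborel. dird v f x) = 0"
proof -
  have f1: "Ck_on (Suc 0) f UNIV" using f by simp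
  have cf: "continuous_on UNIV f" by (rule Ck_on_continuous[OF f])
  have cd: "continuous_on UNIV (dird v f)" using Ck_on_dird[OF f1] by simp
  have off: "dird v f x = 0" if "x \<notin> Q" for x
    using dird_zero_off[OF compact_imp_closed[OF Q(1)] Q(2) that] by simp
  have "bounded (dird v f ` Q)"
    by (intro compact_imp_bounded compact_continuous_image Q continuous_on_subset[OF cd]) simp
  then obtain M0 where M0: "\<And>x. x \<in> Q \<Longrightarrow> norm (dird v f x) \<le> M0"
    by (auto simp: bounded_iff)
  define M where "M = max M0 0"
  have M: "norm (dird v f x) \<le> M" for x
    using M0[of x] off[of x] by (cases "x \<in> Q") (auto simp: M_def)
  have "M \<ge> 0" by (simp add: M_def)
  define h where "h n = inverse (real (Suc n))" for n
  have h: "0 < h n" "h n \<le> 1" for n by (simp_all add: h_def inverse_le_1_iff)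
  have h0: "h \<longlonglongrightarrow> 0" unfolding h_def by (rule LIMSEQ_inverse_real_of_nat)
  define g where "g n x = (f (h n *\<^sub>R v + x) - f x) /\<^sub>R h n" for n x
  \<comment> \<open>A compact set that carries all the difference quotients, whose steps are at most
    1.\<close>
  define Q' where "Q' = (\<lambda>(t, x). x - t *\<^sub>R v) ` ({0..1} \<times> Q)"
  have "compact Q'"
    unfolding Q'_def by (intro compact_continuous_image compact_Times Q) (auto intro!: continuous_intros simp: split_def)
  have bound: "norm (g n x) \<le> M * indicator Q' x" for n x
  proof (cases "x \<in> Q'")
    case True
    have "norm (f (x + h n *\<^sub>R v) - f (x + 0 *\<^sub>R v)) \<le> M * norm (h n - 0)"
    proof (rule differentiable_bound[where S=UNIV and f'="\<lambda>t s. s *\<^sub>R dird v f (x + t *\<^sub>R v)"])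
      show "((\<lambda>t. f (x + t *\<^sub>R v)) has_derivative (\<lambda>s. s *\<^sub>R dird v f (x + t *\<^sub>R v))) (at t)" for t
        using dird_along_line[of f x t v] Ck_on_imp_differentiable[OF f1, of "x + t *\<^sub>R v"]
        by (simp add: has_vector_derivative_def)
      show "onorm (\<lambda>s. s *\<^sub>R dird v f (x + t *\<^sub>R v)) \<le> M" for t
        using M[of "x + t *\<^sub>R v"] \<open>M \<ge> 0\<close>
        by (intro onorm_le) (simp add: mult.commute[of M] mult_left_mono)
    qed auto
    then have "norm (f (h n *\<^sub>R v + x) - f x) \<le> M * h n"
      using h[of n] by (simp add: add.commute)
    moreover have "norm (g n x) = norm (f (h n *\<^sub>R v + x) - f x) / h n"
      using h[of n] by (simp add: g_def divide_inverse mult.commute)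
    ultimately show ?thesis
      using True h[of n] by (simp add: pos_divide_le_eq)
  next
    case False
    have "x \<notin> Q"
      using False unfolding Q'_def by (auto intro: image_eqI[where x="(0, x)"])
    moreover have "h n *\<^sub>R v + x \<notin> Q"
      using False h[of n] unfolding Q'_def by (auto intro!: image_eqI[where x="(h n, h n *\<^sub>R v + x)"])
    ultimately show ?thesis
      using False by (simp add: g_def Q)
  qed
  have [measurable]: "f \<in> borel_measurable borel" "dird v f \<in> borel_measurable borel"
    using cf cd by (auto intro: borel_measurable_continuous_onI)
  have meas: "g n \<in> borel_measurable borel" for n
    unfolding g_def by measurable
  have lim: "(\<lambda>n. g n x) \<longlonglongrightarrow> dird v f x" for x
  proof -
    have "((\<lambda>t. f (x + t *\<^sub>R v)) has_vector_derivative dird v f (x + 0 *\<^sub>R v)) (at 0)"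
      by (rule dird_along_line) (rule Ck_on_imp_differentiable[OF f1], simp)
    then have l: "((\<lambda>t. norm (f (x + t *\<^sub>R v) - f x - t *\<^sub>R dird v f x) / \<bar>t\<bar>) \<longlongrightarrow> 0) (at 0)"
      by (simp add: has_vector_derivative_def has_derivative_at)
    have "((\<lambda>t. (f (x + t *\<^sub>R v) - f x) /\<^sub>R t - dird v f x) \<longlongrightarrow> 0) (at 0)"
    proof (rule tendsto_norm_zero_cancel, rule Lim_transform_eventually[OF l])
      have "norm (f (x + t *\<^sub>R v) - f x - t *\<^sub>R dird v f x) / \<bar>t\<bar> = norm ((f (x + t *\<^sub>R v) - f x) /\<^sub>R t - dird v f x)"
        if "t \<noteq> 0" for t
      proof -
        have "(f (x + t *\<^sub>R v) - f x) /\<^sub>R t - dird v f x = (f (x + t *\<^sub>R v) - f x - t *\<^sub>R dird v f x) /\<^sub>R t"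
          using that by (simp add: scaleR_diff_right)
        then show ?thesis by (simp add: divide_inverse mult.commute)
      qed
      then show "\<forall>\<^sub>F t in at 0. norm (f (x + t *\<^sub>R v) - f x - t *\<^sub>R dird v f x) / \<bar>t\<bar>
          = norm ((f (x + t *\<^sub>R v) - f x) /\<^sub>R t - dird v f x)"
        by (simp add: eventually_at_filter)
    qed
    then have "((\<lambda>t. (f (x + t *\<^sub>R v) - f x) /\<^sub>R t) \<longlongrightarrow> dird v f x) (at 0)"
      by (rule LIM_zero_cancel)
    moreover have "filterlim h (at 0) sequentially"
      using h0 h by (auto simp: filterlim_at less_imp_neq[symmetric])
    ultimately have "(\<lambda>n. (f (x + h n *\<^sub>R v) - f x) /\<^sub>R h n) \<longlonglongrightarrow> dird v f x"
      by (rule filterlim_compose)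
    then show ?thesis by (simp add: g_def add.commute)
  qed
  have "(\<lambda>n. LINT x|lborel. g n x) \<longlonglongrightarrow> (LINT x|lborel. dird v f x)"
  proof (rule integral_dominated_convergence)
    show "integrable lborel (\<lambda>x. M * indicator Q' x)"
      using \<open>compact Q'\<close>
      by (intro integrable_mult_right integrable_real_indicator) (simp_all add: borel_compact emeasure_compact_finite[unfolded infinity_ennreal_def])
  qed (use meas lim bound in auto)
  moreover have "(LINT x|lborel. g n x) = 0" for n
  proof -
    have i: "integrable lborel f"
      by (rule integrable_continuous_compact_support[OF Q(1) continuous_on_subset[OF cf] Q(2)]) auto
    have "integrable lborel (\<lambda>x. f (h n *\<^sub>R v + x))"
      using i by (intro lborel_integrable_translate) simp_all
    with i show ?thesis
      unfolding g_def by (simp add: lborel_integral_translate)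
  qed
  ultimately show ?thesis
    by (simp add: LIMSEQ_const_iff)
qed

section \<open>Mollification\<close>

text \<open>Integrating over a box that holds the support of the kernel keeps the range of
  integration compact for the Leibniz rule and uses \<open>f\<close> only at the points x - y with y
  in the box.\<close>

definition conv :: "('a::euclidean_space \<Rightarrow> real) \<Rightarrow> 'a \<Rightarrow> 'a \<Rightarrow> ('a \<Rightarrow> real) \<Rightarrow> 'a \<Rightarrow> real" where
  "conv h a b f x = integral (cbox a b) (\<lambda>y. h y * f (x - y))"

lemma continuous_on_conv_integrand:
  fixes f h :: "'a::euclidean_space \<Rightarrow> real"
  assumes "continuous_on \<Omega> f" "continuous_on (cbox a b) h"
    and "\<And>x y. x \<in> U \<Longrightarrow> y \<in> cbox a b \<Longrightarrow> x - y \<in> \<Omega>"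
  shows "continuous_on (U \<times> cbox a b) (\<lambda>(x, y). h y * f (x - y))"
  unfolding split_beta using assms(3)
  by (intro continuous_intros continuous_on_compose2[OF assms(1)] continuous_on_compose2[OF assms(2)]) auto

lemma continuous_on_conv:
  assumes "continuous_on \<Omega> f" "continuous_on (cbox a b) h"
    and "\<And>x y. x \<in> U \<Longrightarrow> y \<in> cbox a b \<Longrightarrow> x - y \<in> \<Omega>"
  shows "continuous_on U (conv h a b f)"
  unfolding conv_def
  by (rule integral_continuous_on_param) (rule continuous_on_conv_integrand[OF assms])

lemma conv_has_derivative:
  fixes f h :: "'a::euclidean_space \<Rightarrow> real"
  assumes f: "Ck_on 1 f \<Omega>" and h: "continuous_on (cbox a b) h" and U: "open U" "x0 \<in> U"
    and sub: "\<And>x y. x \<in> U \<Longrightarrow> y \<in> cbox a b \<Longrightarrow> x - y \<in> \<Omega>"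
  shows "(conv h a b f has_derivative (\<lambda>v. conv h a b (dird v f) x0)) (at x0)"
proof -
  have f1: "Ck_on (Suc 0) f \<Omega>" using f by simp
  obtain r where r: "r > 0" "ball x0 r \<subseteq> U" using U by (meson openE)
  let ?V = "ball x0 r"
  \<comment> \<open>The Leibniz rule takes derivatives as bounded linear operators, so the
    directional derivatives are bundled into one; its continuity is checked on basis
    vectors.\<close>
  define G where "G x = Blinfun (frechet_derivative f (at x))" for x
  have G: "blinfun_apply (G x) v = dird v f x" if "x \<in> \<Omega>" for x v
  proof -
    have "bounded_linear (frechet_derivative f (at x))"
      using Ck_on_has_dird[OF f1 that] by (metis has_derivative_bounded_linear)
    then show ?thesis by (simp add: G_def bounded_linear_Blinfun_apply)
  qed
  have cG: "continuous_on \<Omega> G"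
  proof (rule continuous_on_blinfun_componentwise)
    fix i :: 'a
    show "continuous_on \<Omega> (\<lambda>x. blinfun_apply (G x) i)"
      using Ck_on_dird[OF f1, of i] G by (simp cong: continuous_on_cong)
  qed
  define D where "D x y = h y *\<^sub>R G (x - y)" for x y
  have "((\<lambda>x. integral (cbox a b) (\<lambda>y. h y * f (x - y))) has_derivative
      blinfun_apply (integral (cbox a b) (D x0))) (at x0 within ?V)"
  proof (rule leibniz_rule)
    show "((\<lambda>x. h y * f (x - y)) has_derivative blinfun_apply (D x y)) (at x within ?V)"
      if "x \<in> ?V" "y \<in> cbox a b" for x y
    proof -
      have xy: "x - y \<in> \<Omega>" using that r sub by blast
      have "((\<lambda>x. x - y) has_derivative (\<lambda>v. v)) (at x)" by (auto intro!: derivative_eq_intros)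
      from diff_chain_at[OF this Ck_on_has_dird[OF f1 xy]]
      have "((\<lambda>x. f (x - y)) has_derivative (\<lambda>v. dird v f (x - y))) (at x)" by (simp add: o_def)
      then have "((\<lambda>x. h y * f (x - y)) has_derivative (\<lambda>v. h y * dird v f (x - y))) (at x)"
        by (rule has_derivative_mult_right)
      moreover have "blinfun_apply (D x y) = (\<lambda>v. h y * dird v f (x - y))"
        by (auto simp: D_def G[OF xy] scaleR_blinfun.rep_eq)
      ultimately show ?thesis by (metis has_derivative_at_withinI)
    qed
    show "(\<lambda>y. h y * f (x - y)) integrable_on cbox a b" if "x \<in> ?V" for x
    proof (rule integrable_continuous)
      show "continuous_on (cbox a b) (\<lambda>y. h y * f (x - y))"
        using that r sub
        by (intro continuous_intros h continuous_on_compose2[OF Ck_on_continuous[OF f]]) auto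
    qed
    show "continuous_on (?V \<times> cbox a b) (\<lambda>(x, y). D x y)"
      unfolding split_beta D_def using r sub
      by (intro continuous_intros continuous_on_compose2[OF cG] continuous_on_compose2[OF h]) auto
  qed (use r in auto)
  moreover have "blinfun_apply (integral (cbox a b) (D x0)) v = conv h a b (dird v f) x0" for v
  proof -
    have "D x0 integrable_on cbox a b"
    proof (rule integrable_continuous)
      show "continuous_on (cbox a b) (D x0)"
        unfolding D_def using sub U by (intro continuous_intros continuous_on_compose2[OF cG] h) auto
    qed
    then have "blinfun_apply (integral (cbox a b) (D x0)) v = integral (cbox a b) (\<lambda>y. blinfun_apply (D x0 y) v)"
      using integral_linear[OF _ blinfun.bounded_linear_left, of "D x0" "cbox a b" v] by (simp add: o_def)
    also have "\<dots> = conv h a b (dird v f) x0"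
      unfolding conv_def using sub U by (intro integral_cong) (auto simp: D_def G scaleR_blinfun.rep_eq)
    finally show ?thesis .
  qed
  then have "blinfun_apply (integral (cbox a b) (D x0)) = (\<lambda>v. conv h a b (dird v f) x0)" ..
  ultimately have "(conv h a b f has_derivative (\<lambda>v. conv h a b (dird v f) x0)) (at x0 within ?V)"
    by (simp only: conv_def[abs_def])
  then show ?thesis using r by (simp add: at_within_open[of x0 ?V])
qed

lemma Ck_on_conv:
  fixes f h :: "'a::euclidean_space \<Rightarrow> real"
  assumes "Ck_on k f \<Omega>" and h: "continuous_on (cbox a b) h" and U: "open U"
    and sub: "\<And>x y. x \<in> U \<Longrightarrow> y \<in> cbox a b \<Longrightarrow> x - y \<in> \<Omega>"
  shows "Ck_on k (conv h a b f) U"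
  using assms(1)
proof (induction k arbitrary: f)
  case 0
  then show ?case using continuous_on_conv[OF _ h sub] by simp
next
  case (Suc k)
  have "Ck_on 1 f \<Omega>" using Suc.prems by (rule Ck_on_le) simp
  note d = conv_has_derivative[OF this h U _ sub]
  have "Ck_on k (dird v (conv h a b f)) U" for v
  proof (rule Ck_on_cong[OF U])
    show "Ck_on k (conv h a b (dird v f)) U"
      using Suc.prems by (intro Suc.IH) simp
    show "conv h a b (dird v f) x = dird v (conv h a b f) x" if "x \<in> U" for x
      using dirdI[OF d[OF that]] by simp
  qed
  with d show ?case by (auto simp: differentiable_def)
qed

lemma dird_conv:
  fixes f h :: "'a::euclidean_space \<Rightarrow> real"
  assumes "Ck_on 1 f \<Omega>" "continuous_on (cbox a b) h" "open U" "x \<in> U"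
    and "\<And>x y. x \<in> U \<Longrightarrow> y \<in> cbox a b \<Longrightarrow> x - y \<in> \<Omega>"
  shows "dird v (conv h a b f) x = conv h a b (dird v f) x"
  using dirdI[OF conv_has_derivative[OF assms]] by simp

lemma lborel_integral_eq_integral_cbox:
  fixes g :: "'a::euclidean_space \<Rightarrow> real"
  assumes "continuous_on (cbox a b) g" "\<And>y. y \<notin> cbox a b \<Longrightarrow> g y = 0"
  shows "(LINT y|lborel. g y) = integral (cbox a b) g"
proof -
  have "(LINT y:cbox a b|lborel. g y) = integral (cbox a b) g"
    using assms(1) unfolding set_integrable_def[symmetric]
    by (intro set_borel_integral_eq_integral) (simp only: set_integrable_def borel_integrable_compact compact_cbox)
  moreover have "(\<lambda>y. indicator (cbox a b) y *\<^sub>R g y) = g"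
    using assms(2) by (auto simp: indicator_def fun_eq_iff)
  ultimately show ?thesis by (simp add: set_lebesgue_integral_def)
qed

text \<open>The product of h(y) and f(x - y) has compact support in y, so its derivative integrates
  to 0; the inner minus sign in x - y makes the two terms equal.\<close>

lemma conv_by_parts:
  fixes f h :: "'a::euclidean_space \<Rightarrow> real"
  assumes \<Omega>: "open \<Omega>" and f: "Ck_on 1 f \<Omega>" and h: "Ck_on 1 h UNIV" "\<And>y. y \<notin> cbox a b \<Longrightarrow> h y = 0"
    and x: "\<And>y. y \<in> cbox a b \<Longrightarrow> x - y \<in> \<Omega>"
  shows "conv h a b (dird v f) x = conv (dird v h) a b f x"
proof -
  have f1: "Ck_on (Suc 0) f \<Omega>" and h1: "Ck_on (Suc 0) h UNIV" using f h by simp_all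
  let ?W = "(\<lambda>y. x - y) -` \<Omega>"
  have W: "open ?W"
    by (rule open_vimage[OF \<Omega>]) (intro continuous_intros)
  have df: "((\<lambda>y. f (x - y)) has_derivative (\<lambda>v. - dird v f (x - y))) (at y)" if "y \<in> ?W" for y
  proof -
    have "((\<lambda>y. x - y) has_derivative (\<lambda>v. - v)) (at y)" by (auto intro!: derivative_eq_intros)
    from diff_chain_at[OF this Ck_on_has_dird[OF f1, of "x - y"]] that
    have *: "((\<lambda>y. f (x - y)) has_derivative (\<lambda>v. dird (- v) f (x - y))) (at y)" by (simp add: o_def)
    have "f differentiable (at (x - y))" using that by (intro Ck_on_imp_differentiable[OF f1]) simp
    then have "dird (- v) f (x - y) = - dird v f (x - y)" for v
      using dird_linear_vector(2)[of f "x - y" "-1" v] by simp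
    with * show ?thesis by simp
  qed
  have Cf: "Ck_on 1 (\<lambda>y. f (x - y)) ?W"
  proof -
    have "continuous_on ?W (dird v (\<lambda>y. f (x - y)))" for v
    proof -
      have "continuous_on \<Omega> (dird v f)"
        using Ck_on_dird[OF f1] by simp
      then have "continuous_on ?W (\<lambda>y. dird v f (x - y))"
        by (rule continuous_on_compose2[of \<Omega> "dird v f" ?W "\<lambda>y. x - y"])
          (rule continuous_on_diff[OF continuous_on_const continuous_on_id], blast)
      then have "continuous_on ?W (\<lambda>y. - dird v f (x - y))"
        by (rule continuous_on_minus)
      then show ?thesis
        by (rule continuous_on_eq) (rule dirdI[OF df, symmetric])
    qed
    then show ?thesis using df by (auto simp: differentiable_def)
  qed
  interpret bounded_bilinear "(*) :: real \<Rightarrow> real \<Rightarrow> real" by (rule bounded_bilinear_mult)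
  let ?p = "\<lambda>y. h y * f (x - y)"
  have "Ck_on 1 ?p ?W"
    by (intro Ck_on_prod W Cf Ck_on_subset[OF h(1)]) simp
  \<comment> \<open>\<open>f\<close> is regular only on \<Omega>, but the product vanishes off the
    box, which lies in \<open>?W\<close>.\<close>
  then have p: "Ck_on 1 ?p UNIV"
    by (rule Ck_on_zero_extension[OF W closed_cbox[of a b], rotated 2]) (use h x in auto)
  have p1: "Ck_on (Suc 0) ?p UNIV" using p by simp
  have c: "continuous_on UNIV (dird v ?p)" using Ck_on_dird[OF p1] by simp
  have off: "dird v ?p y = 0" if "y \<notin> cbox a b" for y
    by (rule dird_zero_off[OF closed_cbox[of a b] _ that]) (simp add: h)
  have "0 = (LINT y|lborel. dird v ?p y)"
    by (rule integral_dird_eq_0[OF p compact_cbox[of a b], symmetric]) (simp add: h)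
  also have "\<dots> = integral (cbox a b) (dird v ?p)"
    using c off by (intro lborel_integral_eq_integral_cbox) (auto intro: continuous_on_subset)
  also have "\<dots> = integral (cbox a b) (\<lambda>y. dird v h y * f (x - y) - h y * dird v f (x - y))"
  proof (rule integral_cong)
    fix y assume "y \<in> cbox a b"
    then have y: "y \<in> ?W" using x by simp
    have "dird v ?p y = h y * dird v (\<lambda>y. f (x - y)) y + dird v h y * f (x - y)"
      using df[OF y] Ck_on_imp_differentiable[OF h1] by (intro dird_prod) (auto simp: differentiable_def)
    then show "dird v ?p y = dird v h y * f (x - y) - h y * dird v f (x - y)"
      by (simp add: dirdI[OF df[OF y]])
  qed
  also have "\<dots> = conv (dird v h) a b f x - conv h a b (dird v f) x"
    unfolding conv_def
  proof (rule integral_diff; rule integrable_continuous)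
    show "continuous_on (cbox a b) (\<lambda>y. dird v h y * f (x - y))"
      using Ck_on_dird[OF h1, of v] x
      by (intro continuous_intros continuous_on_compose2[OF Ck_on_continuous[OF f]]) (auto intro: continuous_on_subset)
    show "continuous_on (cbox a b) (\<lambda>y. h y * dird v f (x - y))"
    proof (rule continuous_on_mult)
      show "continuous_on (cbox a b) h"
        using Ck_on_continuous[OF h(1)] by (rule continuous_on_subset) simp
      have "continuous_on \<Omega> (dird v f)"
        using Ck_on_dird[OF f1] by simp
      then show "continuous_on (cbox a b) (\<lambda>y. dird v f (x - y))"
        by (rule continuous_on_compose2[of \<Omega> "dird v f" "cbox a b" "\<lambda>y. x - y"])
          (rule continuous_on_diff[OF continuous_on_const continuous_on_id], use x in blast)
    qed
  qed
  finally show ?thesis by simp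
qed

text \<open>One derivative falls on the mollifier and the others on \<open>f\<close>, so \<open>C\<^sup>1\<close> regularity of \<open>h\<close> is enough
  to gain an order.\<close>

lemma Ck_on_Suc_conv:
  fixes f h :: "'a::euclidean_space \<Rightarrow> real"
  assumes "open \<Omega>" and f: "Ck_on (Suc k) f \<Omega>" and h: "Ck_on 1 h UNIV" "\<And>y. y \<notin> cbox a b \<Longrightarrow> h y = 0"
    and U: "open U" and sub: "\<And>x y. x \<in> U \<Longrightarrow> y \<in> cbox a b \<Longrightarrow> x - y \<in> \<Omega>"
  shows "Ck_on (Suc (Suc k)) (conv h a b f) U"
proof -
  have f1: "Ck_on 1 f \<Omega>" using f by (rule Ck_on_le) simp
  have h1: "Ck_on (Suc 0) h UNIV" using h by simp
  have ch: "continuous_on (cbox a b) h" "continuous_on (cbox a b) (dird v h)" for v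
    using Ck_on_continuous[OF h(1)] Ck_on_dird[OF h1, of v] by (auto intro: continuous_on_subset)
  have "Ck_on (Suc k) (dird v (conv h a b f)) U" for v
  proof (rule Ck_on_cong[OF U])
    show "Ck_on (Suc k) (conv (dird v h) a b f) U"
      by (rule Ck_on_conv[OF f ch(2) U sub])
    show "conv (dird v h) a b f x = dird v (conv h a b f) x" if "x \<in> U" for x
      using conv_by_parts[OF assms(1) f1 h sub[OF that], where v=v] dird_conv[OF f1 ch(1) U that sub, where v=v] by simp
  qed
  moreover have "conv h a b f differentiable (at x)" if "x \<in> U" for x
    using conv_has_derivative[OF f1 ch(1) U that sub] by (auto simp: differentiable_def)
  ultimately show ?thesis by (metis Ck_on.simps(2))
qed

text \<open>The integral is at least the minimum over the closed ball of half the radius times the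
  volume of that ball.\<close>

lemma integral_bump_pos:
  fixes f :: "'a::euclidean_space \<Rightarrow> real"
  assumes "r > 0" "continuous_on UNIV f" "\<And>x. 0 \<le> f x" "\<And>x. x \<in> ball c r \<Longrightarrow> 0 < f x"
    "\<And>x. x \<notin> ball c r \<Longrightarrow> f x = 0"
  shows "0 < (LINT x|lborel. f x)"
proof -
  have ne: "cball c (r / 2) \<noteq> {}" using assms(1) by simp
  obtain y where y: "y \<in> cball c (r / 2)" "\<And>x. x \<in> cball c (r / 2) \<Longrightarrow> f y \<le> f x"
    using continuous_attains_inf[OF compact_cball ne continuous_on_subset[OF assms(2)]] by auto
  have fy: "0 < f y" using y(1) assms(1) by (intro assms(4)) auto
  have "0 < f y * measure lborel (cball c (r / 2))"
    using fy content_cball_pos[of "r / 2" c] assms(1) by simp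
  also have "\<dots> = (LINT x|lborel. f y * indicator (cball c (r / 2)) x)"
    by simp
  also have "\<dots> \<le> (LINT x|lborel. f x)"
  proof (rule integral_mono)
    show "integrable lborel (\<lambda>x. f y * indicator (cball c (r / 2)) x)"
      by (intro integrable_mult_right integrable_real_indicator)
        (simp_all add: emeasure_compact_finite[unfolded infinity_ennreal_def])
    show "integrable lborel f"
      by (rule integrable_continuous_compact_support[OF compact_cball[of c r]])
        (use assms in \<open>auto intro: continuous_on_subset\<close>)
    show "f y * indicator (cball c (r / 2)) x \<le> f x" for x
      using y(2)[of x] assms(3)[of x] by (auto simp: indicator_def)
  qed
  finally show ?thesis .
qed

lemma conv_near:
  fixes f h :: "'a::euclidean_space \<Rightarrow> real"
  assumes f: "continuous_on \<Omega> f" and h: "continuous_on (cbox a b) h" "\<And>y. 0 \<le> h y"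
    "integral (cbox a b) h = 1"
    and x: "\<And>y. y \<in> cbox a b \<Longrightarrow> x - y \<in> \<Omega>"
    and near: "\<And>y. y \<in> cbox a b \<Longrightarrow> \<bar>f (x - y) - f x\<bar> \<le> e"
  shows "\<bar>conv h a b f x - f x\<bar> \<le> e"
proof -
  have i: "(\<lambda>y. h y * f (x - y)) integrable_on cbox a b" "h integrable_on cbox a b"
    using x by (auto intro!: integrable_continuous continuous_intros h continuous_on_compose2[OF f])
  have "conv h a b f x - f x = integral (cbox a b) (\<lambda>y. h y * f (x - y)) - integral (cbox a b) (\<lambda>y. h y * f x)"
    using h(3) by (simp add: conv_def)
  also have "\<dots> = integral (cbox a b) (\<lambda>y. h y * f (x - y) - h y * f x)"
    using i by (intro integral_diff[symmetric]) (auto intro: integrable_on_mult_left)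
  also have "norm \<dots> \<le> integral (cbox a b) (\<lambda>y. h y * e)"
  proof (rule integral_norm_bound_integral)
    show "(\<lambda>y. h y * f (x - y) - h y * f x) integrable_on cbox a b"
      using i by (intro integrable_diff) (auto intro: integrable_on_mult_left)
    show "(\<lambda>y. h y * e) integrable_on cbox a b"
      using i by (auto intro: integrable_on_mult_left)
    show "norm (h y * f (x - y) - h y * f x) \<le> h y * e" if "y \<in> cbox a b" for y
      using near[OF that] h(2)[of y]
      by (simp add: abs_mult mult_left_mono flip: right_diff_distrib)
  qed
  also have "\<dots> = e" using h(3) by simp
  finally show ?thesis by simp
qed

lemma exists_mollifier:
  fixes U :: "'a::euclidean_space set"
  assumes "open U" "0 \<in> U"
  obtains h a b where "cbox a b \<subseteq> U" "\<And>m. Ck_on m h UNIV" "\<And>y. 0 \<le> h y" "\<And>y. y \<notin> cbox a b \<Longrightarrow> h y = (0::real)"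
    "integral (cbox a b) h = 1"
proof -
  obtain a b where ab: "cbox a b \<subseteq> U" "0 \<in> box a b"
    using assms open_contains_cbox[of U] by (metis)
  obtain r where r: "r > 0" "ball 0 r \<subseteq> box a b"
    using ab open_box by (meson openE)
  obtain f :: "'a \<Rightarrow> real" where f: "\<And>m. Ck_on m f UNIV" "\<And>x. 0 \<le> f x" "\<And>x. x \<in> ball 0 r \<Longrightarrow> 0 < f x"
    "\<And>x. x \<notin> ball 0 r \<Longrightarrow> f x = 0"
    using exists_bump[OF r(1), of 0] by metis
  have cf: "continuous_on UNIV f" by (rule Ck_on_continuous[OF f(1)])
  have off: "f y = 0" if "y \<notin> cbox a b" for y
    using that r box_subset_cbox[of a b] by (intro f(4)) auto
  have "0 < (LINT x|lborel. f x)"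
    by (rule integral_bump_pos[OF r(1) cf f(2-4)])
  also have "(LINT x|lborel. f x) = integral (cbox a b) f"
    using cf off by (intro lborel_integral_eq_integral_cbox) (auto intro: continuous_on_subset)
  finally have pos: "0 < integral (cbox a b) f" .
  show ?thesis
  proof (rule that[of a b "\<lambda>y. (1 / integral (cbox a b) f) * f y"])
    show "Ck_on m (\<lambda>y. (1 / integral (cbox a b) f) * f y) UNIV" for m
      by (rule bounded_linear.Ck_on_linear[OF bounded_linear_mult_right _ f(1)]) simp
  qed (use ab pos f off in auto)
qed

text \<open>Convolution commutes with derivatives, so on Q the derivatives of \<open>g\<close> up to
  order two are local averages of those of \<open>u\<close>; the third order comes from
  \<open>Ck_on_Suc_conv\<close>.\<close>

lemma C3_approximation:
  fixes u :: "'a::euclidean_space \<Rightarrow> real"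
  assumes \<Omega>: "open \<Omega>" and Q: "compact Q" "Q \<subseteq> \<Omega>" and u: "Ck_on 2 u \<Omega>" and V: "finite V" and e: "e > 0"
  obtains U g where "open U" "Q \<subseteq> U" "U \<subseteq> \<Omega>" "Ck_on 3 g U"
    "\<And>x v. x \<in> Q \<Longrightarrow> v \<in> V \<Longrightarrow> \<bar>dird v g x - dird v u x\<bar> \<le> e"
    "\<And>x v w. x \<in> Q \<Longrightarrow> v \<in> V \<Longrightarrow> w \<in> V \<Longrightarrow> \<bar>dird v (dird w g) x - dird v (dird w u) x\<bar> \<le> e"
proof -
  have u2: "Ck_on (Suc (Suc 0)) u \<Omega>" using u by (simp only: numeral_2_eq_2)
  have u1: "Ck_on 1 u \<Omega>" "Ck_on 1 (dird v u) \<Omega>" for v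
    using Ck_on_le[OF u, of 1] Ck_on_dird[OF u2] by simp_all
  obtain r where r: "r > 0" "(\<Union>x\<in>Q. ball x r) \<subseteq> \<Omega>"
    by (rule compact_subset_open_imp_ball_epsilon_subset[OF Q(1) \<Omega> Q(2)])
  define W where "W = (\<Union>x\<in>Q. ball x (r / 2))"
  \<comment> \<open>A compact neighbourhood of Q inside \<Omega>, on which the finitely many
    functions of \<open>F\<close> are uniformly continuous.\<close>
  define P where "P = (\<lambda>(x, y). x + y) ` (Q \<times> cball 0 (r / 2))"
  have "compact P"
    unfolding P_def by (intro compact_continuous_image compact_Times Q compact_cball) (auto intro!: continuous_intros simp: split_def)
  have "P \<subseteq> \<Omega>"
  proof -
    have "x + y \<in> ball x r" if "y \<in> cball 0 (r / 2)" for x y :: 'a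
      using that r(1) by (auto simp: dist_norm)
    then show ?thesis unfolding P_def using r(2) by fastforce
  qed
  define F where "F = (\<lambda>v. dird v u) ` V \<union> (\<lambda>(v, w). dird v (dird w u)) ` (V \<times> V)"
  have F: "finite F" using V by (auto simp: F_def)
  have cF: "continuous_on \<Omega> f" if "f \<in> F" for f
    using that Ck_on_dird[OF u2] Ck_on_dird[OF Ck_on_dird[OF u2]] Ck_on_continuous
    unfolding F_def by (auto simp del: Ck_on.simps dest: Ck_on_continuous)
  have "\<exists>d>0. \<forall>x\<in>P. \<forall>y\<in>P. dist y x < d \<longrightarrow> dist (f y) (f x) < e" if "f \<in> F" for f
    using compact_uniformly_continuous[OF continuous_on_subset[OF cF[OF that] \<open>P \<subseteq> \<Omega>\<close>] \<open>compact P\<close>] e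
    unfolding uniformly_continuous_on_def by blast
  then obtain d where d: "\<And>f. f \<in> F \<Longrightarrow> d f > 0" "\<And>f x y. f \<in> F \<Longrightarrow> x \<in> P \<Longrightarrow> y \<in> P \<Longrightarrow> dist y x < d f \<Longrightarrow> dist (f y) (f x) < e"
    by metis
  \<comment> \<open>One radius that serves all derivatives in \<open>F\<close> and keeps the shifted
    points inside \<Omega>.\<close>
  define s where "s = Min (insert (r / 2) (d ` F))"
  have s: "s > 0" "s \<le> r / 2" "\<And>f. f \<in> F \<Longrightarrow> s \<le> d f"
  proof -
    show "s > 0" using F d(1) r(1) by (simp add: s_def)
    show "s \<le> r / 2" unfolding s_def using F by (intro Min_le) auto
    show "s \<le> d f" if "f \<in> F" for f unfolding s_def using F that by (intro Min_le) auto
  qed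
  obtain h :: "'a \<Rightarrow> real" and a b where h: "cbox a b \<subseteq> ball 0 s" "\<And>m. Ck_on m h UNIV" "\<And>y. 0 \<le> h y" "\<And>y. y \<notin> cbox a b \<Longrightarrow> h y = 0"
    "integral (cbox a b) h = 1"
    using exists_mollifier[of "ball (0::'a) s"] s by (metis centre_in_ball open_ball)
  have ch: "continuous_on (cbox a b) h"
    using Ck_on_continuous[OF h(2)] by (rule continuous_on_subset) simp
  have W: "open W" "Q \<subseteq> W" "W \<subseteq> \<Omega>"
    using r by (force simp: W_def)+
  have sub: "x - y \<in> \<Omega>" if "x \<in> W" "y \<in> cbox a b" for x y
  proof -
    obtain q where q: "q \<in> Q" "dist q x < r / 2" using \<open>x \<in> W\<close> by (auto simp: W_def)
    have "norm y < r / 2" using that h(1) s by force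
    then have "dist q (x - y) < r"
      using q(2) norm_triangle_ineq[of "q - x" y] by (simp add: dist_norm algebra_simps)
    then have "x - y \<in> ball q r" by simp
    then show ?thesis using r(2) q(1) by blast
  qed
  have near: "\<bar>conv h a b f x - f x\<bar> \<le> e" if "f \<in> F" "x \<in> Q" for f x
  proof (rule conv_near[OF cF[OF that(1)] ch h(3,5)])
    fix y assume y: "y \<in> cbox a b"
    show "x - y \<in> \<Omega>" using sub y that W by blast
    have "norm y < s" using y h(1) by force
    moreover have "x - y \<in> P"
      unfolding P_def using that \<open>norm y < s\<close> s by (intro image_eqI[where x="(x, - y)"]) auto
    moreover have "x \<in> P"
      unfolding P_def using that r(1) by (intro image_eqI[where x="(x, 0)"]) auto
    ultimately have "dist (f (x - y)) (f x) < e"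
      using s(3)[OF that(1)] by (intro d(2) that) (auto simp: dist_norm)
    then show "\<bar>f (x - y) - f x\<bar> \<le> e" by (simp add: dist_real_def)
  qed
  show ?thesis
  proof (rule that[of W "conv h a b u"])
    show "Ck_on 3 (conv h a b u) W"
      unfolding numeral_3_eq_3 by (rule Ck_on_Suc_conv[OF \<Omega> u2 h(2) h(4) W(1) sub])
    have 1: "dird v (conv h a b u) x = conv h a b (dird v u) x" if "x \<in> W" for x v
      using dird_conv[OF u1(1) ch W(1) that sub] .
    have 2: "dird v (dird w (conv h a b u)) x = conv h a b (dird v (dird w u)) x" if "x \<in> W" for x v w
    proof -
      have "dird v (dird w (conv h a b u)) x = dird v (conv h a b (dird w u)) x"
        by (rule dird_cong[OF W(1) that 1])
      also have "\<dots> = conv h a b (dird v (dird w u)) x"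
        by (rule dird_conv[OF u1(2) ch W(1) that sub])
      finally show ?thesis .
    qed
    show "\<bar>dird v (conv h a b u) x - dird v u x\<bar> \<le> e" if "x \<in> Q" "v \<in> V" for x v
    proof -
      have "dird v u \<in> F" using that by (simp add: F_def)
      moreover have "x \<in> W" using that W by blast
      ultimately show ?thesis using near[of "dird v u" x] that(1) by (simp add: 1)
    qed
    show "\<bar>dird v (dird w (conv h a b u)) x - dird v (dird w u) x\<bar> \<le> e" if "x \<in> Q" "v \<in> V" "w \<in> V" for x v w
    proof -
      have "dird v (dird w u) \<in> F"
        unfolding F_def using that by (intro UnI2 image_eqI[where x="(v, w)"]) auto
      moreover have "x \<in> W" using that W by blast
      ultimately show ?thesis using near[of "dird v (dird w u)" x] that(1) by (simp add: 2)
    qed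
  qed (fact W)+
qed

section \<open>The left-invariant vector fields\<close>

definition t_coeff :: "real ^ ('n::finite \<times> 4) ^ ('n \<times> 4) \<Rightarrow> 3 \<Rightarrow> 'n \<times> 4 \<Rightarrow> 'n grp \<Rightarrow> real" where
  "t_coeff S \<beta> b q = 2 * (\<Sum>a\<in>UNIV. B_mat S \<beta> $ a $ b * fst q $ a)"

definition x_vec :: "'n::finite \<times> 4 \<Rightarrow> 'n grp" where
  "x_vec b = (axis b 1, 0)"

definition t_vec :: "3 \<Rightarrow> 'n::finite grp" where
  "t_vec \<beta> = (0, axis \<beta> 1)"

text \<open>As a directional derivative along a vector that depends on the point, X_b inherits all
  rules for \<open>dird\<close>, with values in any normed space.\<close>

definition XV :: "real ^ ('n::finite \<times> 4) ^ ('n \<times> 4) \<Rightarrow> 'n \<times> 4 \<Rightarrow>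
    ('n grp \<Rightarrow> 'b::real_normed_vector) \<Rightarrow> 'n grp \<Rightarrow> 'b" where
  "XV S b F q = dird (x_vec b + (\<Sum>\<beta>\<in>UNIV. t_coeff S \<beta> b q *\<^sub>R t_vec \<beta>)) F q"

lemma continuous_on_dird: "Ck_on 1 f U \<Longrightarrow> continuous_on U (dird v f)"
  using Ck_on_dird[of 0 f U v] by simp

lemma bounded_linear_t_coeff: "bounded_linear (t_coeff S \<beta> b)"
proof -
  have "bounded_linear (\<lambda>q. fst q $ a)" for a
    by (rule bounded_linear_compose[OF bounded_linear_vec_nth bounded_linear_fst])
  then show ?thesis
    unfolding t_coeff_def[abs_def]
    by (intro bounded_linear_const_mult bounded_linear_sum)
qed

lemma t_coeff_x_vec: "t_coeff S \<beta> b (x_vec a) = 2 * B_mat S \<beta> $ a $ b"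
  by (simp add: t_coeff_def x_vec_def axis_def if_distrib[of "times _"] sum.delta cong: if_cong)

lemma t_coeff_t_vec: "t_coeff S \<beta> b (t_vec \<gamma>) = 0"
  by (simp add: t_coeff_def t_vec_def)

lemma dird_linear_sum:
  assumes "f differentiable (at x)"
  shows "dird (\<Sum>i\<in>A. r i *\<^sub>R v i) f x = (\<Sum>i\<in>A. r i *\<^sub>R dird (v i) f x)"
  by (induction A rule: infinite_finite_induct) (simp_all add: dird_linear_vector[OF assms])

lemma XV_expand:
  assumes "F differentiable (at q)"
  shows "XV S b F q = dird (x_vec b) F q + (\<Sum>\<beta>\<in>UNIV. t_coeff S \<beta> b q *\<^sub>R dird (t_vec \<beta>) F q)"
  unfolding XV_def dird_linear_vector(1)[OF assms] dird_linear_sum[OF assms] ..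

lemma X_field_eq_XV:
  assumes "f differentiable (at q)"
  shows "X_field S b f q = XV S b f q"
proof -
  have "2 * (\<Sum>\<beta>\<in>UNIV. \<Sum>a\<in>UNIV. of_real (B_mat S \<beta> $ a $ b * fst q $ a) * dt \<beta> f q)
      = (\<Sum>\<beta>\<in>UNIV. t_coeff S \<beta> b q *\<^sub>R dird (t_vec \<beta>) f q)"
    by (simp add: sum_distrib_left t_coeff_def dt_def t_vec_def scaleR_conv_of_real sum_distrib_right mult.assoc)
  then show ?thesis
    unfolding XV_expand[OF assms] X_field_def by (simp add: dx_def x_vec_def)
qed

lemma XV_cong:
  assumes "open U" "q \<in> U" "\<And>y. y \<in> U \<Longrightarrow> F y = G y"
  shows "XV S b F q = XV S b G q"
  unfolding XV_def by (rule dird_cong[OF assms])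

lemma Ck_on_XV:
  assumes "open U" "Ck_on (Suc k) F U"
  shows "Ck_on k (XV S b F) U"
proof (rule Ck_on_cong[OF assms(1)])
  show "Ck_on k (\<lambda>q. dird (x_vec b) F q + (\<Sum>\<beta>\<in>UNIV. t_coeff S \<beta> b q *\<^sub>R dird (t_vec \<beta>) F q)) U"
    using assms(2)
    by (intro Ck_on_add Ck_on_sum bounded_bilinear.Ck_on_prod[OF bounded_bilinear_scaleR]
        Ck_on_bounded_linear[OF bounded_linear_t_coeff] Ck_on_dird assms(1))
  show "dird (x_vec b) F q + (\<Sum>\<beta>\<in>UNIV. t_coeff S \<beta> b q *\<^sub>R dird (t_vec \<beta>) F q) = XV S b F q" if "q \<in> U" for q
    using XV_expand[OF Ck_on_imp_differentiable[OF assms(2) that]] by simp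
qed

lemma XV_zero_off:
  assumes "closed Q" "\<And>x. x \<notin> Q \<Longrightarrow> F x = 0" "x \<notin> Q"
  shows "XV S b F x = 0"
  unfolding XV_def by (rule dird_zero_off[OF assms])

lemma XV_prod:
  assumes "bounded_bilinear pr" "f differentiable (at q)" "g differentiable (at q)"
  shows "XV S b (\<lambda>x. pr (f x) (g x)) q = pr (f q) (XV S b g q) + pr (XV S b f q) (g q)"
  unfolding XV_def by (rule bounded_bilinear.dird_prod[OF assms])

lemma XV_linear:
  assumes "bounded_linear h" "f differentiable (at q)"
  shows "XV S b (\<lambda>x. h (f x)) q = h (XV S b f q)"
  unfolding XV_def by (rule bounded_linear.dird_linear[OF assms])

lemma dird_sum:
  assumes "\<And>i. i \<in> A \<Longrightarrow> f i differentiable (at x)"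
  shows "dird v (\<lambda>x. \<Sum>i\<in>A. f i x) x = (\<Sum>i\<in>A. dird v (f i) x)"
  by (rule dirdI) (intro has_derivative_sum differentiable_has_dird assms)

lemma XV_sum:
  assumes "\<And>i. i \<in> A \<Longrightarrow> f i differentiable (at q)"
  shows "XV S b (\<lambda>x. \<Sum>i\<in>A. f i x) q = (\<Sum>i\<in>A. XV S b (f i) q)"
  unfolding XV_def by (rule dird_sum[OF assms])

text \<open>The field is divergence free: the coefficients of its t-derivatives depend on x alone
  and can be moved under the derivative.\<close>

lemma integral_XV_eq_0:
  fixes F :: "'n::finite grp \<Rightarrow> 'b::euclidean_space"
  assumes F: "Ck_on 1 F UNIV" and Q: "compact Q" "\<And>x. x \<notin> Q \<Longrightarrow> F x = 0"
  shows "(LINT q|lborel. XV S b F q) = 0"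
proof -
  have F1: "Ck_on (Suc 0) F UNIV" using F by simp
  have int: "integrable lborel (dird v G)" if "Ck_on 1 G UNIV" "\<And>x. x \<notin> Q \<Longrightarrow> G x = 0" for G :: "'n grp \<Rightarrow> 'b" and v
  proof (rule integrable_continuous_compact_support[OF Q(1)])
    have "continuous_on UNIV (dird v G)" using that(1) by (rule continuous_on_dird)
    then show "continuous_on Q (dird v G)" by (rule continuous_on_subset) simp
    show "dird v G x = 0" if "x \<notin> Q" for x
      by (rule dird_zero_off[OF compact_imp_closed[OF Q(1)]]) fact+
  qed
  define G where "G \<beta> q = t_coeff S \<beta> b q *\<^sub>R F q" for \<beta> q
  have G: "Ck_on 1 (G \<beta>) UNIV" "\<And>x. x \<notin> Q \<Longrightarrow> G \<beta> x = 0" for \<beta>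
    unfolding G_def
    by (intro bounded_bilinear.Ck_on_prod[OF bounded_bilinear_scaleR] Ck_on_bounded_linear[OF bounded_linear_t_coeff] F open_UNIV)
      (simp add: Q)
  have dG: "dird (t_vec \<beta>) (G \<beta>) q = t_coeff S \<beta> b q *\<^sub>R dird (t_vec \<beta>) F q" for \<beta> q
  proof -
    have "dird (t_vec \<beta>) (t_coeff S \<beta> b) q = 0"
      by (subst dirdI[OF bounded_linear_imp_has_derivative[OF bounded_linear_t_coeff]]) (rule t_coeff_t_vec)
    then show ?thesis
      unfolding G_def using Ck_on_imp_differentiable[OF F1]
      by (subst bounded_bilinear.dird_prod[OF bounded_bilinear_scaleR])
        (auto intro: bounded_linear_imp_differentiable bounded_linear_t_coeff)
  qed
  have "XV S b F = (\<lambda>q. dird (x_vec b) F q + (\<Sum>\<beta>\<in>UNIV. dird (t_vec \<beta>) (G \<beta>) q))"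
    by (rule ext) (simp only: XV_expand[OF Ck_on_imp_differentiable[OF F1 UNIV_I]] dG)
  then have "(LINT q|lborel. XV S b F q) = (LINT q|lborel. dird (x_vec b) F q) + (\<Sum>\<beta>\<in>UNIV. (LINT q|lborel. dird (t_vec \<beta>) (G \<beta>) q))"
    using int[OF F Q(2)] int[OF G] by (simp add: Bochner_Integration.integral_add Bochner_Integration.integral_sum)
  also have "\<dots> = 0"
    using integral_dird_eq_0[OF F Q] integral_dird_eq_0[OF G(1) Q(1) G(2)] by simp
  finally show ?thesis .
qed

text \<open>The only first-order terms come from differentiating the coefficients of X_b along
  X_a.\<close>

lemma XV_XV_expand:
  fixes f :: "'n::finite grp \<Rightarrow> real"
  assumes U: "open U" "q \<in> U" and f: "Ck_on 2 f U"
  shows "XV S a (XV S b f) q = dird (x_vec a) (dird (x_vec b) f) q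
    + (\<Sum>\<beta>\<in>UNIV. t_coeff S \<beta> b q * dird (x_vec a) (dird (t_vec \<beta>) f) q)
    + (\<Sum>\<beta>\<in>UNIV. 2 * B_mat S \<beta> $ a $ b * dird (t_vec \<beta>) f q)
    + (\<Sum>\<gamma>\<in>UNIV. t_coeff S \<gamma> a q * dird (t_vec \<gamma>) (dird (x_vec b) f) q)
    + (\<Sum>\<gamma>\<in>UNIV. \<Sum>\<beta>\<in>UNIV. t_coeff S \<gamma> a q * (t_coeff S \<beta> b q * dird (t_vec \<gamma>) (dird (t_vec \<beta>) f) q))"
proof -
  have f2: "Ck_on (Suc (Suc 0)) f U" using f by (simp only: numeral_2_eq_2)
  have df: "dird v f differentiable (at q)" for v
    using Ck_on_imp_differentiable[OF Ck_on_dird[OF f2] U(2)] .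
  have dk: "t_coeff S \<beta> b differentiable (at q)" for \<beta>
    by (intro bounded_linear_imp_differentiable bounded_linear_t_coeff)
  have kd: "dird v (t_coeff S \<beta> b) q = t_coeff S \<beta> b v" for v \<beta>
    by (rule dirdI[OF bounded_linear_imp_has_derivative[OF bounded_linear_t_coeff]])
  have D: "dird v (XV S b f) q = dird v (dird (x_vec b) f) q
      + (\<Sum>\<beta>\<in>UNIV. t_coeff S \<beta> b q * dird v (dird (t_vec \<beta>) f) q + t_coeff S \<beta> b v * dird (t_vec \<beta>) f q)" for v
  proof -
    have "dird v (XV S b f) q = dird v (\<lambda>q. dird (x_vec b) f q + (\<Sum>\<beta>\<in>UNIV. t_coeff S \<beta> b q * dird (t_vec \<beta>) f q)) q"
      using XV_expand[OF Ck_on_imp_differentiable[OF f2]] by (intro dird_cong[OF U]) simp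
    also have "\<dots> = dird v (dird (x_vec b) f) q + (\<Sum>\<beta>\<in>UNIV. dird v (\<lambda>q. t_coeff S \<beta> b q * dird (t_vec \<beta>) f q) q)"
      using df dk by (simp add: dird_add dird_sum)
    also have "\<dots> = dird v (dird (x_vec b) f) q
      + (\<Sum>\<beta>\<in>UNIV. t_coeff S \<beta> b q * dird v (dird (t_vec \<beta>) f) q + t_coeff S \<beta> b v * dird (t_vec \<beta>) f q)"
    proof -
      have "dird v (\<lambda>q. t_coeff S \<beta> b q * dird (t_vec \<beta>) f q) q
          = t_coeff S \<beta> b q * dird v (dird (t_vec \<beta>) f) q + t_coeff S \<beta> b v * dird (t_vec \<beta>) f q" for \<beta>
        using bounded_bilinear.dird_prod[OF bounded_bilinear_mult dk df] by (simp only: kd)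
      then show ?thesis by (simp only:)
    qed
    finally show ?thesis .
  qed
  have "XV S b f differentiable (at q)"
    using Ck_on_XV[OF U(1) f2] U(2) by (intro Ck_on_imp_differentiable)
  then show ?thesis
    by (simp add: XV_expand D t_coeff_x_vec t_coeff_t_vec distrib_left sum.distrib sum_distrib_left)
qed

lemma I_mat_skew: "I_mat \<beta> $ i $ j = - I_mat \<beta> $ j $ i"
  by (simp add: I_mat_def transpose_def)

lemma I_diag_skew: "I_diag \<beta> $ a $ b = - I_diag \<beta> $ b $ a"
  using I_mat_skew[of \<beta> "snd a" "snd b"] by (simp add: I_diag_def)

lemma symmetric_matrix_nth:
  assumes "transpose S = S"
  shows "S $ a $ b = S $ b $ a"
proof -
  have "transpose S $ a $ b = S $ b $ a" by (simp add: transpose_def)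
  then show ?thesis using assms by simp
qed

lemma B_mat_nth:
  "B_mat S \<beta> $ a $ b = (\<Sum>c\<in>UNIV. S $ a $ c * I_diag \<beta> $ c $ b) + (\<Sum>c\<in>UNIV. I_diag \<beta> $ a $ c * S $ c $ b)"
  by (simp add: B_mat_def matrix_matrix_mult_def)

lemma B_mat_skew:
  assumes "transpose S = S"
  shows "B_mat S \<beta> $ b $ a = - B_mat S \<beta> $ a $ b"
proof -
  have "(\<Sum>c\<in>UNIV. S $ b $ c * I_diag \<beta> $ c $ a) = - (\<Sum>c\<in>UNIV. I_diag \<beta> $ a $ c * S $ c $ b)"
    unfolding sum_negf[symmetric]
    by (intro sum.cong refl) (simp add: I_diag_skew[of \<beta> _ a] symmetric_matrix_nth[OF assms, of b])
  moreover have "(\<Sum>c\<in>UNIV. I_diag \<beta> $ b $ c * S $ c $ a) = - (\<Sum>c\<in>UNIV. S $ a $ c * I_diag \<beta> $ c $ b)"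
    unfolding sum_negf[symmetric]
    by (intro sum.cong refl) (simp add: I_diag_skew[of \<beta> b] symmetric_matrix_nth[OF assms, of _ a])
  ultimately show ?thesis by (simp add: B_mat_nth)
qed

text \<open>The second-order terms are symmetric; the first-order ones leave 2 B_ab - 2 B_ba, which
  is 4 B_ab by skewness.\<close>

lemma XV_commutator:
  fixes f :: "'n::finite grp \<Rightarrow> real"
  assumes S: "transpose S = S" and U: "open U" "q \<in> U" and f: "Ck_on 2 f U"
  shows "XV S a (XV S b f) q - XV S b (XV S a f) q = (\<Sum>\<beta>\<in>UNIV. 4 * B_mat S \<beta> $ a $ b * dird (t_vec \<beta>) f q)"
proof -
  have s1: "dird (x_vec b) (dird (x_vec a) f) q = dird (x_vec a) (dird (x_vec b) f) q"
    and s2: "dird (t_vec \<beta>) (dird (x_vec c) f) q = dird (x_vec c) (dird (t_vec \<beta>) f) q"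
    and s3: "dird (t_vec \<beta>) (dird (t_vec \<gamma>) f) q = dird (t_vec \<gamma>) (dird (t_vec \<beta>) f) q" for \<beta> \<gamma> c
    by (rule dird_symmetric[OF U f])+
  have tt: "(\<Sum>\<gamma>\<in>UNIV. \<Sum>\<beta>\<in>UNIV. t_coeff S \<gamma> b q * (t_coeff S \<beta> a q * dird (t_vec \<gamma>) (dird (t_vec \<beta>) f) q))
     = (\<Sum>\<gamma>\<in>UNIV. \<Sum>\<beta>\<in>UNIV. t_coeff S \<gamma> a q * (t_coeff S \<beta> b q * dird (t_vec \<gamma>) (dird (t_vec \<beta>) f) q))"
  proof (subst sum.swap, intro sum.cong refl)
    fix \<beta> \<gamma>
    show "t_coeff S \<gamma> b q * (t_coeff S \<beta> a q * dird (t_vec \<gamma>) (dird (t_vec \<beta>) f) q)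
        = t_coeff S \<beta> a q * (t_coeff S \<gamma> b q * dird (t_vec \<beta>) (dird (t_vec \<gamma>) f) q)"
      unfolding s3[of \<gamma> \<beta>] by simp
  qed
  have bt: "(\<Sum>\<beta>\<in>UNIV. 4 * B_mat S \<beta> $ a $ b * dird (t_vec \<beta>) f q)
      = (\<Sum>\<beta>\<in>UNIV. 2 * B_mat S \<beta> $ a $ b * dird (t_vec \<beta>) f q) - (\<Sum>\<beta>\<in>UNIV. 2 * B_mat S \<beta> $ b $ a * dird (t_vec \<beta>) f q)"
    unfolding sum_subtractf[symmetric]
    by (intro sum.cong refl) (simp add: B_mat_skew[OF S, where b=b and a=a])
  show ?thesis
    unfolding XV_XV_expand[OF U f] tt bt s1 s2 by simp
qed

section \<open>The operators as covector-valued derivations\<close>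

text \<open>Collecting in \<open>d0\<close> and \<open>d1\<close> the terms that contain a given field \<open>X\<^sub>a\<close> gives the covectors
  \<open>theta0 a\<close> and \<open>theta1 a\<close>, so that \<open>d\<^sub>i F = \<Sum>\<^sub>a theta\<^sub>i a \<and> X\<^sub>a F\<close> with real derivatives.\<close>

definition theta0 :: "'n::{finite,linorder} \<times> 4 \<Rightarrow> 'n ext" where
  "theta0 a = (case a of (l, k) \<Rightarrow>
     if k = 1 then omega (l, False) else if k = 2 then \<i> *s omega (l, False)
     else if k = 3 then omega (l, True) else (- \<i>) *s omega (l, True))"

definition theta1 :: "'n::{finite,linorder} \<times> 4 \<Rightarrow> 'n ext" where
  "theta1 a = (case a of (l, k) \<Rightarrow>
     if k = 1 then omega (l, True) else if k = 2 then (- \<i>) *s omega (l, True)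
     else if k = 3 then - omega (l, False) else (- \<i>) *s omega (l, False))"

definition dform :: "('n::{finite,linorder} \<times> 4 \<Rightarrow> 'n ext) \<Rightarrow> real ^ ('n \<times> 4) ^ ('n \<times> 4) \<Rightarrow>
    ('n grp \<Rightarrow> 'n ext) \<Rightarrow> 'n grp \<Rightarrow> 'n ext" where
  "dform \<theta> S F q = (\<Sum>b\<in>UNIV. \<theta> b \<curlywedge> XV S b F q)"

lemma sum_UNIV_prod:
  fixes f :: "'a::finite \<times> 'b::finite \<Rightarrow> 'c::comm_monoid_add"
  shows "sum f UNIV = (\<Sum>x\<in>UNIV. \<Sum>y\<in>UNIV. f (x, y))"
proof -
  have "sum f UNIV = (\<Sum>(x, y)\<in>UNIV \<times> UNIV. f (x, y))" by simp
  also have "\<dots> = (\<Sum>x\<in>UNIV. \<Sum>y\<in>UNIV. f (x, y))" by (rule sum.cartesian_product[symmetric])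
  finally show ?thesis .
qed

lemma sum_idx: "(\<Sum>A\<in>(UNIV :: ('n::finite \<times> bool) set). f A) = (\<Sum>l\<in>UNIV. f (l, False) + f (l, True))"
  by (simp add: sum_UNIV_prod UNIV_bool add.commute)

lemma sum_block: "(\<Sum>a\<in>(UNIV :: ('n::finite \<times> 4) set). f a)
    = (\<Sum>l\<in>UNIV. f (l, 1) + f (l, 2) + f (l, 3) + f (l, 4))"
  by (simp add: sum_UNIV_prod sum_4)

lemma odd_ext_uminus: "odd_ext v \<Longrightarrow> odd_ext (- v)"
  by (simp add: odd_ext_def)

lemma odd_theta: "odd_ext (theta0 a)" "odd_ext (theta1 a)"
  by (auto simp: theta0_def theta1_def split_beta intro!: odd_ext_omega odd_ext_scale odd_ext_uminus)

lemma sum_omega_set: "(\<Sum>I\<in>UNIV. v $ I *s omega_set I) = v"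
  by (simp add: omega_set_def basis_expansion)

lemma sum_nth_wedge_omega_set: "(\<Sum>I\<in>UNIV. v $ I *s (w \<curlywedge> omega_set I)) = w \<curlywedge> v"
proof -
  have "w \<curlywedge> v = w \<curlywedge> (\<Sum>I\<in>UNIV. v $ I *s omega_set I)" by (simp add: sum_omega_set)
  then show ?thesis by (simp add: wedge_sum_right wedge_scale_right)
qed

lemma X_field_component:
  assumes "F differentiable (at q)"
  shows "X_field S b (\<lambda>r. F r $ I) q = XV S b F q $ I"
proof -
  have "(\<lambda>r. F r $ I) differentiable (at q)"
    by (rule bounded_linear.differentiable_linear[OF bounded_linear_vec_nth assms])
  then show ?thesis
    by (simp add: X_field_eq_XV XV_linear[OF bounded_linear_vec_nth assms])
qed

lemma
  assumes "F differentiable (at q)"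
  shows d0_eq_dform: "d0 S F q = dform theta0 S F q"
    and d1_eq_dform: "d1 S F q = dform theta1 S F q"
proof -
  note X = X_field_component[OF assms]
  have c: "(\<Sum>I\<in>UNIV. (x * v $ I + y * w $ I) *s (u \<curlywedge> omega_set I)) = (x *s u) \<curlywedge> v + (y *s u) \<curlywedge> w" for u v w :: "'a ext" and x y
  proof -
    have "(\<Sum>I\<in>UNIV. (x * v $ I + y * w $ I) *s (u \<curlywedge> omega_set I))
      = (\<Sum>I\<in>UNIV. (x *s v + y *s w) $ I *s (u \<curlywedge> omega_set I))" by simp
    also have "\<dots> = u \<curlywedge> (x *s v + y *s w)" by (rule sum_nth_wedge_omega_set)
    finally show ?thesis by (simp add: wedge_add_right wedge_scale_left wedge_scale_right)
  qed
  show "d0 S F q = dform theta0 S F q"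
    unfolding d0_def dform_def sum_idx sum_block Z0_def prod.case X theta0_def
    using c[of 1 _ \<i>] c[of 1 _ "- \<i>"] by (simp add: add.assoc)
  show "d1 S F q = dform theta1 S F q"
    unfolding d1_def dform_def sum_idx sum_block Z1_def prod.case X theta1_def
    using c[of "-1" _ "- \<i>"] c[of 1 _ "- \<i>"] by (simp add: add_ac wedge_minus_left) (simp add: algebra_simps)
qed

text \<open>The contraction of a matrix with two families of covectors; commutator terms and the
  right-type condition both have this shape.\<close>

definition sform :: "real ^ ('n \<times> 4) ^ ('n \<times> 4) \<Rightarrow> ('n::{finite,linorder} \<times> 4 \<Rightarrow> 'n ext) \<Rightarrow> ('n \<times> 4 \<Rightarrow> 'n ext) \<Rightarrow> 'n ext" where
  "sform M \<theta> \<theta>' = (\<Sum>a\<in>UNIV. \<Sum>b\<in>UNIV. M $ a $ b *\<^sub>R (\<theta> a \<curlywedge> \<theta>' b))"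

text \<open>Exchanging the indices uses the symmetry of M, and exchanging the factors costs a sign.
  With equal families the contraction therefore vanishes.\<close>

lemma sform_antisym:
  assumes "transpose M = M" "\<And>a. odd_ext (\<theta> a)" "\<And>a. odd_ext (\<theta>' a)"
  shows "sform M \<theta> \<theta>' = - sform M \<theta>' \<theta>"
proof -
  have "sform M \<theta> \<theta>' = (\<Sum>a\<in>UNIV. \<Sum>b\<in>UNIV. M $ b $ a *\<^sub>R - (\<theta>' b \<curlywedge> \<theta> a))"
    unfolding sform_def
    by (intro sum.cong refl arg_cong2[where f=scaleR] symmetric_matrix_nth[OF assms(1)] odd_ext_anticommute assms)
  also have "\<dots> = (\<Sum>b\<in>UNIV. \<Sum>a\<in>UNIV. M $ b $ a *\<^sub>R - (\<theta>' b \<curlywedge> \<theta> a))"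
    by (rule sum.swap)
  finally show ?thesis by (simp add: sform_def sum_negf)
qed

lemma sform_scale_right: "sform M \<theta> (\<lambda>b. c *s \<theta>' b) = c *s sform M \<theta> \<theta>'"
  and sform_scale_left: "sform M (\<lambda>b. c *s \<theta> b) \<theta>' = c *s sform M \<theta> \<theta>'"
  by (simp_all add: sform_def wedge_scale_left wedge_scale_right vec.scale_sum_right scaleR_eq_vector_scale
      vector_smult_assoc mult.commute)

lemma pd_phi_quad:
  assumes "transpose S = S"
  shows "pd b (phi_quad S) x = of_real (2 * (\<Sum>a\<in>UNIV. S $ a $ b * x $ a))"
proof -
  have nth: "((\<lambda>x. x $ a) has_derivative (\<lambda>v. v $ a)) (at x)" for a
    by (rule bounded_linear_imp_has_derivative) (rule bounded_linear_vec_nth)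
  have "((\<lambda>x. S $ a $ b * x $ a * x $ b) has_derivative
      (\<lambda>v. S $ a $ b * x $ a * v $ b + S $ a $ b * v $ a * x $ b)) (at x)" for a b
    by (rule has_derivative_mult[OF has_derivative_mult_right[OF nth] nth])
  then have "((\<lambda>x. \<Sum>a\<in>UNIV. \<Sum>b\<in>UNIV. S $ a $ b * x $ a * x $ b) has_derivative
      (\<lambda>v. \<Sum>a\<in>UNIV. \<Sum>b\<in>UNIV. S $ a $ b * x $ a * v $ b + S $ a $ b * v $ a * x $ b)) (at x)"
    by (intro has_derivative_sum)
  then have "(phi_quad S has_derivative
      (\<lambda>v. of_real (\<Sum>a\<in>UNIV. \<Sum>b\<in>UNIV. S $ a $ b * x $ a * v $ b + S $ a $ b * v $ a * x $ b))) (at x)"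
    unfolding phi_quad_def[abs_def] by (rule has_derivative_of_real)
  then have "pd b (phi_quad S) x = of_real (\<Sum>a\<in>UNIV. \<Sum>c\<in>UNIV. S $ a $ c * x $ a * axis b 1 $ c + S $ a $ c * axis b 1 $ a * x $ c)"
    unfolding pd_def by (rule dirdI)
  also have "(\<Sum>a\<in>UNIV. \<Sum>c\<in>UNIV. S $ a $ c * x $ a * axis b 1 $ c + S $ a $ c * axis b 1 $ a * x $ c)
      = (\<Sum>a\<in>UNIV. S $ a $ b * x $ a) + (\<Sum>c\<in>UNIV. S $ b $ c * x $ c)"
  proof -
    have "(\<Sum>a\<in>UNIV. \<Sum>c\<in>UNIV. S $ a $ c * x $ a * axis b 1 $ c) = (\<Sum>a\<in>UNIV. S $ a $ b * x $ a)"
      by (simp add: axis_def if_distrib[of "times _"] sum.delta cong: if_cong)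
    moreover have "(\<Sum>a\<in>UNIV. \<Sum>c\<in>UNIV. S $ a $ c * axis b 1 $ a * x $ c) = (\<Sum>c\<in>UNIV. S $ b $ c * x $ c)"
      by (subst sum.swap) (simp add: axis_def if_distrib[of "times _"] if_distrib[of "\<lambda>x. x * _"] sum.delta cong: if_cong)
    ultimately show ?thesis by (simp add: sum.distrib)
  qed
  also have "(\<Sum>c\<in>UNIV. S $ b $ c * x $ c) = (\<Sum>a\<in>UNIV. S $ a $ b * x $ a)"
    by (intro sum.cong refl) (simp add: symmetric_matrix_nth[OF assms, of b])
  finally show ?thesis by simp
qed

lemma pd_pd_phi_quad:
  assumes "transpose S = S"
  shows "pd a (\<lambda>x. c * pd b (phi_quad S) x + d * pd b' (phi_quad S) x) x = of_real (2 * S $ a $ b) * c + of_real (2 * S $ a $ b') * d"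
proof -
  have "bounded_linear (\<lambda>x :: real ^ ('a \<times> 4). \<Sum>a\<in>UNIV. S $ a $ b * x $ a)" for b
    by (intro bounded_linear_sum bounded_linear_const_mult bounded_linear_vec_nth)
  then have l: "bounded_linear (\<lambda>x. complex_of_real (2 * (\<Sum>a\<in>UNIV. S $ a $ b * x $ a)))" for b
    by (intro bounded_linear_compose[OF bounded_linear_of_real] bounded_linear_const_mult)
  have "bounded_linear (\<lambda>x. c * pd b (phi_quad S) x + d * pd b' (phi_quad S) x)"
    unfolding pd_phi_quad[OF assms]
    by (intro bounded_linear_add bounded_linear_const_mult l)
  from dirdI[OF bounded_linear_imp_has_derivative[OF this]]
  have "pd a (\<lambda>x. c * pd b (phi_quad S) x + d * pd b' (phi_quad S) x) x
     = c * pd b (phi_quad S) (axis a 1) + d * pd b' (phi_quad S) (axis a 1)"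
    unfolding pd_def .
  then show ?thesis
    unfolding pd_phi_quad[OF assms]
    by (simp add: axis_def if_distrib[of "times _"] sum.delta mult.commute cong: if_cong)
qed

text \<open>Collected by partial derivatives, \<open>nabla0\<close> carries the covectors
  \<open>theta1\<close> and \<open>nabla1\<close> carries the negatives of \<open>theta0\<close>; so
  the right-type condition contracts the Hessian 2 S of phi with these families.\<close>

lemma right_type_sform:
  assumes S: "transpose S = S" and "right_type S"
  shows "sform S theta1 theta0 = 0"
proof -
  define \<psi> where "\<psi> = phi_quad S"
  note P = pd_pd_phi_quad[OF S, folded \<psi>_def]
  have n: "nabla1 (l, False) \<psi> = (\<lambda>x. (-1) * pd (l, 1) \<psi> x + (- \<i>) * pd (l, 2) \<psi> x)"
    "nabla1 (l, True) \<psi> = (\<lambda>x. (-1) * pd (l, 3) \<psi> x + \<i> * pd (l, 4) \<psi> x)" for l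
    by (auto simp: nabla1_def fun_eq_iff)
  have "0 = (\<Sum>A\<in>UNIV. \<Sum>B\<in>UNIV. nabla0 A (nabla1 B \<psi>) 0 *s (omega A \<curlywedge> omega B))"
    using assms(2) by (simp add: right_type_def \<psi>_def)
  also have "\<dots> = (\<Sum>l\<in>UNIV. \<Sum>j\<in>UNIV.
      (nabla0 (l, False) (nabla1 (j, False) \<psi>) 0 *s (omega (l, False) \<curlywedge> omega (j, False))
      + nabla0 (l, False) (nabla1 (j, True) \<psi>) 0 *s (omega (l, False) \<curlywedge> omega (j, True)))
      + (nabla0 (l, True) (nabla1 (j, False) \<psi>) 0 *s (omega (l, True) \<curlywedge> omega (j, False))
      + nabla0 (l, True) (nabla1 (j, True) \<psi>) 0 *s (omega (l, True) \<curlywedge> omega (j, True))))"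
    by (simp only: sum_idx sum.distrib add_ac)
  \<comment> \<open>The 2 comes from the Hessian, the minus sign from \<open>nabla1\<close>.\<close>
  also have "\<dots> = (-2) *s (\<Sum>l\<in>UNIV. \<Sum>j\<in>UNIV.
      \<Sum>k\<in>UNIV. \<Sum>k'\<in>UNIV. S $ (l, k) $ (j, k') *\<^sub>R (theta1 (l, k) \<curlywedge> theta0 (j, k')))"
    unfolding vec.scale_sum_right
    by (intro sum.cong refl)
      (simp only: n nabla0_def prod.case P simp_thms if_True if_False,
        simp add: sum_4 theta0_def theta1_def wedge_scale_left wedge_scale_right wedge_minus_left wedge_minus_right
        vec_eq_iff scaleR_eq_vector_scale algebra_simps)
  also have "(\<Sum>l\<in>UNIV. \<Sum>j\<in>UNIV. \<Sum>k\<in>UNIV. \<Sum>k'\<in>UNIV. S $ (l, k) $ (j, k') *\<^sub>R (theta1 (l, k) \<curlywedge> theta0 (j, k')))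
      = sform S theta1 theta0"
    unfolding sform_def sum_block sum_4 by (simp only: sum.distrib add_ac)
  finally have "(-2) *s sform S theta1 theta0 = 0" by simp
  then show ?thesis by (simp add: vec_eq_iff)
qed

text \<open>Since \<open>B = S I + I S\<close> and the complex structures map \<open>theta0\<close> and \<open>theta1\<close> to multiples of
  each other, the contraction of \<open>B\<close>, which is the commutator term, reduces to those of \<open>S\<close>.\<close>

lemma I_diag_theta:
  "(\<Sum>b\<in>UNIV. I_diag \<beta> $ c $ b *\<^sub>R theta0 b) = (if \<beta> = 1 then \<i> *s theta0 c else if \<beta> = 2 then theta1 c else (- \<i>) *s theta1 c)"
  "(\<Sum>b\<in>UNIV. I_diag \<beta> $ c $ b *\<^sub>R theta1 b) = (if \<beta> = 1 then (- \<i>) *s theta1 c else if \<beta> = 2 then (-1) *s theta0 c else (- \<i>) *s theta0 c)"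
proof -
  obtain l k where c: "c = (l, k)" by (cases c)
  have s: "(\<Sum>b\<in>UNIV. I_diag \<beta> $ c $ b *\<^sub>R \<theta> b) = (\<Sum>j\<in>UNIV. I_mat \<beta> $ k $ j *\<^sub>R \<theta> (l, j))" for \<theta> :: "'a \<times> 4 \<Rightarrow> 'a ext"
  proof -
    have "(\<Sum>b\<in>UNIV. I_diag \<beta> $ c $ b *\<^sub>R \<theta> b) = (\<Sum>l'\<in>UNIV. \<Sum>j\<in>UNIV. I_diag \<beta> $ c $ (l', j) *\<^sub>R \<theta> (l', j))"
      by (rule sum_UNIV_prod)
    also have "\<dots> = (\<Sum>l'\<in>UNIV. if l' = l then (\<Sum>j\<in>UNIV. I_mat \<beta> $ k $ j *\<^sub>R \<theta> (l, j)) else 0)"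
      by (intro sum.cong refl) (auto simp: I_diag_def c)
    finally show ?thesis by simp
  qed
  have b: "\<beta> = 1 \<or> \<beta> = 2 \<or> \<beta> = 3" by (rule exhaust_3)
  have k: "k = 1 \<or> k = 2 \<or> k = 3 \<or> k = 4" by (rule exhaust_4)
  show "(\<Sum>b\<in>UNIV. I_diag \<beta> $ c $ b *\<^sub>R theta0 b) = (if \<beta> = 1 then \<i> *s theta0 c else if \<beta> = 2 then theta1 c else (- \<i>) *s theta1 c)"
    "(\<Sum>b\<in>UNIV. I_diag \<beta> $ c $ b *\<^sub>R theta1 b) = (if \<beta> = 1 then (- \<i>) *s theta1 c else if \<beta> = 2 then (-1) *s theta0 c else (- \<i>) *s theta0 c)"
    unfolding s using b k
    by (auto simp: c I_mat_def I_upper_def transpose_def theta0_def theta1_def sum_4 vec_eq_iff)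
qed

text \<open>In I S the matrix I acts on the left covectors, and its skewness produces the minus
  sign.\<close>

lemma sform_B_mat:
  "sform (B_mat S \<beta>) \<theta> \<theta>' = sform S \<theta> (\<lambda>c. \<Sum>b\<in>UNIV. I_diag \<beta> $ c $ b *\<^sub>R \<theta>' b)
    - sform S (\<lambda>c. \<Sum>b\<in>UNIV. I_diag \<beta> $ c $ b *\<^sub>R \<theta> b) \<theta>'"
proof -
  have "sform (B_mat S \<beta>) \<theta> \<theta>' = (\<Sum>a\<in>UNIV. \<Sum>b\<in>UNIV. \<Sum>c\<in>UNIV. (S $ a $ c * I_diag \<beta> $ c $ b) *\<^sub>R (\<theta> a \<curlywedge> \<theta>' b))
      + (\<Sum>a\<in>UNIV. \<Sum>b\<in>UNIV. \<Sum>c\<in>UNIV. (I_diag \<beta> $ a $ c * S $ c $ b) *\<^sub>R (\<theta> a \<curlywedge> \<theta>' b))"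
    by (simp add: sform_def B_mat_nth scaleR_left_distrib scaleR_left.sum sum.distrib)
  also have "(\<Sum>a\<in>UNIV. \<Sum>b\<in>UNIV. \<Sum>c\<in>UNIV. (S $ a $ c * I_diag \<beta> $ c $ b) *\<^sub>R (\<theta> a \<curlywedge> \<theta>' b))
      = (\<Sum>a\<in>UNIV. \<Sum>c\<in>UNIV. \<Sum>b\<in>UNIV. (S $ a $ c * I_diag \<beta> $ c $ b) *\<^sub>R (\<theta> a \<curlywedge> \<theta>' b))"
    by (rule sum.cong[OF refl]) (rule sum.swap)
  also have "\<dots> = sform S \<theta> (\<lambda>c. \<Sum>b\<in>UNIV. I_diag \<beta> $ c $ b *\<^sub>R \<theta>' b)"
    by (simp add: sform_def wedge_sum_right wedge.scaleR_right scaleR_right.sum)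
  also have "(\<Sum>a\<in>UNIV. \<Sum>b\<in>UNIV. \<Sum>c\<in>UNIV. (I_diag \<beta> $ a $ c * S $ c $ b) *\<^sub>R (\<theta> a \<curlywedge> \<theta>' b))
      = (\<Sum>a\<in>UNIV. \<Sum>c\<in>UNIV. \<Sum>b\<in>UNIV. (I_diag \<beta> $ a $ c * S $ c $ b) *\<^sub>R (\<theta> a \<curlywedge> \<theta>' b))"
    by (rule sum.cong[OF refl]) (rule sum.swap)
  also have "\<dots> = (\<Sum>c\<in>UNIV. \<Sum>a\<in>UNIV. \<Sum>b\<in>UNIV. (I_diag \<beta> $ a $ c * S $ c $ b) *\<^sub>R (\<theta> a \<curlywedge> \<theta>' b))"
    by (rule sum.swap)
  also have "\<dots> = (\<Sum>c\<in>UNIV. \<Sum>b\<in>UNIV. \<Sum>a\<in>UNIV. (I_diag \<beta> $ a $ c * S $ c $ b) *\<^sub>R (\<theta> a \<curlywedge> \<theta>' b))"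
    by (rule sum.cong[OF refl]) (rule sum.swap)
  also have "\<dots> = - sform S (\<lambda>c. \<Sum>b\<in>UNIV. I_diag \<beta> $ c $ b *\<^sub>R \<theta> b) \<theta>'"
    unfolding sform_def wedge_sum_left scaleR_right.sum sum_negf[symmetric]
  proof (intro sum.cong refl)
    fix c b a
    show "(I_diag \<beta> $ a $ c * S $ c $ b) *\<^sub>R (\<theta> a \<curlywedge> \<theta>' b) = - (S $ c $ b *\<^sub>R ((I_diag \<beta> $ c $ a *\<^sub>R \<theta> a) \<curlywedge> \<theta>' b))"
      by (simp add: I_diag_skew[of \<beta> a c] wedge.scaleR_left mult.commute)
  qed
  finally show ?thesis by simp
qed

text \<open>Every contraction of S with \<open>theta0\<close> and \<open>theta1\<close> vanishes:
  the equal pairs by antisymmetry, the mixed ones by the right-type condition. Applying I merely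
  exchanges or keeps the families, up to scalar factors.\<close>

lemma sform_B_mat_eq_0:
  assumes S: "transpose S = S" "right_type S"
  shows "sform (B_mat S \<beta>) theta0 theta0 = 0" "sform (B_mat S \<beta>) theta1 theta1 = 0"
    "sform (B_mat S \<beta>) theta1 theta0 = 0"
proof -
  have self: "x = - x \<Longrightarrow> x = 0" for x :: "'a ext"
    unfolding eq_neg_iff_add_eq_0 by (simp add: vec_eq_iff)
  have 00: "sform S theta0 theta0 = 0"
    by (rule self) (intro sform_antisym S odd_theta)
  have 11: "sform S theta1 theta1 = 0"
    by (rule self) (intro sform_antisym S odd_theta)
  have 10: "sform S theta1 theta0 = 0"
    by (rule right_type_sform[OF S])
  have 01: "sform S theta0 theta1 = 0"
    using sform_antisym[OF S(1) odd_theta(1) odd_theta(2)] 10 by simp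
  have s: "sform S \<theta> \<theta>' = 0" if "\<theta> \<in> {theta0, theta1}" "\<theta>' \<in> {theta0, theta1}" for \<theta> \<theta>'
    using that 00 01 10 11 by blast
  have b: "\<beta> = 1 \<or> \<beta> = 2 \<or> \<beta> = 3" by (rule exhaust_3)
  have I0: "\<exists>c \<theta>. \<theta> \<in> {theta0, theta1} \<and> (\<lambda>x. \<Sum>b\<in>UNIV. I_diag \<beta> $ x $ b *\<^sub>R theta0 b) = (\<lambda>x. c *s \<theta> x)"
  proof (cases "\<beta> = 1")
    case True
    then show ?thesis unfolding I_diag_theta by (intro exI[of _ \<i>] exI[of _ theta0]) simp
  next
    case False
    then show ?thesis unfolding I_diag_theta
      by (intro exI[of _ "if \<beta> = 2 then 1 else - \<i>"] exI[of _ theta1]) auto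
  qed
  have I1: "\<exists>c \<theta>. \<theta> \<in> {theta0, theta1} \<and> (\<lambda>x. \<Sum>b\<in>UNIV. I_diag \<beta> $ x $ b *\<^sub>R theta1 b) = (\<lambda>x. c *s \<theta> x)"
  proof (cases "\<beta> = 1")
    case True
    then show ?thesis unfolding I_diag_theta by (intro exI[of _ "- \<i>"] exI[of _ theta1]) simp
  next
    case False
    then show ?thesis unfolding I_diag_theta
      by (intro exI[of _ "if \<beta> = 2 then -1 else - \<i>"] exI[of _ theta0]) auto
  qed
  have "sform (B_mat S \<beta>) \<theta> \<theta>' = 0" if \<theta>: "\<theta> \<in> {theta0, theta1}" "\<theta>' \<in> {theta0, theta1}" for \<theta> \<theta>'
  proof -
    obtain c \<rho> where c: "\<rho> \<in> {theta0, theta1}" "(\<lambda>x. \<Sum>b\<in>UNIV. I_diag \<beta> $ x $ b *\<^sub>R \<theta> b) = (\<lambda>x. c *s \<rho> x)"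
      using \<theta>(1) I0 I1 by blast
    obtain c' \<rho>' where c': "\<rho>' \<in> {theta0, theta1}" "(\<lambda>x. \<Sum>b\<in>UNIV. I_diag \<beta> $ x $ b *\<^sub>R \<theta>' b) = (\<lambda>x. c' *s \<rho>' x)"
      using \<theta>(2) I0 I1 by blast
    show ?thesis
      unfolding sform_B_mat c(2) c'(2) sform_scale_left sform_scale_right s[OF c(1) \<theta>(2)] s[OF \<theta>(1) c'(1)]
      by simp
  qed
  then show "sform (B_mat S \<beta>) theta0 theta0 = 0" "sform (B_mat S \<beta>) theta1 theta1 = 0"
    "sform (B_mat S \<beta>) theta1 theta0 = 0"
    by blast+
qed

text \<open>Two successive operators applied to a function, see \<open>dform_grad\<close>. On C^2
  functions the pair \<open>theta0\<close>, \<open>theta1\<close> gives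
  \<open>triangle_form\<close>.\<close>

definition hess :: "real ^ ('n::{finite,linorder} \<times> 4) ^ ('n \<times> 4) \<Rightarrow> ('n \<times> 4 \<Rightarrow> 'n ext) \<Rightarrow> ('n \<times> 4 \<Rightarrow> 'n ext) \<Rightarrow>
    ('n grp \<Rightarrow> real) \<Rightarrow> 'n grp \<Rightarrow> 'n ext" where
  "hess S \<theta> \<theta>' u q = (\<Sum>a\<in>UNIV. \<Sum>b\<in>UNIV. XV S a (XV S b u) q *\<^sub>R (\<theta> a \<curlywedge> \<theta>' b))"

definition grad :: "real ^ ('n::{finite,linorder} \<times> 4) ^ ('n \<times> 4) \<Rightarrow> ('n \<times> 4 \<Rightarrow> 'n ext) \<Rightarrow>
    ('n grp \<Rightarrow> real) \<Rightarrow> 'n grp \<Rightarrow> 'n ext" where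
  "grad S \<theta> u q = (\<Sum>b\<in>UNIV. XV S b u q *\<^sub>R \<theta> b)"

lemma Ck_on_2_Suc: "Ck_on 2 f U \<longleftrightarrow> Ck_on (Suc (Suc 0)) f U"
  by (simp only: numeral_2_eq_2)

lemma Ck_on_1_Suc: "Ck_on 1 f U \<longleftrightarrow> Ck_on (Suc 0) f U"
  by (simp only: One_nat_def)

lemma Ck_on_XV_XV: "open U \<Longrightarrow> Ck_on (Suc (Suc k)) u U \<Longrightarrow> Ck_on k (XV S a (XV S b u)) U"
  by (intro Ck_on_XV)

lemma Ck_on_scaleR_const: "open U \<Longrightarrow> Ck_on k f U \<Longrightarrow> Ck_on k (\<lambda>q. f q *\<^sub>R c) U"
  by (rule bounded_linear.Ck_on_linear[OF bounded_linear_scaleR_left])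

lemma Ck_on_hess: "open U \<Longrightarrow> Ck_on (Suc (Suc k)) u U \<Longrightarrow> Ck_on k (hess S \<theta> \<theta>' u) U"
  unfolding hess_def[abs_def] by (intro Ck_on_sum Ck_on_scaleR_const Ck_on_XV_XV)

lemma Ck_on_grad: "open U \<Longrightarrow> Ck_on (Suc k) u U \<Longrightarrow> Ck_on k (grad S \<theta> u) U"
  unfolding grad_def[abs_def] by (intro Ck_on_sum Ck_on_scaleR_const Ck_on_XV)

lemma XV_scaleR_const:
  assumes "f differentiable (at q)"
  shows "XV S b (\<lambda>q. f q *\<^sub>R c) q = XV S b f q *\<^sub>R c"
  by (rule XV_linear[OF bounded_linear_scaleR_left assms])

lemma differentiable_scaleR_const:
  fixes f :: "'a::euclidean_space \<Rightarrow> real"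
  shows "f differentiable (at q) \<Longrightarrow> (\<lambda>q. f q *\<^sub>R c) differentiable (at q)"
  by (rule bounded_linear.differentiable_linear[OF bounded_linear_scaleR_left])

lemma dform_cong:
  assumes "open U" "q \<in> U" "\<And>y. y \<in> U \<Longrightarrow> F y = G y"
  shows "dform \<theta> S F q = dform \<theta> S G q"
  unfolding dform_def using XV_cong[OF assms] by simp

lemma dform_grad:
  assumes "open U" "q \<in> U" "Ck_on 2 u U"
  shows "dform \<theta> S (grad S \<theta>' u) q = hess S \<theta> \<theta>' u q"
proof -
  have u: "Ck_on (Suc (Suc 0)) u U" using assms(3) by (simp only: Ck_on_2_Suc)
  have d: "XV S b u differentiable (at q)" for b
    by (rule Ck_on_imp_differentiable[OF Ck_on_XV[OF assms(1) u] assms(2)])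
  have "XV S a (grad S \<theta>' u) q = (\<Sum>b\<in>UNIV. XV S a (XV S b u) q *\<^sub>R \<theta>' b)" for a
    unfolding grad_def[abs_def]
    by (simp add: XV_sum[OF differentiable_scaleR_const[OF d]] XV_scaleR_const[OF d])
  then show ?thesis
    by (simp add: dform_def hess_def wedge_sum_right wedge.scaleR_right)
qed

text \<open>Reversing the two fields costs the commutator, whose coefficients contract to
  \<open>sform (B_mat S \<beta>)\<close>; reversing the covectors costs a sign.\<close>

lemma hess_swap:
  fixes u :: "'n::{finite,linorder} grp \<Rightarrow> real"
  assumes S: "transpose S = S" and U: "open U" "q \<in> U" "Ck_on 2 u U"
    and \<theta>: "\<And>a. odd_ext (\<theta> a)" "\<And>a. odd_ext (\<theta>' a)"
    and B: "\<And>\<beta>. sform (B_mat S \<beta>) \<theta> \<theta>' = 0"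
  shows "hess S \<theta> \<theta>' u q = - hess S \<theta>' \<theta> u q"
proof -
  have "hess S \<theta> \<theta>' u q - (\<Sum>a\<in>UNIV. \<Sum>b\<in>UNIV. XV S b (XV S a u) q *\<^sub>R (\<theta> a \<curlywedge> \<theta>' b))
      = (\<Sum>a\<in>UNIV. \<Sum>b\<in>UNIV. \<Sum>\<beta>\<in>UNIV. (4 * B_mat S \<beta> $ a $ b * dird (t_vec \<beta>) u q) *\<^sub>R (\<theta> a \<curlywedge> \<theta>' b))"
    unfolding hess_def sum_subtractf[symmetric] scaleR_left_diff_distrib[symmetric] scaleR_left.sum[symmetric]
      XV_commutator[OF S U] ..
  also have "\<dots> = (\<Sum>a\<in>UNIV. \<Sum>\<beta>\<in>UNIV. \<Sum>b\<in>UNIV. (4 * B_mat S \<beta> $ a $ b * dird (t_vec \<beta>) u q) *\<^sub>R (\<theta> a \<curlywedge> \<theta>' b))"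
    by (rule sum.cong[OF refl]) (rule sum.swap)
  also have "\<dots> = (\<Sum>\<beta>\<in>UNIV. \<Sum>a\<in>UNIV. \<Sum>b\<in>UNIV. (4 * B_mat S \<beta> $ a $ b * dird (t_vec \<beta>) u q) *\<^sub>R (\<theta> a \<curlywedge> \<theta>' b))"
    by (rule sum.swap)
  also have "\<dots> = (\<Sum>\<beta>\<in>UNIV. (4 * dird (t_vec \<beta>) u q) *\<^sub>R sform (B_mat S \<beta>) \<theta> \<theta>')"
    unfolding sform_def scaleR_right.sum by (simp add: mult_ac)
  finally have "hess S \<theta> \<theta>' u q = (\<Sum>a\<in>UNIV. \<Sum>b\<in>UNIV. XV S b (XV S a u) q *\<^sub>R (\<theta> a \<curlywedge> \<theta>' b))"
    by (simp add: B)
  also have "\<dots> = (\<Sum>a\<in>UNIV. \<Sum>b\<in>UNIV. XV S b (XV S a u) q *\<^sub>R - (\<theta>' b \<curlywedge> \<theta> a))"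
    by (intro sum.cong refl arg_cong2[where f=scaleR] odd_ext_anticommute \<theta>)
  also have "\<dots> = (\<Sum>b\<in>UNIV. \<Sum>a\<in>UNIV. XV S b (XV S a u) q *\<^sub>R - (\<theta>' b \<curlywedge> \<theta> a))"
    by (rule sum.swap)
  finally show ?thesis by (simp add: hess_def sum_negf)
qed

context
  fixes S :: "real ^ ('n::{finite,linorder} \<times> 4) ^ ('n \<times> 4)"
  assumes S: "transpose S = S" "right_type S"
begin

lemma hess_same_eq_0:
  assumes "open U" "q \<in> U" "Ck_on 2 u U" "\<theta> \<in> {theta0, theta1}"
  shows "hess S \<theta> \<theta> u q = 0"
proof -
  have "hess S \<theta> \<theta> u q = - hess S \<theta> \<theta> u q"
    using assms(4) by (intro hess_swap[OF S(1) assms(1-3)]) (auto simp: odd_theta sform_B_mat_eq_0[OF S])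
  then show ?thesis
    unfolding eq_neg_iff_add_eq_0 by (simp add: vec_eq_iff)
qed

lemma hess_theta_swap:
  assumes "open U" "q \<in> U" "Ck_on 2 u U"
  shows "hess S theta1 theta0 u q = - hess S theta0 theta1 u q"
  by (intro hess_swap[OF S(1) assms]) (auto simp: odd_theta sform_B_mat_eq_0[OF S])

text \<open>Among three operators chosen from two, one is repeated, and anticommutation brings its
  two copies together.\<close>

lemma dform_hess_eq_0:
  assumes U: "open U" "q \<in> U" "Ck_on 3 u U" and \<theta>: "\<theta> \<in> {theta0, theta1}"
  shows "dform \<theta> S (hess S theta0 theta1 u) q = 0"
proof -
  have u3: "Ck_on (Suc (Suc (Suc 0))) u U" using U(3) by (simp only: numeral_3_eq_3)
  have u2: "Ck_on 2 u U" using U(3) by (rule Ck_on_le) simp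
  have X2: "Ck_on 2 (XV S b u) U" for b
    unfolding Ck_on_2_Suc by (rule Ck_on_XV[OF U(1) u3])
  have d: "XV S a (XV S b u) differentiable (at q)" for a b
    using Ck_on_XV_XV[OF U(1) u3] U(2) by (rule Ck_on_imp_differentiable)
  \<comment> \<open>Regrouping around the innermost field lets the second-order identities act on
    the functions X_b u, which are still C^2.\<close>
  have expand: "dform \<rho> S (hess S \<theta>1 \<theta>2 u) q = (\<Sum>b\<in>UNIV. hess S \<rho> \<theta>1 (XV S b u) q \<curlywedge> \<theta>2 b)" for \<rho> \<theta>1 \<theta>2
  proof -
    have "XV S c (hess S \<theta>1 \<theta>2 u) q = (\<Sum>a\<in>UNIV. \<Sum>b\<in>UNIV. XV S c (XV S a (XV S b u)) q *\<^sub>R (\<theta>1 a \<curlywedge> \<theta>2 b))" for c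
    proof -
      have dd: "(\<lambda>q. \<Sum>b\<in>UNIV. XV S a (XV S b u) q *\<^sub>R (\<theta>1 a \<curlywedge> \<theta>2 b)) differentiable (at q)" for a
        by (intro differentiable_sum ballI finite differentiable_scaleR_const d)
      show ?thesis
        unfolding hess_def[abs_def]
        by (simp add: XV_sum[OF dd] XV_sum[OF differentiable_scaleR_const[OF d]] XV_scaleR_const[OF d])
    qed
    then have "dform \<rho> S (hess S \<theta>1 \<theta>2 u) q
        = (\<Sum>c\<in>UNIV. \<Sum>a\<in>UNIV. \<Sum>b\<in>UNIV. XV S c (XV S a (XV S b u)) q *\<^sub>R (\<rho> c \<curlywedge> \<theta>1 a \<curlywedge> \<theta>2 b))"
      by (simp add: dform_def wedge_sum_right wedge.scaleR_right)
    also have "\<dots> = (\<Sum>c\<in>UNIV. \<Sum>b\<in>UNIV. \<Sum>a\<in>UNIV. XV S c (XV S a (XV S b u)) q *\<^sub>R (\<rho> c \<curlywedge> \<theta>1 a \<curlywedge> \<theta>2 b))"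
      by (rule sum.cong[OF refl]) (rule sum.swap)
    also have "\<dots> = (\<Sum>b\<in>UNIV. \<Sum>c\<in>UNIV. \<Sum>a\<in>UNIV. XV S c (XV S a (XV S b u)) q *\<^sub>R (\<rho> c \<curlywedge> \<theta>1 a \<curlywedge> \<theta>2 b))"
      by (rule sum.swap)
    also have "\<dots> = (\<Sum>b\<in>UNIV. hess S \<rho> \<theta>1 (XV S b u) q \<curlywedge> \<theta>2 b)"
      by (simp add: hess_def wedge_sum_left wedge.scaleR_left wedge_assoc)
    finally show ?thesis .
  qed
  show ?thesis
  proof (cases "\<theta> = theta0")
    case True
    then show ?thesis
      unfolding expand using hess_same_eq_0[OF U(1,2) X2] by simp
  next
    case False
    then have t: "\<theta> = theta1" using \<theta> by simp
    \<comment> \<open>Anticommutation moves the two copies of d1 next to each other; d1 d1 u then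
      vanishes on all of U, hence so does its image under d0.\<close>
    have "dform theta1 S (hess S theta0 theta1 u) q = - (\<Sum>b\<in>UNIV. hess S theta0 theta1 (XV S b u) q \<curlywedge> theta1 b)"
      unfolding expand by (simp add: hess_theta_swap[OF U(1,2) X2] wedge_minus_left sum_negf)
    also have "\<dots> = - dform theta0 S (hess S theta1 theta1 u) q"
      unfolding expand ..
    also have "dform theta0 S (hess S theta1 theta1 u) q = dform theta0 S (\<lambda>_. 0) q"
      using hess_same_eq_0[OF U(1) _ u2] by (intro dform_cong[OF U(1,2)]) simp
    also have "\<dots> = 0"
      by (simp add: dform_def XV_def)
    finally show ?thesis using t by simp
  qed
qed

end

lemma Ck_on_dform:
  assumes "open U" "Ck_on (Suc k) F U"
  shows "Ck_on k (dform \<theta> S F) U"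
  unfolding dform_def[abs_def]
  by (intro Ck_on_sum assms(1) bounded_linear.Ck_on_linear[OF wedge.bounded_linear_right] Ck_on_XV[OF assms])

lemma even_hess:
  assumes "\<And>a. odd_ext (\<theta> a)" "\<And>a. odd_ext (\<theta>' a)"
  shows "even_ext (hess S \<theta> \<theta>' u q)"
  unfolding hess_def by (intro even_ext_sum even_ext_scaleR odd_odd_wedge assms)

lemma dform_zero_off:
  assumes "closed Q" "\<And>x. x \<notin> Q \<Longrightarrow> F x = 0" "x \<notin> Q"
  shows "dform \<theta> S F x = 0"
  unfolding dform_def using XV_zero_off[OF assms] by simp

text \<open>The covectors of the operator pass an even factor without a sign.\<close>

lemma dform_wedge_even:
  assumes "G differentiable (at q)" "w differentiable (at q)" "even_ext (G q)"
  shows "dform \<theta> S (\<lambda>q. G q \<curlywedge> w q) q = G q \<curlywedge> dform \<theta> S w q + dform \<theta> S G q \<curlywedge> w q"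
proof -
  have "\<theta> b \<curlywedge> XV S b (\<lambda>q. G q \<curlywedge> w q) q = G q \<curlywedge> (\<theta> b \<curlywedge> XV S b w q) + (\<theta> b \<curlywedge> XV S b G q) \<curlywedge> w q" for b
    unfolding XV_prod[OF bounded_bilinear_wedge assms(1,2)]
    by (simp add: wedge_add_right wedge_assoc even_ext_left_commute[OF assms(3)])
  then show ?thesis
    by (simp add: dform_def sum.distrib wedge_sum_left wedge_sum_right)
qed

lemma dform_scaleR:
  assumes "f differentiable (at q)" "F differentiable (at q)"
  shows "dform \<theta> S (\<lambda>q. f q *\<^sub>R F q) q = f q *\<^sub>R dform \<theta> S F q + grad S \<theta> f q \<curlywedge> F q"
proof -
  have "\<theta> b \<curlywedge> XV S b (\<lambda>q. f q *\<^sub>R F q) q = f q *\<^sub>R (\<theta> b \<curlywedge> XV S b F q) + (XV S b f q *\<^sub>R \<theta> b) \<curlywedge> F q" for b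
    unfolding XV_prod[OF bounded_bilinear_scaleR assms]
    by (simp add: wedge_add_right wedge.scaleR_right wedge.scaleR_left)
  then show ?thesis
    by (simp add: dform_def grad_def sum.distrib wedge_sum_left scaleR_right.sum)
qed

section \<open>Weakly closed forms\<close>

text \<open>The test forms are only C^1, because the proofs insert a C^2 cutoff times d1 u, or the
  second-order form of a C^3 function times another test form.\<close>

definition weakly_closed :: "real ^ ('n::{finite,linorder} \<times> 4) ^ ('n \<times> 4) \<Rightarrow> 'n grp set \<Rightarrow>
    ('n grp \<Rightarrow> 'n ext) \<Rightarrow> bool" where
  "weakly_closed S \<Omega> T \<longleftrightarrow> (\<forall>\<theta>\<in>{theta0, theta1}. \<forall>w Q. compact Q \<longrightarrow> Q \<subseteq> \<Omega> \<longrightarrow> (\<forall>q. q \<notin> Q \<longrightarrow> w q = 0) \<longrightarrow>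
     Ck_on 1 w UNIV \<longrightarrow> (LINT q|lborel. top_coeff (dform \<theta> S w q \<curlywedge> T q)) = 0)"

lemma continuous_on_top_coeff_wedge:
  assumes "continuous_on A F" "continuous_on A G"
  shows "continuous_on A (\<lambda>q. top_coeff (F q \<curlywedge> G q))"
  by (intro bounded_linear.continuous_on[OF bounded_linear_top_coeff] wedge.continuous_on assms)

lemma integrable_top_coeff_wedge:
  assumes "compact Q" "continuous_on Q F" "continuous_on Q G" "\<And>q. q \<notin> Q \<Longrightarrow> F q = 0"
  shows "integrable lborel (\<lambda>q. top_coeff (F q \<curlywedge> G q))"
  by (rule integrable_continuous_compact_support[OF assms(1) continuous_on_top_coeff_wedge[OF assms(2,3)]])
    (simp add: assms(4))

text \<open>With constant coefficients the integrand is a sum of derivatives of compactly supported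
  functions along divergence-free fields.\<close>

lemma weakly_closed_const:
  fixes S :: "real ^ ('n::{finite,linorder} \<times> 4) ^ ('n \<times> 4)"
  shows "weakly_closed S \<Omega> (\<lambda>q. \<eta>)"
  unfolding weakly_closed_def
proof (intro ballI allI impI)
  fix \<theta> :: "'n \<times> 4 \<Rightarrow> 'n ext" and w :: "'n grp \<Rightarrow> 'n ext" and Q
  assume Q: "compact Q" "\<forall>q. q \<notin> Q \<longrightarrow> w q = 0" and w: "Ck_on 1 w UNIV"
  have w1: "Ck_on (Suc 0) w UNIV" using w by (simp only: Ck_on_1_Suc)
  define h where "h b x = top_coeff ((\<theta> b \<curlywedge> x) \<curlywedge> \<eta>)" for b x
  have h: "bounded_linear (h b)" for b
    unfolding h_def[abs_def]
    by (intro bounded_linear_compose[OF bounded_linear_top_coeff] bounded_linear_compose[OF wedge.bounded_linear_left]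
        wedge.bounded_linear_right)
  have C: "Ck_on 1 (\<lambda>q. h b (w q)) UNIV" for b
    by (rule bounded_linear.Ck_on_linear[OF h open_UNIV w])
  have off: "h b (w q) = 0" if "q \<notin> Q" for b q
    using Q(2)[rule_format, OF that] linear_simps(3)[OF h] by (simp only:)
  have eq: "top_coeff (dform \<theta> S w q \<curlywedge> \<eta>) = (\<Sum>b\<in>UNIV. XV S b (\<lambda>q. h b (w q)) q)" for q
    using XV_linear[OF h Ck_on_imp_differentiable[OF w1 UNIV_I]]
    by (simp add: dform_def wedge_sum_left top_coeff_sum h_def)
  have int: "integrable lborel (XV S b (\<lambda>q. h b (w q)))" for b
  proof (rule integrable_continuous_compact_support[OF Q(1)])
    have "continuous_on UNIV (XV S b (\<lambda>q. h b (w q)))"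
      using Ck_on_XV[OF open_UNIV C[unfolded Ck_on_1_Suc]] by (rule Ck_on_continuous)
    then show "continuous_on Q (XV S b (\<lambda>q. h b (w q)))"
      by (rule continuous_on_subset) simp
  qed (rule XV_zero_off[OF compact_imp_closed[OF Q(1)] off])
  show "(LINT q|lborel. top_coeff (dform \<theta> S w q \<curlywedge> \<eta>)) = 0"
    unfolding eq by (simp add: Bochner_Integration.integral_sum[OF int] integral_XV_eq_0[OF C Q(1) off])
qed

text \<open>The factor after \<open>e\<close> is an explicit continuous function of
  \<open>q\<close>, independent of \<open>g\<close>, so that it can be integrated over a compact
  set.\<close>

lemma XV_XV_diff_bound:
  fixes u g :: "'n::finite grp \<Rightarrow> real"
  assumes U: "open U" "q \<in> U" "Ck_on 2 u U" and V: "open V" "q \<in> V" "Ck_on 2 g V"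
    and e1: "\<And>v. v \<in> range x_vec \<union> range t_vec \<Longrightarrow> \<bar>dird v g q - dird v u q\<bar> \<le> e"
    and e2: "\<And>v w. v \<in> range x_vec \<union> range t_vec \<Longrightarrow> w \<in> range x_vec \<union> range t_vec \<Longrightarrow> \<bar>dird v (dird w g) q - dird v (dird w u) q\<bar> \<le> e"
  shows "\<bar>XV S a (XV S b g) q - XV S a (XV S b u) q\<bar> \<le> e * (1 + (\<Sum>\<beta>\<in>UNIV. \<bar>t_coeff S \<beta> b q\<bar>)
    + (\<Sum>\<beta>\<in>UNIV. \<bar>2 * B_mat S \<beta> $ a $ b\<bar>) + (\<Sum>\<gamma>\<in>UNIV. \<bar>t_coeff S \<gamma> a q\<bar>)
    + (\<Sum>\<gamma>\<in>UNIV. \<Sum>\<beta>\<in>UNIV. \<bar>t_coeff S \<gamma> a q * t_coeff S \<beta> b q\<bar>))"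
proof -
  have sb: "\<bar>(\<Sum>i\<in>A. c i * x i) - (\<Sum>i\<in>A. c i * y i)\<bar> \<le> e * (\<Sum>i\<in>A. \<bar>c i\<bar>)"
    if "\<And>i. \<bar>x i - y i\<bar> \<le> e" for c x y :: "'i \<Rightarrow> real" and A
  proof -
    have "\<bar>(\<Sum>i\<in>A. c i * x i) - (\<Sum>i\<in>A. c i * y i)\<bar> = \<bar>\<Sum>i\<in>A. c i * (x i - y i)\<bar>"
      by (simp add: sum_subtractf right_diff_distrib)
    also have "\<dots> \<le> (\<Sum>i\<in>A. \<bar>c i * (x i - y i)\<bar>)" by (rule sum_abs)
    also have "\<dots> \<le> (\<Sum>i\<in>A. \<bar>c i\<bar> * e)"
      using that by (intro sum_mono) (simp add: abs_mult mult_left_mono)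
    finally show ?thesis by (simp add: sum_distrib_left mult.commute)
  qed
  have ee: "\<bar>dird (x_vec a) (dird (x_vec b) g) q - dird (x_vec a) (dird (x_vec b) u) q\<bar> \<le> e"
    by (intro e2) auto
  have 1: "\<bar>(\<Sum>\<beta>\<in>UNIV. t_coeff S \<beta> b q * dird (x_vec a) (dird (t_vec \<beta>) g) q) - (\<Sum>\<beta>\<in>UNIV. t_coeff S \<beta> b q * dird (x_vec a) (dird (t_vec \<beta>) u) q)\<bar>
      \<le> e * (\<Sum>\<beta>\<in>UNIV. \<bar>t_coeff S \<beta> b q\<bar>)"
    by (intro sb e2) auto
  have 2: "\<bar>(\<Sum>\<beta>\<in>UNIV. 2 * B_mat S \<beta> $ a $ b * dird (t_vec \<beta>) g q) - (\<Sum>\<beta>\<in>UNIV. 2 * B_mat S \<beta> $ a $ b * dird (t_vec \<beta>) u q)\<bar>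
      \<le> e * (\<Sum>\<beta>\<in>UNIV. \<bar>2 * B_mat S \<beta> $ a $ b\<bar>)"
    by (intro sb e1) auto
  have 3: "\<bar>(\<Sum>\<gamma>\<in>UNIV. t_coeff S \<gamma> a q * dird (t_vec \<gamma>) (dird (x_vec b) g) q) - (\<Sum>\<gamma>\<in>UNIV. t_coeff S \<gamma> a q * dird (t_vec \<gamma>) (dird (x_vec b) u) q)\<bar>
      \<le> e * (\<Sum>\<gamma>\<in>UNIV. \<bar>t_coeff S \<gamma> a q\<bar>)"
    by (intro sb e2) auto
  have pair: "(\<Sum>\<gamma>\<in>UNIV. \<Sum>\<beta>\<in>UNIV. f \<gamma> \<beta>) = (\<Sum>p\<in>UNIV \<times> UNIV. f (fst p) (snd p))" for f :: "3 \<Rightarrow> 3 \<Rightarrow> real"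
    by (simp add: sum.cartesian_product split_beta)
  have 4: "\<bar>(\<Sum>\<gamma>\<in>UNIV. \<Sum>\<beta>\<in>UNIV. (t_coeff S \<gamma> a q * t_coeff S \<beta> b q) * dird (t_vec \<gamma>) (dird (t_vec \<beta>) g) q)
       - (\<Sum>\<gamma>\<in>UNIV. \<Sum>\<beta>\<in>UNIV. (t_coeff S \<gamma> a q * t_coeff S \<beta> b q) * dird (t_vec \<gamma>) (dird (t_vec \<beta>) u) q)\<bar>
      \<le> e * (\<Sum>\<gamma>\<in>UNIV. \<Sum>\<beta>\<in>UNIV. \<bar>t_coeff S \<gamma> a q * t_coeff S \<beta> b q\<bar>)"
    unfolding pair by (intro sb e2) auto
  show ?thesis
    unfolding XV_XV_expand[OF U] XV_XV_expand[OF V] distrib_left mult_1_right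
    using ee 1 2 3 4 unfolding mult.assoc by linarith
qed

lemma le_all_eps_imp_zero:
  fixes x C :: real
  assumes "0 \<le> C" "\<And>e. 0 < e \<Longrightarrow> x \<le> e * C"
  shows "x \<le> 0"
proof (rule ccontr)
  assume "\<not> x \<le> 0"
  then have x: "x > 0" by simp
  have "x \<le> (x / (2 * (C + 1))) * C"
    using x assms(1) by (intro assms(2)) simp
  also have "\<dots> < x"
    using x assms(1) by (simp add: field_simps add_nonneg_pos)
  finally show False by simp
qed

lemma continuous_on_XV_XV:
  assumes "open U" "Ck_on 2 u U" "Q \<subseteq> U"
  shows "continuous_on Q (XV S a (XV S b u))"
  using Ck_on_continuous[OF Ck_on_XV_XV[OF assms(1) assms(2)[unfolded Ck_on_2_Suc]]] assms(3)
  by (rule continuous_on_subset)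

lemma continuous_on_t_coeff: "continuous_on A (t_coeff S \<beta> b)"
  by (rule linear_continuous_on) (rule bounded_linear_t_coeff)

lemma norm_lborel_integral_le:
  fixes f :: "'a::euclidean_space \<Rightarrow> 'b::{banach, second_countable_topology}"
  assumes "integrable lborel f" "integrable lborel g" "\<And>x. norm (f x) \<le> g x"
  shows "norm (LINT x|lborel. f x) \<le> (LINT x|lborel. g x)"
proof -
  have "norm (LINT x|lborel. f x) \<le> (LINT x|lborel. norm (f x))"
    by (rule Bochner_Integration.integral_norm_bound)
  also have "\<dots> \<le> (LINT x|lborel. g x)"
    using assms by (intro Bochner_Integration.integral_mono) auto
  finally show ?thesis .
qed

lemma weakly_closedD:
  assumes "weakly_closed S \<Omega> T" "\<theta> \<in> {theta0, theta1}" "compact Q" "Q \<subseteq> \<Omega>" "\<And>q. q \<notin> Q \<Longrightarrow> w q = 0" "Ck_on 1 w UNIV"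
  shows "(LINT q|lborel. top_coeff (dform \<theta> S w q \<curlywedge> T q)) = 0"
  using assms unfolding weakly_closed_def by blast

text \<open>For a C^3 function \<open>g\<close> near Q the even closed factor \<open>hess g\<close>
  can be absorbed into the test form. Replacing \<open>u\<close> by \<open>g\<close> costs at most
  \<open>e\<close> times a fixed integral.\<close>

lemma weakly_closed_hess:
  fixes S :: "real ^ ('n::{finite,linorder} \<times> 4) ^ ('n \<times> 4)"
  assumes S: "transpose S = S" "right_type S" and \<Omega>: "open \<Omega>" and u: "Ck_on 2 u \<Omega>"
    and T: "continuous_on \<Omega> T" "weakly_closed S \<Omega> T"
  shows "weakly_closed S \<Omega> (\<lambda>q. hess S theta0 theta1 u q \<curlywedge> T q)"
  unfolding weakly_closed_def
proof (intro ballI allI impI)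
  fix \<theta> and w :: "'n grp \<Rightarrow> 'n ext" and Q :: "'n grp set"
  assume \<theta>: "\<theta> \<in> {theta0, theta1 :: 'n \<times> 4 \<Rightarrow> 'n ext}" and Q: "compact Q" "Q \<subseteq> \<Omega>"
    and w0: "\<forall>q. q \<notin> Q \<longrightarrow> w q = 0" and w: "Ck_on 1 w UNIV"
  have clQ: "closed Q" using Q(1) by (rule compact_imp_closed)
  have w0': "w q = 0" if "q \<notin> Q" for q using w0 that by blast
  have w1: "Ck_on (Suc 0) w UNIV" using w by (simp only: Ck_on_1_Suc)
  define F where "F = dform \<theta> S w"
  have cF: "continuous_on A F" for A
    using Ck_on_continuous[OF Ck_on_dform[OF open_UNIV w1]] unfolding F_def by (rule continuous_on_subset) simp
  have F0: "F q = 0" if "q \<notin> Q" for q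
    unfolding F_def by (rule dform_zero_off[OF clQ w0' that])
  define k where "k a b q = top_coeff (F q \<curlywedge> (theta0 a \<curlywedge> theta1 b) \<curlywedge> T q)" for a b q
  have ck: "continuous_on Q (k a b)" for a b
    unfolding k_def
    by (intro continuous_on_top_coeff_wedge wedge.continuous_on cF continuous_on_const continuous_on_subset[OF T(1) Q(2)])
  have k0: "k a b q = 0" if "q \<notin> Q" for a b q
    using F0[OF that] by (simp add: k_def)
  have expand: "top_coeff (F q \<curlywedge> hess S theta0 theta1 v q \<curlywedge> T q) = (\<Sum>a\<in>UNIV. \<Sum>b\<in>UNIV. XV S a (XV S b v) q *\<^sub>R k a b q)" for v q
    by (simp add: hess_def wedge_sum_left wedge_sum_right wedge.scaleR_left wedge.scaleR_right top_coeff_sum top_coeff_scaleR k_def)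
  have int: "integrable lborel (\<lambda>q. top_coeff (F q \<curlywedge> hess S theta0 theta1 v q \<curlywedge> T q))"
    if "open U" "Ck_on 2 v U" "Q \<subseteq> U" for v U
  proof (rule integrable_top_coeff_wedge[OF Q(1) cF _ F0])
    have "continuous_on Q (hess S theta0 theta1 v)"
      using Ck_on_continuous[OF Ck_on_hess[OF that(1) that(2)[unfolded Ck_on_2_Suc]]] that(3) by (rule continuous_on_subset)
    then show "continuous_on Q (\<lambda>q. hess S theta0 theta1 v q \<curlywedge> T q)"
      by (intro wedge.continuous_on continuous_on_subset[OF T(1) Q(2)])
  qed
  define m where "m a b q = 1 + (\<Sum>\<beta>\<in>UNIV. \<bar>t_coeff S \<beta> b q\<bar>)
    + (\<Sum>\<beta>\<in>UNIV. \<bar>2 * B_mat S \<beta> $ a $ b\<bar>) + (\<Sum>\<gamma>\<in>UNIV. \<bar>t_coeff S \<gamma> a q\<bar>)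
    + (\<Sum>\<gamma>\<in>UNIV. \<Sum>\<beta>\<in>UNIV. \<bar>t_coeff S \<gamma> a q * t_coeff S \<beta> b q\<bar>)" for a b q
  have cm: "continuous_on Q (m a b)" for a b
    unfolding m_def by (intro continuous_intros continuous_on_t_coeff)
  have m0: "0 \<le> m a b q" for a b q
    unfolding m_def by (intro add_nonneg_nonneg sum_nonneg) auto
  \<comment> \<open>A majorant of the error per unit of \<open>e\<close>, fixed before the
    approximation \<open>g\<close> is chosen.\<close>
  define h where "h q = (\<Sum>a\<in>UNIV. \<Sum>b\<in>UNIV. m a b q * cmod (k a b q))" for q
  have ih: "integrable lborel h"
    by (rule integrable_continuous_compact_support[OF Q(1)])
      (auto simp: h_def k0 intro!: continuous_intros cm ck)
  define C where "C = (LINT q|lborel. h q)"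
  have "0 \<le> C"
    unfolding C_def h_def by (intro Bochner_Integration.integral_nonneg sum_nonneg mult_nonneg_nonneg m0) auto
  have "cmod (LINT q|lborel. top_coeff (F q \<curlywedge> hess S theta0 theta1 u q \<curlywedge> T q)) \<le> 0"
  proof (rule le_all_eps_imp_zero[OF \<open>0 \<le> C\<close>])
    fix e :: real assume "0 < e"
    have fin: "finite (range x_vec \<union> range t_vec :: 'n grp set)" by simp
    obtain U g where U: "open U" "Q \<subseteq> U" "U \<subseteq> \<Omega>" and g: "Ck_on 3 g U"
      and near1: "\<And>x v. x \<in> Q \<Longrightarrow> v \<in> range x_vec \<union> range t_vec \<Longrightarrow> \<bar>dird v g x - dird v u x\<bar> \<le> e"
      and near2: "\<And>x v w. x \<in> Q \<Longrightarrow> v \<in> range x_vec \<union> range t_vec \<Longrightarrow> w \<in> range x_vec \<union> range t_vec \<Longrightarrow>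
        \<bar>dird v (dird w g) x - dird v (dird w u) x\<bar> \<le> e"
      using C3_approximation[OF \<Omega> Q u fin \<open>0 < e\<close>] by blast
    have g3: "Ck_on (Suc (Suc 1)) g U" using g by (simp only: numeral_3_eq_3 One_nat_def)
    have g2: "Ck_on 2 g U" using g by (rule Ck_on_le) simp
    \<comment> \<open>\<open>g\<close> is regular only on U, but \<open>w\<close> vanishes off Q, so
      the product is C^1 everywhere.\<close>
    define w' where "w' q = hess S theta0 theta1 g q \<curlywedge> w q" for q
    have "Ck_on 1 w' U"
      unfolding w'_def[abs_def]
      by (intro bounded_bilinear.Ck_on_prod[OF bounded_bilinear_wedge U(1)] Ck_on_hess U(1) g3 Ck_on_subset[OF w]) simp
    then have w': "Ck_on 1 w' UNIV"
      by (rule Ck_on_zero_extension[OF U(1) clQ U(2), rotated]) (simp add: w'_def w0')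
    have "dform \<theta> S w' q \<curlywedge> T q = F q \<curlywedge> hess S theta0 theta1 g q \<curlywedge> T q" for q
    proof (cases "q \<in> U")
      case True
      have "dform \<theta> S w' q = hess S theta0 theta1 g q \<curlywedge> F q + dform \<theta> S (hess S theta0 theta1 g) q \<curlywedge> w q"
        unfolding w'_def[abs_def] F_def
        using Ck_on_imp_differentiable[OF Ck_on_hess[OF U(1) g3[unfolded One_nat_def]] True] Ck_on_imp_differentiable[OF w1 UNIV_I]
        by (intro dform_wedge_even even_hess odd_theta)
      moreover have "even_ext (hess S theta0 theta1 g q)"
        by (intro even_hess odd_theta)
      ultimately show ?thesis
        using dform_hess_eq_0[OF S U(1) True g \<theta>] even_ext_commute[of "hess S theta0 theta1 g q" "F q"]
        by (simp flip: wedge_assoc)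
    next
      case False
      then have "q \<notin> Q" using U(2) by blast
      then show ?thesis
        using dform_zero_off[OF clQ, of w' q] F0 by (simp add: w'_def w0')
    qed
    then have "(LINT q|lborel. top_coeff (F q \<curlywedge> hess S theta0 theta1 g q \<curlywedge> T q))
        = (LINT q|lborel. top_coeff (dform \<theta> S w' q \<curlywedge> T q))" by simp
    also have "\<dots> = 0"
      by (rule weakly_closedD[OF T(2) \<theta> Q _ w']) (simp add: w'_def w0')
    finally have g0: "(LINT q|lborel. top_coeff (F q \<curlywedge> hess S theta0 theta1 g q \<curlywedge> T q)) = 0" .
    have "cmod (LINT q|lborel. top_coeff (F q \<curlywedge> hess S theta0 theta1 u q \<curlywedge> T q))
      = cmod (LINT q|lborel. top_coeff (F q \<curlywedge> hess S theta0 theta1 g q \<curlywedge> T q) - top_coeff (F q \<curlywedge> hess S theta0 theta1 u q \<curlywedge> T q))"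
      using Bochner_Integration.integral_diff[OF int[OF U(1) g2 U(2)] int[OF \<Omega> u Q(2)]] g0 by simp
    also have "\<dots> \<le> (LINT q|lborel. e * h q)"
    proof (rule norm_lborel_integral_le)
      show "cmod (top_coeff (F q \<curlywedge> hess S theta0 theta1 g q \<curlywedge> T q) - top_coeff (F q \<curlywedge> hess S theta0 theta1 u q \<curlywedge> T q)) \<le> e * h q" for q
      proof (cases "q \<in> Q")
        case True
        have "\<bar>XV S a (XV S b g) q - XV S a (XV S b u) q\<bar> \<le> e * m a b q" for a b
          unfolding m_def
          by (rule XV_XV_diff_bound[OF \<Omega> _ u U(1) _ g2]) (use True Q U near1 near2 in blast)+
        then have b: "cmod ((XV S a (XV S b g) q - XV S a (XV S b u) q) *\<^sub>R k a b q) \<le> e * (m a b q * cmod (k a b q))" for a b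
          by (simp add: mult.assoc[symmetric] mult_right_mono)
        have "top_coeff (F q \<curlywedge> hess S theta0 theta1 g q \<curlywedge> T q) - top_coeff (F q \<curlywedge> hess S theta0 theta1 u q \<curlywedge> T q)
            = (\<Sum>a\<in>UNIV. \<Sum>b\<in>UNIV. (XV S a (XV S b g) q - XV S a (XV S b u) q) *\<^sub>R k a b q)"
          unfolding expand by (simp add: sum_subtractf scaleR_left_diff_distrib)
        also have "cmod \<dots> \<le> (\<Sum>a\<in>UNIV. \<Sum>b\<in>UNIV. e * (m a b q * cmod (k a b q)))"
          by (intro sum_norm_le b)
        finally show ?thesis by (simp add: h_def sum_distrib_left)
      next
        case False
        then show ?thesis by (simp add: F0 h_def k0)
      qed
    qed (use ih in \<open>auto intro: Bochner_Integration.integrable_diff int[OF U(1) g2 U(2)] int[OF \<Omega> u Q(2)]\<close>)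
    also have "\<dots> = e * C" by (simp add: C_def)
    finally show "cmod (LINT q|lborel. top_coeff (F q \<curlywedge> hess S theta0 theta1 u q \<curlywedge> T q)) \<le> e * C" .
  qed
  then show "(LINT q|lborel. top_coeff (dform \<theta> S w q \<curlywedge> hess S theta0 theta1 u q \<curlywedge> T q)) = 0"
    by (simp add: F_def)
qed

lemma odd_grad:
  assumes "\<And>a. odd_ext (\<theta> a)"
  shows "odd_ext (grad S \<theta> u q)"
  unfolding grad_def scaleR_eq_vector_scale by (intro odd_ext_sum odd_ext_scale assms)

lemma grad_zero_off:
  assumes "closed Q" "\<And>x. x \<notin> Q \<Longrightarrow> f x = 0" "x \<notin> Q"
  shows "grad S \<theta> f x = 0"
  unfolding grad_def using XV_zero_off[OF assms] by simp

lemma hess_zero_off: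
  assumes "closed Q" "\<And>x. x \<notin> Q \<Longrightarrow> f x = 0" "x \<notin> Q"
  shows "hess S \<theta> \<theta>' f x = 0"
  unfolding hess_def using XV_zero_off[OF assms(1) XV_zero_off[OF assms(1,2)] assms(3)] by simp

text \<open>Both boundary terms vanish by weak closedness, applied to \<open>\<psi> d\<^sub>1u\<close> and to \<open>u d\<^sub>0\<psi>\<close>.\<close>

lemma hess_by_parts:
  fixes S :: "real ^ ('n::{finite,linorder} \<times> 4) ^ ('n \<times> 4)"
  assumes \<Omega>: "open \<Omega>" and Q: "compact Q" "Q \<subseteq> \<Omega>" and \<psi>: "Ck_on 2 \<psi> UNIV" "\<And>q. q \<notin> Q \<Longrightarrow> \<psi> q = 0"
    and u: "Ck_on 2 u \<Omega>" and T: "continuous_on \<Omega> T" "weakly_closed S \<Omega> T"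
  shows "(LINT q|lborel. \<psi> q *\<^sub>R top_coeff (hess S theta0 theta1 u q \<curlywedge> T q))
    = - (LINT q|lborel. u q *\<^sub>R top_coeff (hess S theta1 theta0 \<psi> q \<curlywedge> T q))"
proof -
  have clQ: "closed Q" using Q(1) by (rule compact_imp_closed)
  have u2: "Ck_on (Suc 1) u \<Omega>" "Ck_on (Suc (Suc 0)) u \<Omega>" using u by (simp_all only: Ck_on_2_Suc One_nat_def)
  have \<psi>2: "Ck_on (Suc 1) \<psi> UNIV" "Ck_on (Suc (Suc 0)) \<psi> UNIV" using \<psi>(1) by (simp_all only: Ck_on_2_Suc One_nat_def)
  have u1: "Ck_on 1 u \<Omega>" and \<psi>1: "Ck_on 1 \<psi> \<Omega>"
    using Ck_on_le[OF u] Ck_on_le[OF Ck_on_subset[OF \<psi>(1)]] by (metis one_le_numeral top_greatest)+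
  have gu: "Ck_on 1 (grad S theta1 u) \<Omega>" by (rule Ck_on_grad[OF \<Omega> u2(1)])
  have g\<psi>: "Ck_on 1 (grad S theta0 \<psi>) UNIV" by (rule Ck_on_grad[OF open_UNIV \<psi>2(1)])
  have g\<psi>0: "grad S theta0 \<psi> q = 0" and h\<psi>0: "hess S theta1 theta0 \<psi> q = 0" if "q \<notin> Q" for q
    using grad_zero_off[OF clQ \<psi>(2) that] hess_zero_off[OF clQ \<psi>(2) that] by auto
  have diff: "u differentiable (at q)" "grad S theta1 u differentiable (at q)" if "q \<in> \<Omega>" for q
    using Ck_on_imp_differentiable[OF u2(1) that] Ck_on_imp_differentiable[OF gu[unfolded Ck_on_1_Suc] that] by auto
  have diff\<psi>: "\<psi> differentiable (at q)" "grad S theta0 \<psi> differentiable (at q)" for q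
    using Ck_on_imp_differentiable[OF \<psi>2(1)] Ck_on_imp_differentiable[OF g\<psi>[unfolded Ck_on_1_Suc]] by auto
  define P where "P q = \<psi> q *\<^sub>R top_coeff (hess S theta0 theta1 u q \<curlywedge> T q)" for q
  \<comment> \<open>The cross term of first derivatives; it occurs in both applications of weak
    closedness and cancels.\<close>
  define R where "R q = top_coeff (grad S theta0 \<psi> q \<curlywedge> (grad S theta1 u q \<curlywedge> T q))" for q
  define V where "V q = u q *\<^sub>R top_coeff (hess S theta1 theta0 \<psi> q \<curlywedge> T q)" for q
  note cs = continuous_on_subset[OF Ck_on_continuous]
  have cT: "continuous_on Q T" by (rule continuous_on_subset[OF T(1) Q(2)])
  have iP: "integrable lborel P"
    by (rule integrable_continuous_compact_support[OF Q(1)])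
      (auto simp: P_def \<psi>(2) intro!: continuous_on_scaleR continuous_on_top_coeff_wedge cT
        cs[OF \<psi>(1)] cs[OF Ck_on_hess[OF \<Omega> u2(2)] Q(2)])
  have iR: "integrable lborel R"
    unfolding R_def
    by (rule integrable_top_coeff_wedge[OF Q(1) cs[OF g\<psi>] wedge.continuous_on[OF cs[OF gu Q(2)] cT] g\<psi>0]) auto
  have iV: "integrable lborel V"
    by (rule integrable_continuous_compact_support[OF Q(1)])
      (auto simp: V_def h\<psi>0 intro!: continuous_on_scaleR continuous_on_top_coeff_wedge cT
        cs[OF u Q(2)] cs[OF Ck_on_hess[OF open_UNIV \<psi>2(2)]])
  define w1 where "w1 q = \<psi> q *\<^sub>R grad S theta1 u q" for q
  have w1: "Ck_on 1 w1 UNIV"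
    by (rule Ck_on_zero_extension[OF \<Omega> clQ Q(2)])
      (auto simp: w1_def[abs_def] \<psi>(2) simp del: Ck_on.simps One_nat_def
        intro!: bounded_bilinear.Ck_on_prod[OF bounded_bilinear_scaleR \<Omega> \<psi>1 gu])
  have e1: "top_coeff (dform theta0 S w1 q \<curlywedge> T q) = P q + R q" for q
  proof (cases "q \<in> \<Omega>")
    case True
    then show ?thesis
      unfolding w1_def[abs_def] P_def R_def
      by (simp add: dform_scaleR[OF diff\<psi>(1) diff(2)] dform_grad[OF \<Omega> _ u] wedge_add_left wedge_assoc
          wedge.scaleR_left top_coeff_add top_coeff_scaleR)
  next
    case False
    then have "q \<notin> Q" using Q(2) by blast
    then show ?thesis
      using dform_zero_off[OF clQ, of w1 q] by (simp add: P_def R_def w1_def \<psi>(2) g\<psi>0)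
  qed
  define w2 where "w2 q = u q *\<^sub>R grad S theta0 \<psi> q" for q
  have w2: "Ck_on 1 w2 UNIV"
    by (rule Ck_on_zero_extension[OF \<Omega> clQ Q(2)])
      (auto simp: w2_def[abs_def] g\<psi>0 simp del: Ck_on.simps One_nat_def
        intro!: bounded_bilinear.Ck_on_prod[OF bounded_bilinear_scaleR \<Omega> u1 Ck_on_subset[OF g\<psi>]])
  have e2: "top_coeff (dform theta1 S w2 q \<curlywedge> T q) = V q - R q" for q
  proof (cases "q \<in> \<Omega>")
    case True
    \<comment> \<open>The two gradients are odd, and their anticommutation gives R the opposite
      sign.\<close>
    have "grad S theta1 u q \<curlywedge> grad S theta0 \<psi> q = - (grad S theta0 \<psi> q \<curlywedge> grad S theta1 u q)"
      by (intro odd_ext_anticommute odd_grad odd_theta)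
    with True show ?thesis
      unfolding w2_def[abs_def] V_def R_def
      by (simp add: dform_scaleR[OF diff(1) diff\<psi>(2)] dform_grad[OF open_UNIV _ \<psi>(1)] wedge_add_left wedge_minus_left
          wedge_assoc wedge.scaleR_left top_coeff_diff top_coeff_scaleR wedge_diff_left)
  next
    case False
    then have "q \<notin> Q" using Q(2) by blast
    then show ?thesis
      using dform_zero_off[OF clQ, of w2 q] by (simp add: V_def R_def w2_def h\<psi>0 g\<psi>0)
  qed
  have "(LINT q|lborel. P q + R q) = 0" "(LINT q|lborel. V q - R q) = 0"
    unfolding e1[symmetric] e2[symmetric]
    by (rule weakly_closedD[OF T(2) _ Q _ w1] weakly_closedD[OF T(2) _ Q _ w2];
        simp add: w1_def w2_def \<psi>(2) g\<psi>0)+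
  then have "(LINT q|lborel. P q) = - (LINT q|lborel. V q)"
    using iP iR iV by (simp add: eq_neg_iff_add_eq_0)
  then show ?thesis by (simp add: P_def V_def)
qed

section \<open>Pointwise positivity of the form of a plurisubharmonic function\<close>

lemma of_real_scale_ext_one: "of_real r *s v = r *\<^sub>R (v :: 'n::{finite,linorder} ext)"
  by (simp add: scaleR_eq_vector_scale)

lemma triangle_form_eq_hess:
  assumes "open \<Omega>" "Ck_on 2 u \<Omega>" "q \<in> \<Omega>"
  shows "triangle_form S u q = hess S theta0 theta1 u q"
proof -
  let ?E = "\<lambda>q. u q *\<^sub>R ext_one"
  have u2: "Ck_on (Suc 1) u \<Omega>" using assms(2) by (simp only: Ck_on_2_Suc One_nat_def)
  have du: "u differentiable (at r)" if "r \<in> \<Omega>" for r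
    by (rule Ck_on_imp_differentiable[OF u2 that])
  have 1: "d1 S ?E r = grad S theta1 u r" if "r \<in> \<Omega>" for r
    by (simp add: d1_eq_dform[OF differentiable_scaleR_const[OF du[OF that]]] dform_def grad_def
        XV_scaleR_const[OF du[OF that]] wedge.scaleR_right)
  have "Ck_on 1 (d1 S ?E) \<Omega>"
    by (rule Ck_on_cong[OF assms(1) _ Ck_on_grad[OF assms(1) u2]]) (simp add: 1)
  then have "d1 S ?E differentiable (at q)"
    unfolding Ck_on_1_Suc using assms(3) by (rule Ck_on_imp_differentiable)
  then have "triangle_form S u q = dform theta0 S (d1 S ?E) q"
    by (simp add: triangle_form_def of_real_scale_ext_one d0_eq_dform)
  also have "\<dots> = dform theta0 S (grad S theta1 u) q"
    by (rule dform_cong[OF assms(1,3) 1])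
  also have "\<dots> = hess S theta0 theta1 u q"
    by (rule dform_grad[OF assms(1,3,2)])
  finally show ?thesis .
qed

text \<open>If g were negative at q it would be negative on a ball, and a bump there would have a
  negative integral against g.\<close>

lemma nonneg_of_bump_integrals:
  fixes g :: "'a::euclidean_space \<Rightarrow> real"
  assumes \<Omega>: "open \<Omega>" "q \<in> \<Omega>" and g: "continuous_on \<Omega> g"
    and pos: "\<And>\<psi> Q. (\<And>m. Ck_on m \<psi> UNIV) \<Longrightarrow> (\<And>x. 0 \<le> \<psi> x) \<Longrightarrow> compact Q \<Longrightarrow> Q \<subseteq> \<Omega> \<Longrightarrow>
      (\<And>x. x \<notin> Q \<Longrightarrow> \<psi> x = 0) \<Longrightarrow> 0 \<le> (LINT x|lborel. \<psi> x * g x)"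
  shows "0 \<le> g q"
proof (rule ccontr)
  assume "\<not> 0 \<le> g q"
  then have neg: "g q < 0" by simp
  have "open (\<Omega> \<inter> g -` {..<0})"
    using continuous_open_preimage[OF g \<Omega>(1), of "{..<0}"] by simp
  moreover have "q \<in> \<Omega> \<inter> g -` {..<0}" using neg \<Omega>(2) by simp
  ultimately obtain r where r: "r > 0" "cball q r \<subseteq> \<Omega> \<inter> g -` {..<0}"
    by (meson open_contains_cball)
  obtain \<psi> :: "'a \<Rightarrow> real" where \<psi>: "\<And>m. Ck_on m \<psi> UNIV" "\<And>x. 0 \<le> \<psi> x" "\<And>x. x \<in> ball q r \<Longrightarrow> 0 < \<psi> x"
    "\<And>x. x \<notin> ball q r \<Longrightarrow> \<psi> x = 0"
    using exists_bump[OF r(1), of q] by metis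
  define f where "f x = \<psi> x * - g x" for x
  have off: "f x = 0" if "x \<notin> cball q r" for x
    using that \<psi>(4)[of x] by (simp add: f_def)
  have "Ck_on 0 f UNIV"
  proof (rule Ck_on_zero_extension[OF \<Omega>(1) closed_cball[of q r]])
    show "Ck_on 0 f \<Omega>"
      using Ck_on_continuous[OF \<psi>(1)] unfolding f_def Ck_on.simps
      by (intro continuous_intros g) (rule continuous_on_subset, auto)
  qed (use r off in auto)
  then have cf: "continuous_on UNIV f" by simp
  have "0 < (LINT x|lborel. f x)"
  proof (rule integral_bump_pos[OF r(1) cf])
    show "0 < f x" if "x \<in> ball q r" for x
      using \<psi>(3)[OF that] r(2) that by (auto simp: f_def mult_pos_neg subset_iff)
    then show "0 \<le> f x" for x
      using \<psi>(4)[of x] by (cases "x \<in> ball q r") (auto simp: f_def less_imp_le)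
  qed (simp add: f_def \<psi>(4))
  moreover have "0 \<le> (LINT x|lborel. \<psi> x * g x)"
    using r \<psi>(4) by (intro pos[OF \<psi>(1,2) compact_cball[of q r]]) auto
  ultimately show False by (simp add: f_def)
qed

lemma ext_degree_pullback: "ext_degree 1 (pullback a r)"
  unfolding pullback_def omega_def
  by (intro ext_degree_sum ext_degree_scale) (use ext_degree_omega_set[of "{B}" for B] in simp)

lemma ext_degree_elementary_sp:
  assumes "\<eta> \<in> elementary_sp p"
  shows "ext_degree (2 * p) \<eta>"
proof -
  have "ext_degree (2 * length js) (wedge_list (map (\<lambda>i. pullback (a i) False \<curlywedge> pullback (a i) True) js))" for a and js :: "nat list"
  proof (induction js)
    case Nil
    then show ?case by (simp add: ext_degree_def ext_one_def omega_set_nth)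
  next
    case (Cons j js)
    show ?case
      using ext_degree_wedge[OF ext_degree_wedge[OF ext_degree_pullback ext_degree_pullback] Cons.IH] by simp
  qed
  from this[of "[0..<p]"] show ?thesis
    using assms by (auto simp: elementary_sp_def)
qed

text \<open>The operators appear in this order because moving d0 d1 from a current to the test form
  reverses them.\<close>

lemma
  assumes \<psi>: "Ck_on 2 \<psi> UNIV"
  shows d1_d0_scaleR_const: "d1 S (d0 S (\<lambda>q. \<psi> q *\<^sub>R \<eta>)) q = hess S theta1 theta0 \<psi> q \<curlywedge> \<eta>"
proof -
  have \<psi>2: "Ck_on (Suc 1) \<psi> UNIV" using \<psi> by (simp only: Ck_on_2_Suc One_nat_def)
  have d\<psi>: "\<psi> differentiable (at r)" for r
    by (rule Ck_on_imp_differentiable[OF \<psi>2 UNIV_I])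
  have dg: "grad S theta0 \<psi> differentiable (at r)" for r
    using Ck_on_grad[OF open_UNIV \<psi>2] unfolding Ck_on_1_Suc by (rule Ck_on_imp_differentiable) simp
  have 0: "d0 S (\<lambda>q. \<psi> q *\<^sub>R \<eta>) = (\<lambda>r. grad S theta0 \<psi> r \<curlywedge> \<eta>)"
  proof
    fix r
    show "d0 S (\<lambda>q. \<psi> q *\<^sub>R \<eta>) r = grad S theta0 \<psi> r \<curlywedge> \<eta>"
      by (simp add: d0_eq_dform[OF differentiable_scaleR_const[OF d\<psi>]] dform_def grad_def XV_scaleR_const[OF d\<psi>]
          wedge_sum_left wedge.scaleR_left wedge.scaleR_right)
  qed
  have "(\<lambda>r. grad S theta0 \<psi> r \<curlywedge> \<eta>) differentiable (at q)"
    by (rule bounded_linear.differentiable_linear[OF wedge.bounded_linear_left dg])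
  then have "d1 S (d0 S (\<lambda>q. \<psi> q *\<^sub>R \<eta>)) q = dform theta1 S (\<lambda>r. grad S theta0 \<psi> r \<curlywedge> \<eta>) q"
    unfolding 0 by (rule d1_eq_dform)
  also have "\<dots> = dform theta1 S (grad S theta0 \<psi>) q \<curlywedge> \<eta>"
    by (simp add: dform_def XV_linear[OF wedge.bounded_linear_left dg] wedge_sum_left wedge_assoc)
  also have "\<dots> = hess S theta1 theta0 \<psi> q \<curlywedge> \<eta>"
    by (simp add: dform_grad[OF open_UNIV UNIV_I \<psi>])
  finally show ?thesis .
qed

text \<open>Test the current of u on a bump times the fixed element \<eta>. Integrating by parts
  back, with the constant form \<eta> as T, gives the integral of the bump against the coefficient
  in question.\<close>

lemma psh_hess_nonneg:
  fixes S :: "real ^ ('n::{finite,linorder} \<times> 4) ^ ('n \<times> 4)"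
  assumes \<Omega>: "open \<Omega>" "q \<in> \<Omega>" and u: "Ck_on 2 u \<Omega>" "psh S \<Omega> (\<lambda>q. ereal (u q))"
    and \<eta>: "\<eta> \<in> elementary_sp (CARD('n) - 1)"
  shows "0 \<le> top_coeff (hess S theta0 theta1 u q \<curlywedge> \<eta>)"
proof -
  define g where "g q = top_coeff (hess S theta0 theta1 u q \<curlywedge> \<eta>)" for q
  have cg: "continuous_on \<Omega> g"
    unfolding g_def[abs_def]
    using Ck_on_continuous[OF Ck_on_hess[OF \<Omega>(1) u(1)[unfolded Ck_on_2_Suc]]]
    by (intro continuous_on_top_coeff_wedge continuous_on_const)
  have key: "integrable lborel (\<lambda>x. \<psi> x *\<^sub>R g x) \<and> 0 \<le> (LINT x|lborel. \<psi> x *\<^sub>R g x)"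
    if \<psi>: "\<And>m. Ck_on m \<psi> UNIV" "\<And>x. 0 \<le> \<psi> x" and Q: "compact Q" "Q \<subseteq> \<Omega>" and off: "\<And>x. x \<notin> Q \<Longrightarrow> \<psi> x = 0" for \<psi> Q
  proof
    have clQ: "closed Q" using Q(1) by (rule compact_imp_closed)
    show "integrable lborel (\<lambda>x. \<psi> x *\<^sub>R g x)"
      by (rule integrable_continuous_compact_support[OF Q(1)])
        (auto simp: off intro!: continuous_on_scaleR continuous_on_subset[OF cg Q(2)] continuous_on_subset[OF Ck_on_continuous[OF \<psi>(1)]])
    define \<zeta> where "\<zeta> = (\<lambda>q. \<psi> q *\<^sub>R \<eta>)"
    have n: "CARD('n) - 1 + 1 = CARD('n)" by simp
    have sub: "{q. \<zeta> q \<noteq> 0} \<subseteq> Q" using off by (auto simp: \<zeta>_def)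
    then have cl: "closure {q. \<zeta> q \<noteq> 0} \<subseteq> Q" using clQ by (rule closure_minimal)
    have "test_form \<Omega> (2 * (CARD('n) - 1)) \<zeta>"
      unfolding test_form_def
    proof (intro conjI allI)
      show "Ck_on m \<zeta> UNIV" for m
        unfolding \<zeta>_def by (rule Ck_on_scaleR_const[OF open_UNIV \<psi>(1)])
      show "compact (closure {q. \<zeta> q \<noteq> 0})"
        using compact_Int_closed[OF Q(1) closed_closure, of "{q. \<zeta> q \<noteq> 0}"] cl by (simp add: Int_absorb1)
      show "closure {q. \<zeta> q \<noteq> 0} \<subseteq> \<Omega>" using cl Q(2) by blast
      show "ext_degree (2 * (CARD('n) - 1)) (\<zeta> q)" for q
        unfolding \<zeta>_def scaleR_eq_vector_scale by (intro ext_degree_scale ext_degree_elementary_sp \<eta>)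
    qed
    moreover have "\<forall>q. \<zeta> q \<in> strongly_positive (CARD('n) - 1)"
      unfolding \<zeta>_def strongly_positive_def
      using \<psi>(2) hull_inc[OF \<eta>] by (auto intro: convex_cone_hull_mul)
    ultimately have "0 \<le> triangle_current S \<Omega> (\<lambda>q. ereal (u q)) \<zeta>"
      using u(2) n unfolding psh_def positive_current_def by blast
    \<comment> \<open>\<open>current_diff\<close> contributes the sign +1 in degree 1 and -1 in
      degree 0; the remaining minus is the one in \<open>hess_by_parts\<close>.\<close>
    also have "triangle_current S \<Omega> (\<lambda>q. ereal (u q)) \<zeta>
        = - (LINT q:\<Omega>|lborel. of_real (u q) * top_coeff (hess S theta1 theta0 \<psi> q \<curlywedge> \<eta>))"
      by (simp add: triangle_current_def current_diff_def function_current_def \<zeta>_def d1_d0_scaleR_const[OF \<psi>(1)])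
    also have "(LINT q:\<Omega>|lborel. of_real (u q) * top_coeff (hess S theta1 theta0 \<psi> q \<curlywedge> \<eta>))
        = (LINT q|lborel. u q *\<^sub>R top_coeff (hess S theta1 theta0 \<psi> q \<curlywedge> \<eta>))"
      unfolding set_lebesgue_integral_def
    proof (rule Bochner_Integration.integral_cong[OF refl])
      fix q
      show "indicat_real \<Omega> q *\<^sub>R (of_real (u q) * top_coeff (hess S theta1 theta0 \<psi> q \<curlywedge> \<eta>)) = u q *\<^sub>R top_coeff (hess S theta1 theta0 \<psi> q \<curlywedge> \<eta>)"
      proof (cases "q \<in> \<Omega>")
        case True
        then show ?thesis by (simp add: scaleR_conv_of_real)
      next
        case False
        then have "q \<notin> Q" using Q(2) by blast
        have "hess S theta1 theta0 \<psi> q = 0" by (rule hess_zero_off[OF clQ off \<open>q \<notin> Q\<close>])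
        then show ?thesis by simp
      qed
    qed
    also have "- \<dots> = (LINT q|lborel. \<psi> q *\<^sub>R g q)"
      unfolding g_def
      by (rule hess_by_parts[OF \<Omega>(1) Q \<psi>(1) off u(1) continuous_on_const weakly_closed_const, symmetric])
    finally show "0 \<le> (LINT x|lborel. \<psi> x *\<^sub>R g x)" .
  qed
  have "0 \<le> Re (g q)"
  proof (rule nonneg_of_bump_integrals[OF \<Omega>])
    show "continuous_on \<Omega> (\<lambda>x. Re (g x))" by (intro continuous_intros cg)
    fix \<psi> :: "'n grp \<Rightarrow> real" and Q
    assume *: "\<And>m. Ck_on m \<psi> UNIV" "\<And>x. 0 \<le> \<psi> x" "compact Q" "Q \<subseteq> \<Omega>" "\<And>x. x \<notin> Q \<Longrightarrow> \<psi> x = 0"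
    from key[OF *] show "0 \<le> (LINT x|lborel. \<psi> x * Re (g x))"
      using integral_Re[of lborel "\<lambda>x. \<psi> x *\<^sub>R g x"] by (simp add: less_eq_complex_def)
  qed
  \<comment> \<open>The cases c = 1 and c = -1 together force the imaginary part to vanish.\<close>
  moreover have im: "0 \<le> c * Im (g q)" for c
  proof (rule nonneg_of_bump_integrals[OF \<Omega>])
    show "continuous_on \<Omega> (\<lambda>x. c * Im (g x))" by (intro continuous_intros cg)
    fix \<psi> :: "'n grp \<Rightarrow> real" and Q
    assume *: "\<And>m. Ck_on m \<psi> UNIV" "\<And>x. 0 \<le> \<psi> x" "compact Q" "Q \<subseteq> \<Omega>" "\<And>x. x \<notin> Q \<Longrightarrow> \<psi> x = 0"
    from key[OF *] have "(LINT x|lborel. \<psi> x * Im (g x)) = 0"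
      using integral_Im[of lborel "\<lambda>x. \<psi> x *\<^sub>R g x"] by (simp add: less_eq_complex_def)
    then show "0 \<le> (LINT x|lborel. \<psi> x * (c * Im (g x)))"
      by (simp add: mult.left_commute)
  qed
  have "Im (g q) = 0" using im[of 1] im[of "-1"] by simp
  ultimately show ?thesis by (simp add: g_def less_eq_complex_def)
qed

lemma theta_omega:
  "\<exists>c A. cmod c = 1 \<and> theta0 a = c *s omega A" "\<exists>c A. cmod c = 1 \<and> theta1 a = c *s omega A"
proof -
  obtain l k where a: "a = (l, k)" by (cases a)
  have k: "k = 1 \<or> k = 2 \<or> k = 3 \<or> k = 4" by (rule exhaust_4)
  show "\<exists>c A. cmod c = 1 \<and> theta0 a = c *s omega A"
    using k unfolding a theta0_def prod.case
    by (intro exI[of _ "if k = 1 then 1 else if k = 2 then \<i> else if k = 3 then 1 else - \<i>"]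
        exI[of _ "(l, k \<noteq> 1 \<and> k \<noteq> 2)"]) (elim disjE; simp)
  show "\<exists>c A. cmod c = 1 \<and> theta1 a = c *s omega A"
    using k unfolding a theta1_def prod.case
    by (intro exI[of _ "if k = 1 then 1 else if k = 2 then - \<i> else if k = 3 then -1 else - \<i>"]
        exI[of _ "(l, k = 1 \<or> k = 2)"]) (elim disjE; simp)
qed

text \<open>Collecting the terms with equal basis covectors gives the coefficient shape on which
  \<open>zeta_sum_of_positive\<close> works.\<close>

lemma hess_two_form:
  fixes S :: "real ^ ('n::{finite,linorder} \<times> 4) ^ ('n \<times> 4)"
  shows "\<exists>m. hess S theta0 theta1 u q = (\<Sum>A\<in>UNIV. \<Sum>B\<in>UNIV. m A B *s (omega A \<curlywedge> omega B))"
proof -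
  obtain c0 and A0 :: "'n \<times> 4 \<Rightarrow> 'n idx" where 0: "\<And>a. theta0 a = c0 a *s omega (A0 a)" using theta_omega(1) by metis
  obtain c1 and A1 :: "'n \<times> 4 \<Rightarrow> 'n idx" where 1: "\<And>a. theta1 a = c1 a *s omega (A1 a)" using theta_omega(2) by metis
  define m where "m A B = (\<Sum>a\<in>UNIV. \<Sum>b\<in>UNIV. if A0 a = A \<and> A1 b = B then of_real (XV S a (XV S b u) q) * (c0 a * c1 b) else 0)" for A B
  have "(\<Sum>A\<in>UNIV. \<Sum>B\<in>UNIV. m A B *s (omega A \<curlywedge> omega B)) =
     (\<Sum>A\<in>UNIV. \<Sum>B\<in>UNIV. \<Sum>a\<in>UNIV. \<Sum>b\<in>UNIV. if A0 a = A \<and> A1 b = B then (of_real (XV S a (XV S b u) q) * (c0 a * c1 b)) *s (omega A \<curlywedge> omega B) else 0)"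
    by (intro sum.cong refl) (simp add: m_def vec.scale_sum_left if_distrib[of "\<lambda>x. x *s _"] cong: if_cong)
  also have "\<dots> = (\<Sum>A\<in>UNIV. \<Sum>a\<in>UNIV. \<Sum>b\<in>UNIV. \<Sum>B\<in>UNIV. if A0 a = A \<and> A1 b = B then (of_real (XV S a (XV S b u) q) * (c0 a * c1 b)) *s (omega A \<curlywedge> omega B) else 0)"
    by (rule sum.cong[OF refl], subst sum.swap, rule sum.cong[OF refl], rule sum.swap)
  also have "\<dots> = (\<Sum>a\<in>UNIV. \<Sum>b\<in>UNIV. \<Sum>A\<in>UNIV. \<Sum>B\<in>UNIV. if A0 a = A \<and> A1 b = B then (of_real (XV S a (XV S b u) q) * (c0 a * c1 b)) *s (omega A \<curlywedge> omega B) else 0)"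
    by (subst sum.swap, rule sum.cong[OF refl], rule sum.swap)
  also have "\<dots> = (\<Sum>a\<in>UNIV. \<Sum>b\<in>UNIV. (of_real (XV S a (XV S b u) q) * (c0 a * c1 b)) *s (omega (A0 a) \<curlywedge> omega (A1 b)))"
  proof (intro sum.cong refl)
    fix a b
    let ?x = "\<lambda>A B. (of_real (XV S a (XV S b u) q) * (c0 a * c1 b)) *s (omega A \<curlywedge> omega B)"
    have "(\<Sum>A\<in>UNIV. \<Sum>B\<in>UNIV. if A0 a = A \<and> A1 b = B then ?x A B else 0)
        = (\<Sum>A\<in>UNIV. if A0 a = A then (\<Sum>B\<in>UNIV. if A1 b = B then ?x A B else 0) else 0)"
      by (intro sum.cong refl) auto
    then show "(\<Sum>A\<in>UNIV. \<Sum>B\<in>UNIV. if A0 a = A \<and> A1 b = B then ?x A B else 0) = ?x (A0 a) (A1 b)"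
      by simp
  qed
  also have "\<dots> = hess S theta0 theta1 u q"
    unfolding hess_def 0 1 by (simp add: wedge_scale_left wedge_scale_right scaleR_eq_vector_scale mult_ac)
  finally show ?thesis by (intro exI[of _ m]) (rule sym)
qed

lemma psh_zeta_sum:
  assumes "open \<Omega>" "q \<in> \<Omega>" "Ck_on 2 u \<Omega>" "psh S \<Omega> (\<lambda>q. ereal (u q))"
  shows "zeta_sum (hess S theta0 theta1 u q)"
proof -
  obtain m where "hess S theta0 theta1 u q = (\<Sum>A\<in>UNIV. \<Sum>B\<in>UNIV. m A B *s (omega A \<curlywedge> omega B))"
    using hess_two_form by blast
  then show ?thesis
    by (rule zeta_sum_of_positive) (rule psh_hess_nonneg[OF assms])
qed

section \<open>The estimate\<close>

text \<open>The number of factors beta_n is a parameter because each step of the estimate trades one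
  function for one such factor.\<close>

definition mass_form :: "real ^ ('n::{finite,linorder} \<times> 4) ^ ('n \<times> 4) \<Rightarrow> ('n grp \<Rightarrow> real) list \<Rightarrow> nat \<Rightarrow>
    'n grp \<Rightarrow> 'n ext" where
  "mass_form S us k q = wedge_list (map (\<lambda>u. hess S theta0 theta1 u q) us) \<curlywedge> wedge_list (replicate k beta_form)"

lemma mass_form_Cons: "mass_form S (u # us) k q = hess S theta0 theta1 u q \<curlywedge> mass_form S us k q"
  by (simp add: mass_form_def wedge_assoc)

lemma beta_wedge_mass_form: "beta_form \<curlywedge> mass_form S us k q = mass_form S us (Suc k) q"
proof -
  have "even_ext (wedge_list (map (\<lambda>u. hess S theta0 theta1 u q) us))"
    by (rule even_ext_wedge_list) (auto intro: even_hess odd_theta)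
  then show ?thesis
    using even_ext_left_commute[of "wedge_list (map (\<lambda>u. hess S theta0 theta1 u q) us)" beta_form] by (simp add: mass_form_def)
qed

lemma continuous_on_mass_form:
  assumes "open \<Omega>" "\<And>u. u \<in> set us \<Longrightarrow> Ck_on 2 u \<Omega>"
  shows "continuous_on \<Omega> (mass_form S us k)"
  using assms(2)
proof (induction us)
  case Nil
  then show ?case by (simp add: mass_form_def[abs_def])
next
  case (Cons u us)
  have "continuous_on \<Omega> (hess S theta0 theta1 u)"
    using Ck_on_hess[OF assms(1), of 0 u] Cons.prems[of u] by (simp add: Ck_on_2_Suc del: Ck_on.simps(2))
  moreover have "continuous_on \<Omega> (mass_form S us k)"
    using Cons.prems by (intro Cons.IH) simp
  ultimately show ?case
    unfolding mass_form_Cons[abs_def] by (rule wedge.continuous_on)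
qed

lemma weakly_closed_mass_form:
  assumes S: "transpose S = S" "right_type S" and \<Omega>: "open \<Omega>" and us: "\<And>u. u \<in> set us \<Longrightarrow> Ck_on 2 u \<Omega>"
  shows "weakly_closed S \<Omega> (mass_form S us k)"
  using us
proof (induction us)
  case Nil
  then show ?case unfolding mass_form_def[abs_def] by (simp add: weakly_closed_const)
next
  case (Cons u us)
  have "weakly_closed S \<Omega> (mass_form S us k)" "continuous_on \<Omega> (mass_form S us k)"
    using Cons by (auto intro: continuous_on_mass_form \<Omega>)
  then show ?case
    unfolding mass_form_Cons[abs_def] using Cons.prems by (intro weakly_closed_hess S \<Omega>) auto
qed

lemma Pos_mass_form:
  assumes "\<And>u. u \<in> set us \<Longrightarrow> zeta_sum (hess S theta0 theta1 u q)"
  shows "Pos (mass_form S us k q)"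
  using assms
proof (induction us)
  case Nil
  have "Pos (wedge_list (replicate k beta_form))"
    by (induction k) (auto intro: Pos_ext_one Pos_beta)
  then show ?case by (simp add: mass_form_def)
next
  case (Cons u us)
  then show ?case by (auto simp: mass_form_Cons intro: Pos_zeta_sum)
qed

lemma C0_norm_bound:
  assumes "compact K" "continuous_on K u" "q \<in> K"
  shows "\<bar>u q\<bar> \<le> C0_norm u K"
proof -
  have "bdd_above ((\<lambda>q. \<bar>u q\<bar>) ` K)"
    using assms(1,2) by (intro bounded_imp_bdd_above compact_imp_bounded compact_continuous_image continuous_intros)
  then show ?thesis
    unfolding C0_norm_def by (rule cSUP_upper[OF assms(3)])
qed

text \<open>In the order on the complex numbers this includes that the integral is real.\<close>

lemma mass_form_nonneg:
  assumes "compact L" "L \<subseteq> \<Omega>" "open \<Omega>" "\<And>u. u \<in> set us \<Longrightarrow> Ck_on 2 u \<Omega>"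
    and "\<And>u q. u \<in> set us \<Longrightarrow> q \<in> \<Omega> \<Longrightarrow> zeta_sum (hess S theta0 theta1 u q)"
  shows "0 \<le> (LINT q:L|lborel. top_coeff (mass_form S us k q))"
proof -
  have c: "continuous_on L (\<lambda>q. top_coeff (mass_form S us k q))"
    using continuous_on_mass_form[OF assms(3,4)] assms(2)
    by (intro bounded_linear.continuous_on[OF bounded_linear_top_coeff]) (rule continuous_on_subset)
  have i: "integrable lborel (\<lambda>q. indicator L q *\<^sub>R top_coeff (mass_form S us k q))"
    by (rule borel_integrable_compact[OF assms(1) c])
  have p: "0 \<le> top_coeff (mass_form S us k q)" if "q \<in> L" for q
    using that assms(2) by (intro Pos_top_coeff Pos_mass_form assms(5)) blast+
  then have "0 \<le> (LINT q|lborel. Re (indicator L q *\<^sub>R top_coeff (mass_form S us k q)))"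
    by (intro Bochner_Integration.integral_nonneg) (auto simp: indicator_def less_eq_complex_def)
  moreover have "Im (indicator L q *\<^sub>R top_coeff (mass_form S us k q)) = 0" for q
    using p[of q] by (auto simp: indicator_def less_eq_complex_def)
  then have "(LINT q|lborel. Im (indicator L q *\<^sub>R top_coeff (mass_form S us k q))) = 0"
    by (simp only: Bochner_Integration.integral_zero)
  ultimately show ?thesis
    unfolding set_lebesgue_integral_def less_eq_complex_def integral_Re[OF i, symmetric] integral_Im[OF i, symmetric]
    by simp
qed

text \<open>A step of the induction passes from L to the larger support Q of the cutoff and from
  \<open>k\<close> to \<open>Suc k\<close>, so both vary. The constant is chosen before \<Omega> and
  the functions, since the cutoff depends only on L and K.\<close>

lemma mass_estimate:
  fixes S :: "real ^ ('n::{finite,linorder} \<times> 4) ^ ('n \<times> 4)" and K :: "'n grp set"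
  assumes S: "transpose S = S" "right_type S" and K: "compact K" "K \<noteq> {}"
  shows "compact L \<Longrightarrow> L \<subseteq> interior K \<Longrightarrow> \<exists>C\<ge>0. \<forall>\<Omega> us. open \<Omega> \<longrightarrow> K \<subseteq> \<Omega> \<longrightarrow> length us = p \<longrightarrow>
     (\<forall>u\<in>set us. Ck_on 2 u \<Omega> \<and> (\<forall>q\<in>\<Omega>. zeta_sum (hess S theta0 theta1 u q))) \<longrightarrow>
     Re (LINT q:L|lborel. top_coeff (mass_form S us k q)) \<le> C * (\<Prod>u\<leftarrow>us. C0_norm u K)"
proof (induction p arbitrary: L k)
  case 0
  \<comment> \<open>No function is left: the integral itself is the constant, made nonnegative by
    \<open>max\<close>.\<close>
  show ?case
    by (rule exI[of _ "max 0 (Re (LINT q:L|lborel. top_coeff (mass_form S [] k q)))"]) auto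
next
  case (Suc p)
  obtain \<psi> :: "'n grp \<Rightarrow> real" and Q where \<psi>: "\<And>m. Ck_on m \<psi> UNIV" "\<And>x. 0 \<le> \<psi> x" "\<And>x. x \<in> L \<Longrightarrow> 1 \<le> \<psi> x"
    and Q: "compact Q" "Q \<subseteq> interior K" "L \<subseteq> Q" and off: "\<And>x. x \<notin> Q \<Longrightarrow> \<psi> x = 0"
    using exists_cutoff[OF Suc.prems(1) open_interior Suc.prems(2)] by metis
  obtain C1 where C1: "C1 \<ge> 0" "\<And>\<Omega> us. open \<Omega> \<Longrightarrow> K \<subseteq> \<Omega> \<Longrightarrow> length us = p \<Longrightarrow>
     \<forall>u\<in>set us. Ck_on 2 u \<Omega> \<and> (\<forall>q\<in>\<Omega>. zeta_sum (hess S theta0 theta1 u q)) \<Longrightarrow>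
     Re (LINT q:Q|lborel. top_coeff (mass_form S us (Suc k) q)) \<le> C1 * (\<Prod>u\<leftarrow>us. C0_norm u K)"
    using Suc.IH[OF Q(1,2), of "Suc k"] by blast
  have clQ: "closed Q" using Q(1) by (rule compact_imp_closed)
  \<comment> \<open>The total size of the coefficients of the second-order form of the cutoff; a
    bound for it on Q enters the constant.\<close>
  define M where "M q = (\<Sum>a\<in>UNIV. \<Sum>b\<in>UNIV. \<bar>XV S a (XV S b \<psi>) q\<bar>)" for q
  have "continuous_on Q M"
    unfolding M_def by (intro continuous_intros continuous_on_XV_XV[OF open_UNIV \<psi>(1)]) simp
  then obtain N where N: "\<And>q. q \<in> Q \<Longrightarrow> M q \<le> N"
    using compact_imp_bounded[OF compact_continuous_image[OF _ Q(1)], of M] unfolding bounded_iff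
    by (metis abs_le_D1 imageI real_norm_def)
  define N' where "N' = max 0 N"
  have N': "N' \<ge> 0" "\<And>q. q \<in> Q \<Longrightarrow> M q \<le> N'" using N by (auto simp: N'_def intro: max.coboundedI2)
  show ?case
  proof (intro exI[of _ "N' * C1"] conjI allI impI)
    show "0 \<le> N' * C1" using N'(1) C1(1) by simp
    fix \<Omega> :: "'n grp set" and us :: "('n grp \<Rightarrow> real) list"
    assume \<Omega>: "open \<Omega>" "K \<subseteq> \<Omega>" and len: "length us = Suc p"
      and us: "\<forall>u\<in>set us. Ck_on 2 u \<Omega> \<and> (\<forall>q\<in>\<Omega>. zeta_sum (hess S theta0 theta1 u q))"
    obtain u vs where uvs: "us = u # vs" "length vs = p" using len by (cases us) auto
    have u: "Ck_on 2 u \<Omega>" and uz: "\<And>q. q \<in> \<Omega> \<Longrightarrow> zeta_sum (hess S theta0 theta1 u q)"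
      and vs: "\<forall>u\<in>set vs. Ck_on 2 u \<Omega> \<and> (\<forall>q\<in>\<Omega>. zeta_sum (hess S theta0 theta1 u q))"
      using us uvs by auto
    have Q\<Omega>: "Q \<subseteq> \<Omega>" and QK: "Q \<subseteq> K" using Q(2) interior_subset[of K] \<Omega>(2) by auto
    define T where "T = mass_form S vs k"
    have cT: "continuous_on \<Omega> T" unfolding T_def using vs by (intro continuous_on_mass_form \<Omega>(1)) auto
    have wT: "weakly_closed S \<Omega> T" unfolding T_def using vs by (intro weakly_closed_mass_form S \<Omega>(1)) auto
    have pT: "Pos (T q)" if "q \<in> \<Omega>" for q unfolding T_def using vs that by (intro Pos_mass_form) auto
    define f where "f q = top_coeff (hess S theta0 theta1 u q \<curlywedge> T q)" for q
    have mf: "top_coeff (mass_form S us k q) = f q" for q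
      by (simp add: f_def T_def uvs mass_form_Cons)
    have cf: "continuous_on \<Omega> f"
      unfolding f_def[abs_def]
      using Ck_on_continuous[OF Ck_on_hess[OF \<Omega>(1) u[unfolded Ck_on_2_Suc]]] cT by (rule continuous_on_top_coeff_wedge)
    have pf: "0 \<le> f q" if "q \<in> \<Omega>" for q
      unfolding f_def using that by (intro Pos_top_coeff Pos_zeta_sum uz pT)
    have iL: "integrable lborel (\<lambda>q. indicator L q *\<^sub>R f q)"
      by (rule borel_integrable_compact[OF Suc.prems(1)]) (rule continuous_on_subset[OF cf], use Q(3) Q\<Omega> in blast)
    have i\<psi>: "integrable lborel (\<lambda>q. \<psi> q *\<^sub>R f q)"
      by (rule integrable_continuous_compact_support[OF Q(1)])
        (auto simp: off intro!: continuous_on_scaleR continuous_on_subset[OF cf Q\<Omega>] continuous_on_subset[OF Ck_on_continuous[OF \<psi>(1)]])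
    have "Re (LINT q:L|lborel. top_coeff (mass_form S us k q)) = (LINT q|lborel. Re (indicator L q *\<^sub>R f q))"
      unfolding mf set_lebesgue_integral_def integral_Re[OF iL] ..
    \<comment> \<open>The cutoff is at least 1 on L, and the integrand is nonnegative wherever the
      cutoff does not vanish.\<close>
    also have "\<dots> \<le> (LINT q|lborel. Re (\<psi> q *\<^sub>R f q))"
    proof (rule Bochner_Integration.integral_mono)
      show "integrable lborel (\<lambda>q. Re (indicator L q *\<^sub>R f q))" by (rule integrable_Re[OF iL])
      show "integrable lborel (\<lambda>q. Re (\<psi> q *\<^sub>R f q))" by (rule integrable_Re[OF i\<psi>])
      show "Re (indicator L q *\<^sub>R f q) \<le> Re (\<psi> q *\<^sub>R f q)" for q
      proof (cases "q \<in> Q")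
        case True
        then have "0 \<le> Re (f q)" using pf[of q] Q\<Omega> by (auto simp: less_eq_complex_def)
        then show ?thesis
          using \<psi>(2)[of q] \<psi>(3)[of q] mult_right_mono[of 1 "\<psi> q" "Re (f q)"] by (auto simp: indicator_def)
      next
        case False
        then show ?thesis using Q(3) off[OF False] by (auto simp: indicator_def)
      qed
    qed
    also have "\<dots> = Re (LINT q|lborel. \<psi> q *\<^sub>R f q)" by (rule integral_Re[OF i\<psi>])
    also have "\<dots> = Re (- (LINT q|lborel. u q *\<^sub>R top_coeff (hess S theta1 theta0 \<psi> q \<curlywedge> T q)))"
      unfolding f_def using hess_by_parts[OF \<Omega>(1) Q(1) Q\<Omega> \<psi>(1) off u cT wT] by simp
    also have "\<dots> \<le> cmod (LINT q|lborel. u q *\<^sub>R top_coeff (hess S theta1 theta0 \<psi> q \<curlywedge> T q))"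
      using complex_Re_le_cmod[of "- (LINT q|lborel. u q *\<^sub>R top_coeff (hess S theta1 theta0 \<psi> q \<curlywedge> T q))"] by simp
    also have "\<dots> \<le> (LINT q|lborel. (C0_norm u K * N') * Re (indicator Q q *\<^sub>R top_coeff (mass_form S vs (Suc k) q)))"
    proof (rule norm_lborel_integral_le)
      have cQ: "continuous_on Q (\<lambda>q. top_coeff (mass_form S vs (Suc k) q))"
        using vs Q\<Omega> by (intro bounded_linear.continuous_on[OF bounded_linear_top_coeff]
          continuous_on_subset[OF continuous_on_mass_form[OF \<Omega>(1)]]) auto
      show "integrable lborel (\<lambda>q. (C0_norm u K * N') * Re (indicator Q q *\<^sub>R top_coeff (mass_form S vs (Suc k) q)))"
        by (intro integrable_mult_right integrable_Re borel_integrable_compact Q(1) cQ)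
      show "integrable lborel (\<lambda>q. u q *\<^sub>R top_coeff (hess S theta1 theta0 \<psi> q \<curlywedge> T q))"
      proof (rule integrable_continuous_compact_support[OF Q(1)])
        show "continuous_on Q (\<lambda>q. u q *\<^sub>R top_coeff (hess S theta1 theta0 \<psi> q \<curlywedge> T q))"
          by (intro continuous_on_scaleR continuous_on_top_coeff_wedge continuous_on_subset[OF cT Q\<Omega>]
            continuous_on_subset[OF Ck_on_continuous[OF u] Q\<Omega>]
            continuous_on_subset[OF Ck_on_continuous[OF Ck_on_hess[OF open_UNIV \<psi>(1)]]]) simp
        show "u q *\<^sub>R top_coeff (hess S theta1 theta0 \<psi> q \<curlywedge> T q) = 0" if "q \<notin> Q" for q
          using hess_zero_off[OF clQ off that] by simp
      qed
      fix q
      show "norm (u q *\<^sub>R top_coeff (hess S theta1 theta0 \<psi> q \<curlywedge> T q))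
          \<le> (C0_norm u K * N') * Re (indicator Q q *\<^sub>R top_coeff (mass_form S vs (Suc k) q))"
      proof (cases "q \<in> Q")
        case False
        then show ?thesis using hess_zero_off[OF clQ off False] by (simp add: indicator_def)
      next
        case True
        define t where "t = Re (top_coeff (beta_form \<curlywedge> T q))"
        have posT: "Pos (T q)" using pT True Q\<Omega> by blast
        have t: "t = Re (top_coeff (mass_form S vs (Suc k) q))"
          by (simp only: t_def T_def beta_wedge_mass_form)
        have t0: "0 \<le> t"
          using Pos_top_coeff[OF Pos_beta[OF posT]] by (simp add: t_def less_eq_complex_def)
        \<comment> \<open>Up to unit factors \<open>theta1 a\<close> and \<open>theta0 b\<close> are
          basis covectors, so the Cauchy-Schwarz bound applies.\<close>
        have ent: "cmod (top_coeff ((theta1 a \<curlywedge> theta0 b) \<curlywedge> T q)) \<le> t" for a b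
        proof -
          obtain c A where 1: "cmod c = 1" "theta1 a = c *s omega A" using theta_omega(2) by metis
          obtain d B where 0: "cmod d = 1" "theta0 b = d *s omega B" using theta_omega(1) by metis
          have "top_coeff ((theta1 a \<curlywedge> theta0 b) \<curlywedge> T q) = c * (d * top_coeff (omega A \<curlywedge> omega B \<curlywedge> T q))"
            by (simp add: 0 1 wedge_scale_left wedge_scale_right wedge_assoc top_coeff_scale)
          then show ?thesis
            using Pos_omega_bound[OF posT, of A B] by (simp add: norm_mult 0 1 t_def)
        qed
        have "cmod (top_coeff (hess S theta1 theta0 \<psi> q \<curlywedge> T q))
            = cmod (\<Sum>a\<in>UNIV. \<Sum>b\<in>UNIV. XV S a (XV S b \<psi>) q *\<^sub>R top_coeff ((theta1 a \<curlywedge> theta0 b) \<curlywedge> T q))"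
          by (simp only: hess_def wedge_sum_left wedge.scaleR_left top_coeff_sum top_coeff_scaleR)
        also have "\<dots> \<le> (\<Sum>a\<in>UNIV. \<Sum>b\<in>UNIV. \<bar>XV S a (XV S b \<psi>) q\<bar> * t)"
          by (intro sum_norm_le) (simp add: ent mult_left_mono)
        also have "\<dots> = M q * t" by (simp add: M_def sum_distrib_right)
        also have "\<dots> \<le> N' * t" by (rule mult_right_mono[OF N'(2)[OF True] t0])
        finally have h: "cmod (top_coeff (hess S theta1 theta0 \<psi> q \<curlywedge> T q)) \<le> N' * t" .
        have "continuous_on K u"
          using Ck_on_continuous[OF u] \<Omega>(2) by (rule continuous_on_subset)
        then have "\<bar>u q\<bar> \<le> C0_norm u K"
          using True QK by (intro C0_norm_bound[OF K(1)]) auto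
        then have "\<bar>u q\<bar> * cmod (top_coeff (hess S theta1 theta0 \<psi> q \<curlywedge> T q)) \<le> C0_norm u K * (N' * t)"
          using h by (intro mult_mono) auto
        then show ?thesis using True by (simp add: t mult.assoc)
      qed
    qed
    also have "\<dots> = (C0_norm u K * N') * Re (LINT q:Q|lborel. top_coeff (mass_form S vs (Suc k) q))"
    proof -
      have "integrable lborel (\<lambda>q. indicator Q q *\<^sub>R top_coeff (mass_form S vs (Suc k) q))"
        using vs Q\<Omega> by (intro borel_integrable_compact Q(1) bounded_linear.continuous_on[OF bounded_linear_top_coeff]
          continuous_on_subset[OF continuous_on_mass_form[OF \<Omega>(1)]]) auto
      from integral_Re[OF this] show ?thesis
        by (simp only: set_lebesgue_integral_def Bochner_Integration.integral_mult_right_zero)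
    qed
    also have "\<dots> \<le> N' * C1 * (\<Prod>u\<leftarrow>us. C0_norm u K)"
    proof -
      \<comment> \<open>A point of K makes \<open>C0_norm\<close> nonnegative; over the empty set
        the supremum would be an unspecified number.\<close>
      obtain q where "q \<in> K" using K(2) by blast
      have "continuous_on K u"
        using Ck_on_continuous[OF u] \<Omega>(2) by (rule continuous_on_subset)
      then have "0 \<le> C0_norm u K"
        using C0_norm_bound[OF K(1) _ \<open>q \<in> K\<close>] abs_ge_zero order_trans by blast
      then have "(C0_norm u K * N') * Re (LINT q:Q|lborel. top_coeff (mass_form S vs (Suc k) q))
          \<le> (C0_norm u K * N') * (C1 * (\<Prod>u\<leftarrow>vs. C0_norm u K))"
        using N'(1) by (intro mult_left_mono C1(2)[OF \<Omega> uvs(2) vs]) simp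
      then show ?thesis by (simp add: uvs mult_ac)
    qed
    finally show "Re (LINT q:L|lborel. top_coeff (mass_form S us k q)) \<le> N' * C1 * (\<Prod>u\<leftarrow>us. C0_norm u K)" .
  qed
qed

lemma prod_list_upt: "(\<Prod>i\<leftarrow>[1..<Suc p]. f i) = (\<Prod>i = 1..p. f i)"
  by (subst prod.distinct_set_conv_list[symmetric]) (auto intro!: prod.cong)

theorem theorem6p1:
  fixes S :: "real ^ ('n::{finite,linorder} \<times> 4) ^ ('n \<times> 4)"
    and K L :: "'n grp set"
  assumes "transpose S = S" and "right_type S"
    and "compact K" and "compact L" and "L \<subseteq> interior K"
  shows "\<exists>C::real. \<forall>(\<Omega>::'n grp set) (p::nat) (u::nat \<Rightarrow> 'n grp \<Rightarrow> real).
     is_domain \<Omega> \<longrightarrow> K \<subseteq> \<Omega> \<longrightarrow> 1 \<le> p \<longrightarrow> p \<le> CARD('n) \<longrightarrow>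
     (\<forall>i\<in>{1..p}. Ck_on 2 (u i) \<Omega> \<and> psh S \<Omega> (\<lambda>q. ereal (u i q))) \<longrightarrow>
     form_norm (CARD('n) - p) (\<lambda>q. wedge_list (map (\<lambda>i. triangle_form S (u i) q) [1..<Suc p])) L
       \<le> complex_of_real (C * (\<Prod>i = 1..p. C0_norm (u i) K))"
proof (cases "K = {}")
  case True
  then have "L = {}" using assms(5) by simp
  \<comment> \<open>\<open>C0_norm\<close> over the empty set is unspecified, so the constant 0 is
    taken and both sides vanish.\<close>
  then show ?thesis
    by (intro exI[of _ 0]) (simp add: form_norm_def form_integral_def set_lebesgue_integral_def)
next
  case False
  \<comment> \<open>There is one constant for each p; their sum over p \<le> n will serve all p at
    once.\<close>
  have "\<forall>p. \<exists>C\<ge>0. \<forall>\<Omega> us. open \<Omega> \<longrightarrow> K \<subseteq> \<Omega> \<longrightarrow> length us = p \<longrightarrow>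
     (\<forall>u\<in>set us. Ck_on 2 u \<Omega> \<and> (\<forall>q\<in>\<Omega>. zeta_sum (hess S theta0 theta1 u q))) \<longrightarrow>
     Re (LINT q:L|lborel. top_coeff (mass_form S us (CARD('n) - p) q)) \<le> C * (\<Prod>u\<leftarrow>us. C0_norm u K)"
    by (intro allI mass_estimate[OF assms(1-3) False assms(4,5)])
  from choice[OF this] obtain C where C: "\<forall>p. 0 \<le> C p \<and> (\<forall>\<Omega> us. open \<Omega> \<longrightarrow> K \<subseteq> \<Omega> \<longrightarrow> length us = p \<longrightarrow>
     (\<forall>u\<in>set us. Ck_on 2 u \<Omega> \<and> (\<forall>q\<in>\<Omega>. zeta_sum (hess S theta0 theta1 u q))) \<longrightarrow>
     Re (LINT q:L|lborel. top_coeff (mass_form S us (CARD('n) - p) q)) \<le> C p * (\<Prod>u\<leftarrow>us. C0_norm u K))" ..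
  show ?thesis
  proof (intro exI allI impI)
    fix \<Omega> :: "'n grp set" and p and u :: "nat \<Rightarrow> 'n grp \<Rightarrow> real"
    assume \<Omega>: "is_domain \<Omega>" "K \<subseteq> \<Omega>" and p: "1 \<le> p" "p \<le> CARD('n)"
      and u: "\<forall>i\<in>{1..p}. Ck_on 2 (u i) \<Omega> \<and> psh S \<Omega> (\<lambda>q. ereal (u i q))"
    have op: "open \<Omega>" using \<Omega>(1) by (simp add: is_domain_def)
    have L\<Omega>: "L \<subseteq> \<Omega>" using assms(5) interior_subset[of K] \<Omega>(2) by blast
    define us where "us = map u [1..<Suc p]"
    have us: "Ck_on 2 v \<Omega> \<and> (\<forall>q\<in>\<Omega>. zeta_sum (hess S theta0 theta1 v q))" if "v \<in> set us" for v
    proof -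
      obtain i where "i \<in> set [1..<Suc p]" "v = u i"
        using \<open>v \<in> set us\<close> unfolding us_def set_map by blast
      then have "i \<in> {1..p}" "v = u i" by auto
      then have "Ck_on 2 v \<Omega>" "psh S \<Omega> (\<lambda>q. ereal (v q))" using u by blast+
      then show ?thesis using psh_zeta_sum[OF op] by blast
    qed
    have len: "length us = p" by (simp add: us_def)
    have eq: "wedge_list (map (\<lambda>i. triangle_form S (u i) q) [1..<Suc p]) \<curlywedge> wedge_list (replicate (CARD('n) - p) beta_form)
        = mass_form S us (CARD('n) - p) q" if "q \<in> \<Omega>" for q
    proof -
      have "map (\<lambda>i. triangle_form S (u i) q) [1..<Suc p] = map (\<lambda>u. hess S theta0 theta1 u q) us"
        unfolding us_def map_map o_def
        by (rule map_cong[OF refl]) (use u that in \<open>auto intro!: triangle_form_eq_hess[OF op]\<close>)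
      then show ?thesis by (simp only: mass_form_def)
    qed
    \<comment> \<open>\<open>triangle_form\<close> is identified with \<open>hess\<close> on
      \<Omega>, and L lies in \<Omega>.\<close>
    have norm: "form_norm (CARD('n) - p) (\<lambda>q. wedge_list (map (\<lambda>i. triangle_form S (u i) q) [1..<Suc p])) L
        = (LINT q:L|lborel. top_coeff (mass_form S us (CARD('n) - p) q))"
      unfolding form_norm_def form_integral_def set_lebesgue_integral_def
    proof (rule Bochner_Integration.integral_cong[OF refl])
      fix q
      show "indicat_real L q *\<^sub>R top_coeff (wedge_list (map (\<lambda>i. triangle_form S (u i) q) [1..<Suc p]) \<curlywedge> wedge_list (replicate (CARD('n) - p) beta_form))
          = indicat_real L q *\<^sub>R top_coeff (mass_form S us (CARD('n) - p) q)"
        using eq[of q] L\<Omega> by (cases "q \<in> L") auto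
    qed
    have prod: "(\<Prod>u\<leftarrow>us. C0_norm u K) = (\<Prod>i = 1..p. C0_norm (u i) K)"
      unfolding us_def map_map o_def by (rule prod_list_upt)
    obtain q where q: "q \<in> K" using False by blast
    have "0 \<le> C0_norm (u i) K" if "i \<in> {1..p}" for i
    proof -
      have "Ck_on 2 (u i) \<Omega>" using u that by blast
      then have "continuous_on K (u i)"
        using continuous_on_subset[OF Ck_on_continuous \<Omega>(2)] by blast
      from C0_norm_bound[OF assms(3) this q] show ?thesis by (rule order_trans[OF abs_ge_zero])
    qed
    then have pos: "0 \<le> (\<Prod>i = 1..p. C0_norm (u i) K)" by (intro prod_nonneg) auto
    \<comment> \<open>The claim compares complex numbers, so the left side must also be
      real.\<close>
    have "0 \<le> (LINT q:L|lborel. top_coeff (mass_form S us (CARD('n) - p) q))"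
      using us by (intro mass_form_nonneg[OF assms(4) L\<Omega> op]) blast+
    moreover have "Re (LINT q:L|lborel. top_coeff (mass_form S us (CARD('n) - p) q)) \<le> C p * (\<Prod>i = 1..p. C0_norm (u i) K)"
      unfolding prod[symmetric]
      by (rule C[THEN spec, THEN conjunct2, rule_format, OF op \<Omega>(2) len us])
    moreover have "C p * (\<Prod>i = 1..p. C0_norm (u i) K) \<le> (\<Sum>p\<le>CARD('n). C p) * (\<Prod>i = 1..p. C0_norm (u i) K)"
      using C p(2) by (intro mult_right_mono pos member_le_sum) auto
    ultimately show "form_norm (CARD('n) - p) (\<lambda>q. wedge_list (map (\<lambda>i. triangle_form S (u i) q) [1..<Suc p])) L
       \<le> complex_of_real ((\<Sum>p\<le>CARD('n). C p) * (\<Prod>i = 1..p. C0_norm (u i) K))"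
      unfolding norm by (simp add: less_eq_complex_def del: of_real_mult of_real_sum of_real_prod)
  qed
qed

end
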